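(* For every ergodic, aperiodic and probability measure preserving dynamical system $(X,\mathcal{B},m,T)$ there exists a square integrable function $f:X\to\mathbb{Z}$ with $\int f\,dm=0$ which satisfies the lattice local central limit theorem.
   Context: For a function $f$ on $X$, write $S_n(f):=\sum_{k=0}^{n-1}f\circ T^k$, and let $\|\cdot\|_2$ be the norm of $L^2(X,m)$. A function $f:X\to\mathbb{Z}$ with $\int f\,dm=0$ such that $\lim_{n\to\infty}\frac{\|S_n(f)\|_2^2}{n}=\sigma^2>0$ satisfies a lattice local central limit theorem if $$\sup_{x\in\mathbb{Z}}\left|\sqrt{n}\cdot m\left(S_n(f)=x\right)-\frac{e^{-x^2/(2n\sigma^2)}}{\sqrt{2\pi\sigma^2}}\right|\xrightarrow[n\to\infty]{}0 .$$ Aperiodic has its usual meaning: the set of periodic points $\{x\in X:\ T^jx=x\text{ for some } j\ge 1\}$ is $m$-null.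
   Formalization: The probability space is assumed standard (Polish up to null sets, Borel or completed), the usual convention; without it the claim fails, e.g. for the shift on the integers with the trivial sigma-algebra, where only constant functions are measurable. *)

theory Defs
  imports "HOL-Probability.Probability"
begin

definition polish_topology :: "'a topology \<Rightarrow> bool" where
  "polish_topology S \<longleftrightarrow> completely_metrizable_space S \<and> second_countable S"

definition borel_sets_of :: "'a topology \<Rightarrow> 'a set set" where
  "borel_sets_of S = sigma_sets (topspace S) {U. openin S U}"

text \<open>
  Standard probability space, in the mod 0 sense: up to a null set, the measurable sets
  lie between the Borel sets of a Polish topology and their completion. This covers
  standard Borel probability spaces as well as (complete) Lebesgue-Rokhlin spaces.
  Some such convention is indispensable: a probability space with trivial
  sigma-algebra \<open>{{}, space M}\<close> admits only constant measurable functions, although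
  every self-map of it is ergodic and measure preserving.
\<close>

definition standard_prob_space :: "'a measure \<Rightarrow> bool" where
  "standard_prob_space M \<longleftrightarrow>
     prob_space M \<and>
     (\<exists>S. polish_topology S \<and> borel_sets_of S \<subseteq> sets M \<and> measure M (topspace S) = 1 \<and>
        (\<forall>A\<in>sets M. \<exists>B\<in>borel_sets_of S. \<exists>C\<in>borel_sets_of S.
           B \<subseteq> A \<inter> topspace S \<and> A \<inter> topspace S \<subseteq> C \<and> measure M (C - B) = 0))"

text \<open>The transformation is not required to be invertible.\<close>

definition measure_preserving_map :: "'a measure \<Rightarrow> ('a \<Rightarrow> 'a) \<Rightarrow> bool" where
  "measure_preserving_map M T \<longleftrightarrow> T \<in> measurable M M \<and> distr M M T = M"

definition ergodic_map :: "'a measure \<Rightarrow> ('a \<Rightarrow> 'a) \<Rightarrow> bool" where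
  "ergodic_map M T \<longleftrightarrow>
     (\<forall>A\<in>sets M. T -` A \<inter> space M = A \<longrightarrow> measure M A = 0 \<or> measure M A = 1)"

text \<open>
  Stated with \<open>AE\<close>, so that the set of periodic points only has to be contained in a
  measurable null set.
\<close>

definition aperiodic_map :: "'a measure \<Rightarrow> ('a \<Rightarrow> 'a) \<Rightarrow> bool" where
  "aperiodic_map M T \<longleftrightarrow> (AE x in M. \<not> (\<exists>j\<ge>1. (T ^^ j) x = x))"

definition birkhoff_sum :: "('a \<Rightarrow> 'a) \<Rightarrow> ('a \<Rightarrow> int) \<Rightarrow> nat \<Rightarrow> 'a \<Rightarrow> int" where
  "birkhoff_sum T f n x = (\<Sum>k<n. f ((T ^^ k) x))"

definition L2_norm :: "'a measure \<Rightarrow> ('a \<Rightarrow> real) \<Rightarrow> real" where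
  "L2_norm M g = sqrt (\<integral>x. (g x)\<^sup>2 \<partial>M)"

definition lattice_LCLT :: "'a measure \<Rightarrow> ('a \<Rightarrow> 'a) \<Rightarrow> ('a \<Rightarrow> int) \<Rightarrow> bool" where
  "lattice_LCLT M T f \<longleftrightarrow>
     (\<exists>v::real. v > 0 \<and>
        (\<lambda>n. (L2_norm M (\<lambda>x. real_of_int (birkhoff_sum T f n x)))\<^sup>2 / real n) \<longlonglongrightarrow> v \<and>
        (\<lambda>n. SUP x::int.
           \<bar>sqrt (real n) * measure M {y \<in> space M. birkhoff_sum T f n y = x}
            - exp (- (real_of_int x)\<^sup>2 / (2 * real n * v)) / sqrt (2 * pi * v)\<bar>)
          \<longlonglongrightarrow> 0)"

end

theory Submission
  imports Defs
begin

text \<open>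
  The function is a sum \<open>f = f\<^sub>0 + f\<^sub>1 + \<dots>\<close> of coboundaries \<open>f\<^sub>k = e\<^sub>k - e\<^sub>k \<circ> T\<^sup>d\<close> with \<open>d = d\<^sub>k\<close>, where \<open>e\<^sub>k\<close> is
  a moving average of length \<open>j\<^sub>k\<close> of a sparse process \<open>\<xi>\<^sub>k \<circ> T\<^sup>s\<close> with values in \<open>{-1, 0, 1}\<close>. The process
  behaves, on very long orbit segments, like an i.i.d. process independent of the earlier \<open>f\<^sub>i\<close>, up
  to an error as small as desired. This is achieved on a Rokhlin tower: a letter from a huge
  alphabet, attached to the base and spread out over the tower, is asymptotically independent of any
  given finite partition, because the digits of a uniform random variable are orthogonal.

  At time \<open>n\<close> the Birkhoff sum of \<open>f\<^sub>k\<close> has variance about \<open>2 n / (k + 1)\<close> if \<open>j\<^sub>k \<ll> n \<ll> d\<^sub>k\<close>, and \<open>o(n)\<close>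
  in total for the other \<open>k\<close>. With \<open>d\<^sub>k = j\<^bsub>2k\<^esub>\<close> and \<open>j\<^sub>k\<close> growing quickly, the active \<open>k\<close> are those
  with \<open>m/2 < k < m\<close> when \<open>n\<close> is about \<open>j\<^sub>m\<close>, so the variance is asymptotically \<open>2 n ln 2\<close>. The finitely many
  \<open>f\<^sub>k\<close> whose independence has run out by time \<open>n\<close> are coboundaries of negligible size, and to
  the remaining independent part the characteristic function method applies; consecutive \<open>j\<^sub>k\<close> are coprime,
  which excludes lattice obstructions.
\<close>

section \<open>Rokhlin towers and nearly independent processes\<close>

text \<open>Since \<open>f\<close> must be integer valued, a summand cannot be rescaled; its size is
  tuned by the sparsity of \<open>\<xi>\<close> instead. The weights 1/(k + 1) meet two demands:
  they tend to 0, so a summand that is just entering or leaving its active range disturbs the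
  variance by o(n) only and the limit exists along all n; and their sum over a window from m/2 to m
  converges. As they are not summable, summands behaving like i.i.d. sequences of that variance
  would not add up to a square integrable function. The moving average repairs this: it lowers the
  second moment of f_k itself to about 2/((k + 1) blk k), while the Birkhoff sums reach their full
  variance once n is much larger than blk k. The price is that at such times the coefficients of the
  letters are mostly plus or minus blk k, whence the danger of a lattice obstruction. The coboundary
  form answers another obstacle: independence can be arranged only on orbit segments of bounded
  length, so the Birkhoff sums of f_k must stay bounded at all later times.\<close>

locale ergodic_pt = prob_space M for M :: "'a measure" +
  fixes T :: "'a \<Rightarrow> 'a"
  assumes mpt: "measure_preserving_map M T" and erg: "ergodic_map M T"
begin

lemma T_measurable [measurable]: "T \<in> measurable M M"
  using mpt by (simp add: measure_preserving_map_def)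

lemma T_pow_measurable [measurable]: "(T ^^ n) \<in> measurable M M"
  by (induction n) (auto simp: id_def o_def)

lemma T_pow_space [simp]: "x \<in> space M \<Longrightarrow> (T ^^ n) x \<in> space M"
  using measurable_space[OF T_pow_measurable] .

lemma T_pow_add: "(T ^^ i) ((T ^^ j) x) = (T ^^ (i + j)) x"
  by (simp add: funpow_add)

lemma distr_T_pow: "distr M M (T ^^ n) = M"
proof (induction n)
  case 0
  show ?case by (simp add: id_def distr_id)
next
  case (Suc n)
  have "distr M M (T ^^ Suc n) = distr (distr M M (T ^^ n)) M T"
    by (subst distr_distr) (auto simp: o_def)
  then show ?case
    using Suc.IH mpt by (metis measure_preserving_map_def)
qed

lemma prob_T_pow:
  assumes [measurable]: "Measurable.pred M P"
  shows "\<P>(x in M. P ((T ^^ n) x)) = \<P>(x in M. P x)"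
proof -
  have "\<P>(x in M. P x) = measure (distr M M (T ^^ n)) {x \<in> space M. P x}"
    by (simp add: distr_T_pow)
  also have "\<dots> = prob ((T ^^ n) -` {x \<in> space M. P x} \<inter> space M)"
    by (rule measure_distr) auto
  also have "(T ^^ n) -` {x \<in> space M. P x} \<inter> space M = {x \<in> space M. P ((T ^^ n) x)}"
    by auto
  finally show ?thesis ..
qed

lemma integral_T_pow:
  fixes g :: "'a \<Rightarrow> real"
  assumes [measurable]: "g \<in> borel_measurable M"
  shows "(\<integral>x. g ((T ^^ n) x) \<partial>M) = (\<integral>x. g x \<partial>M)"
  using integral_distr[of "T ^^ n" M M g] by (simp add: distr_T_pow)

lemma integrable_T_pow:
  fixes g :: "'a \<Rightarrow> real"
  assumes "integrable M g"
  shows "integrable M (\<lambda>x. g ((T ^^ n) x))"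
  using integrable_distr[of "T ^^ n" M M g] assms by (simp add: distr_T_pow)

lemma AE_T_pow:
  assumes [measurable]: "Measurable.pred M P" and "AE x in M. P x"
  shows "AE x in M. P ((T ^^ n) x)"
proof -
  have "AE x in distr M M (T ^^ n). P x" using assms(2) by (subst distr_T_pow)
  then show ?thesis by (subst (asm) AE_distr_iff) auto
qed

text \<open>\<open>ergodic_map\<close> speaks only of sets that equal their preimage, so the set
  \<open>I\<close> of points with infinitely many visits is used, which is exactly invariant. Each
  \<open>U N\<close> contains the N-th preimage of A, hence \<open>I\<close> has at least the
  measure of A.\<close>

lemma AE_visits:
  assumes [measurable]: "A \<in> sets M" and pos: "0 < prob A"
  shows "AE x in M. \<exists>n. (T ^^ n) x \<in> A"
proof -
  define U where "U N = {x \<in> space M. \<exists>n\<ge>N. (T ^^ n) x \<in> A}" for N :: nat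
  define I where "I = (\<Inter>N. U N)"
  have Um [measurable]: "U N \<in> sets M" for N unfolding U_def by measurable
  have Im [measurable]: "I \<in> sets M" unfolding I_def by measurable
  have "prob A \<le> prob (U N)" for N
  proof -
    have "prob A = \<P>(x in M. x \<in> A)"
      by (rule arg_cong[where f=prob]) (use sets.sets_into_space[OF assms(1)] in auto)
    also have "\<dots> = \<P>(x in M. (T ^^ N) x \<in> A)" by (rule prob_T_pow[symmetric]) measurable
    also have "\<dots> \<le> prob (U N)" by (rule finite_measure_mono) (auto simp: U_def)
    finally show ?thesis .
  qed
  moreover have "(\<lambda>N. prob (U N)) \<longlonglongrightarrow> prob I"
    unfolding I_def by (rule finite_Lim_measure_decseq) (auto simp: decseq_def U_def intro: order_trans)
  ultimately have "prob A \<le> prob I" by (intro LIMSEQ_le_const) auto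
  moreover have "T -` I \<inter> space M = I"
  proof (intro equalityI subsetI)
    fix x assume x: "x \<in> T -` I \<inter> space M"
    have "\<exists>n\<ge>N. (T ^^ n) x \<in> A" for N
    proof -
      obtain n where "n \<ge> N" "(T ^^ n) (T x) \<in> A" using x by (auto simp: I_def U_def)
      then show ?thesis by (intro exI[of _ "Suc n"]) (auto simp: funpow_swap1)
    qed
    then show "x \<in> I" using x by (auto simp: I_def U_def)
  next
    fix x assume x: "x \<in> I"
    then have sp: "x \<in> space M" by (auto simp: I_def U_def)
    have "\<exists>n\<ge>N. (T ^^ n) (T x) \<in> A" for N
    proof -
      obtain n where n: "n \<ge> Suc N" "(T ^^ n) x \<in> A" using x by (auto simp: I_def U_def)
      then obtain k where "n = Suc k" by (cases n) auto
      then show ?thesis using n by (intro exI[of _ k]) (auto simp: funpow_swap1)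
    qed
    then show "x \<in> T -` I \<inter> space M"
      using sp measurable_space[OF T_measurable sp] by (auto simp: I_def U_def)
  qed
  ultimately have "prob I = 1" using erg pos Im unfolding ergodic_map_def by fastforce
  then have "AE x in M. x \<in> I" by (intro AE_prob_1)
  then show ?thesis by eventually_elim (auto simp: I_def U_def)
qed

text \<open>With \<open>r\<close> the time to reach a small set A, the base consists of the points
  whose \<open>r\<close> is a positive multiple of H. Almost every orbit that misses the base for H
  steps hits A within 2 H steps, so the exceptional set is covered by 2 H preimages of A, of total
  measure below e.\<close>

lemma rokhlin_tower:
  assumes small: "\<And>e. 0 < e \<Longrightarrow> \<exists>A\<in>sets M. 0 < prob A \<and> prob A < e"
    and H: "0 < H" and e: "0 < e"
  obtains B where "B \<in> sets M"
    "\<And>x i j. i < H \<Longrightarrow> j < H \<Longrightarrow> (T ^^ i) x \<in> B \<Longrightarrow> (T ^^ j) x \<in> B \<Longrightarrow> i = j"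
    "\<P>(x in M. \<forall>i<H. (T ^^ i) x \<notin> B) < e"
proof -
  obtain A where A [measurable]: "A \<in> sets M" and A0: "0 < prob A" and A1: "prob A < e / (2 * H)"
    using small[of "e / (2 * H)"] H e by auto
  define r where "r x = (LEAST n. (T ^^ n) x \<in> A)" for x
  define V where "V = {x \<in> space M. \<exists>n. (T ^^ n) x \<in> A}"
  have V [measurable]: "V \<in> sets M" unfolding V_def by measurable
  have [measurable]: "r \<in> measurable M (count_space UNIV)" unfolding r_def by measurable
  \<comment> \<open>\<open>H \<le> r x\<close> prevents the orbit from reaching A during the next H
    - 1 steps; meanwhile \<open>r\<close> drops by one per step, so two visits in one window would
    be a multiple of H apart.\<close>
  define B where "B = {x \<in> space M. x \<in> V \<and> H dvd r x \<and> H \<le> r x}"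
  have r_shift: "(T ^^ i) x \<in> V \<and> r ((T ^^ i) x) = r x - i" if "x \<in> V" "i \<le> r x" for x i
  proof -
    have hit: "(T ^^ r x) x \<in> A" using that unfolding V_def r_def by (auto intro: LeastI)
    have "(T ^^ (r x - i)) ((T ^^ i) x) \<in> A" using hit that by (simp add: T_pow_add)
    moreover have "r x - i \<le> n" if "(T ^^ n) ((T ^^ i) x) \<in> A" for n
      using that Least_le[of "\<lambda>n. (T ^^ n) x \<in> A" "n + i"] by (simp add: T_pow_add r_def)
    ultimately have "r ((T ^^ i) x) = r x - i" unfolding r_def[of "(T ^^ i) x"]
      by (intro Least_equality) auto
    moreover have "(T ^^ i) x \<in> V"
      using \<open>x \<in> V\<close> \<open>(T ^^ (r x - i)) ((T ^^ i) x) \<in> A\<close> T_pow_space[of x i] unfolding V_def by auto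
    ultimately show ?thesis by simp
  qed
  have sep: "\<not> ((T ^^ i) x \<in> B \<and> (T ^^ j) x \<in> B)" if "i < j" "j < H" for x i j
  proof
    assume *: "(T ^^ i) x \<in> B \<and> (T ^^ j) x \<in> B"
    define y where "y = (T ^^ i) x"
    have y: "y \<in> V" "H dvd r y" "H \<le> r y" using * by (auto simp: B_def y_def)
    have "(T ^^ j) x = (T ^^ (j - i)) y" using that by (simp add: y_def T_pow_add)
    then have "H dvd r y - (j - i)" using * r_shift[OF y(1), of "j - i"] y that by (auto simp: B_def)
    then have "H dvd j - i" using y that
      by (metis dvd_diff_nat diff_diff_cancel diff_le_self le_trans less_imp_le_nat)
    then show False using that by (auto dest: dvd_imp_le)
  qed
  show ?thesis
  proof
    show [measurable]: "B \<in> sets M" unfolding B_def by measurable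
    show "i = j" if "i < H" "j < H" "(T ^^ i) x \<in> B" "(T ^^ j) x \<in> B" for x i j
      using sep[of i j x] sep[of j i x] that by (metis nat_neq_iff)
    have "AE x in M. x \<in> V" using AE_visits[OF A A0] AE_space by eventually_elim (auto simp: V_def)
    have cov: "x \<in> (\<Union>i<2*H. {x \<in> space M. (T ^^ i) x \<in> A})"
      if x: "x \<in> V" "\<forall>i<H. (T ^^ i) x \<notin> B" for x
    proof -
      have sp: "x \<in> space M" and hit: "(T ^^ r x) x \<in> A"
        using x unfolding V_def r_def by (auto intro: LeastI)
      have "r x < 2 * H"
      proof (rule ccontr)
        assume c: "\<not> r x < 2 * H"
        \<comment> \<open>After the remainder of \<open>r\<close> modulo H the waiting time is
          divisible by H, and by \<open>c\<close> it is still at least H.\<close>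
        define i where "i = r x mod H"
        have i: "i < H" "i \<le> r x" using H by (auto simp: i_def)
        have "H dvd r x - i" unfolding i_def by (simp add: dvd_minus_mod)
        then have "(T ^^ i) x \<in> B" using r_shift[OF x(1) i(2)] c i sp by (auto simp: B_def)
        then show False using x i by auto
      qed
      then show ?thesis using hit sp by auto
    qed
    have "\<P>(x in M. \<forall>i<H. (T ^^ i) x \<notin> B) \<le> prob (\<Union>i<2*H. {x \<in> space M. (T ^^ i) x \<in> A})"
      by (rule finite_measure_mono_AE) (use \<open>AE x in M. x \<in> V\<close> cov in \<open>auto elim!: eventually_mono\<close>)
    also have "\<dots> \<le> (\<Sum>i<2*H. \<P>(x in M. (T ^^ i) x \<in> A))"
      by (rule finite_measure_subadditive_finite) auto
    also have "\<dots> = (\<Sum>i<2*H. \<P>(x in M. x \<in> A))"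
      by (intro sum.cong refl prob_T_pow) measurable
    also have "\<dots> = 2 * H * prob A"
      using sets.sets_into_space[OF A] by (simp add: Int_absorb1 Int_def[symmetric] inf_commute)
    also have "\<dots> < e" using A1 H by (simp add: field_simps)
    finally show "\<P>(x in M. \<forall>i<H. (T ^^ i) x \<notin> B) < e" .
  qed
qed

end

section \<open>Uniform random variables and their digits\<close>

definition (in prob_space) uniform01 :: "('a \<Rightarrow> real) \<Rightarrow> bool" where
  "uniform01 U \<longleftrightarrow> U \<in> borel_measurable M \<and> (\<forall>x. 0 \<le> U x) \<and>
    (\<forall>s. 0 \<le> s \<longrightarrow> s \<le> 1 \<longrightarrow> \<P>(x in M. U x < s) = s)"

text \<open>Probability integral transform. Without atoms the distribution function F is continuous,
  and U = F(h) works: U < s = F t forces h \<le> t. Conversely h \<le> t gives only U \<le> F t, so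
  strictness is bought with F t slightly below s.\<close>

lemma (in prob_space) cdf_transform_uniform:
  fixes h :: "'a \<Rightarrow> real"
  assumes [measurable]: "h \<in> borel_measurable M"
    and atomless: "\<And>t. \<P>(x in M. h x = t) = 0"
  obtains U where "uniform01 U"
proof -
  interpret D: real_distribution "distr M borel h"
    by (rule real_distribution_distr) measurable
  define F where "F = cdf (distr M borel h)"
  have Fh: "F t = \<P>(x in M. h x \<le> t)" for t
    unfolding F_def cdf_def by (subst measure_distr) (auto intro!: arg_cong[where f=prob])
  have mono: "F s \<le> F t" if "s \<le> t" for s t
    using D.cdf_nondecreasing that by (simp add: F_def)
  have "isCont F t" for t
    unfolding F_def D.isCont_cdf using atomless[of t]
    by (subst measure_distr) (auto simp: vimage_def Int_def conj_commute)
  have ivt: "\<exists>t. F t = s" if s: "0 < s" "s < 1" for s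
  proof -
    have "eventually (\<lambda>t. F t < s) at_bot"
      using order_tendstoD(2)[OF D.cdf_lim_at_bot s(1)] by (simp add: F_def)
    then obtain a where a: "F a < s" by (auto simp: eventually_at_bot_linorder)
    have "eventually (\<lambda>t. s < F t) at_top"
      using order_tendstoD(1)[OF D.cdf_lim_at_top_prob s(2)] by (simp add: F_def)
    then obtain b where b: "s < F b" by (auto simp: eventually_at_top_linorder)
    have "a \<le> b" using a b mono[of b a] by linarith
    then show ?thesis using IVT'[of F a s b] a b \<open>\<And>t. isCont F t\<close>
      by (auto intro: continuous_at_imp_continuous_on)
  qed
  define U where "U x = F (h x)" for x
  have "F \<in> borel_measurable borel"
    by (intro borel_measurable_continuous_onI continuous_at_imp_continuous_on) (use \<open>\<And>t. isCont F t\<close> in auto)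
  then have Um [measurable]: "U \<in> borel_measurable M" unfolding U_def by measurable
  have U0: "0 \<le> U x" for x by (simp add: U_def Fh)
  have lower: "s \<le> \<P>(x in M. U x < s')" if s: "0 < s" "s < s'" "s < 1" for s s'
  proof -
    obtain t where t: "F t = s" using ivt s by blast
    have "U x < s'" if "h x \<le> t" for x using mono[OF that] t s by (simp add: U_def)
    then have "\<P>(x in M. h x \<le> t) \<le> \<P>(x in M. U x < s')"
      by (intro finite_measure_mono) auto
    then show ?thesis using t by (simp add: Fh)
  qed
  have lower': "s \<le> \<P>(x in M. U x < s)" if "0 < s" "s \<le> 1" for s
    by (rule dense_le_bounded[of 0]) (use lower that in auto)
  have "\<P>(x in M. U x < s) = s" if s: "0 \<le> s" "s \<le> 1" for s
  proof -
    consider "s = 0" | "s = 1" | "0 < s" "s < 1" using s by fastforce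
    then show ?thesis
    proof cases
      case 1
      then show ?thesis using U0 by (simp add: not_less[symmetric])
    next
      case 2
      then show ?thesis using lower'[of 1] prob_le_1 by (simp add: antisym)
    next
      case 3
      obtain t where t: "F t = s" using ivt 3 by blast
      have "x \<in> space M \<and> h x \<le> t" if "x \<in> space M" "U x < s" for x
        using mono[of t "h x"] t that by (force simp: U_def)
      then have "\<P>(x in M. U x < s) \<le> \<P>(x in M. h x \<le> t)"
        by (intro finite_measure_mono) auto
      then show ?thesis using lower'[of s] 3 t by (simp add: Fh)
    qed
  qed
  then have "uniform01 U" using Um U0 by (simp add: uniform01_def)
  then show ?thesis by (rule that)
qed

context prob_space begin

text \<open>By Bessel's inequality the squares of these inner products are summable.\<close>

lemma orthogonal_tendsto_0:
  fixes \<phi> :: "nat \<Rightarrow> 'a \<Rightarrow> real"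
  assumes meas [measurable]: "\<And>r. \<phi> r \<in> borel_measurable M"
    and bound: "\<And>r x. \<bar>\<phi> r x\<bar> \<le> 1"
    and orth: "\<And>r s. r < s \<Longrightarrow> (\<integral>x. \<phi> r x * \<phi> s x \<partial>M) = 0"
    and D [measurable]: "D \<in> sets M"
  shows "(\<lambda>r. \<integral>x. indicator D x * \<phi> r x \<partial>M) \<longlonglongrightarrow> 0"
proof -
  define I where "I x = (indicator D x :: real)" for x
  define c where "c r = (\<integral>x. I x * \<phi> r x \<partial>M)" for r
  have [measurable]: "I \<in> borel_measurable M" unfolding I_def by measurable
  have I01: "\<bar>I x\<bar> \<le> 1" for x by (simp add: I_def indicator_def)
  have int: "integrable M g" if "g \<in> borel_measurable M" "\<And>x. \<bar>g x\<bar> \<le> 1" for g :: "'a \<Rightarrow> real"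
    by (rule integrable_const_bound[of _ 1]) (use that in auto)
  have ij: "integrable M (\<lambda>x. \<phi> r x * \<phi> s x)" "integrable M (\<lambda>x. I x * \<phi> r x)" "integrable M I"
    "integrable M (\<lambda>x. I x * I x)" for r s
    by (rule int, measurable, metis abs_mult mult_le_one abs_ge_zero bound I01)+
  have orth': "(\<integral>x. \<phi> r x * \<phi> s x \<partial>M) = 0" if "r \<noteq> s" for r s
    using orth[of r s] orth[of s r] that by (cases "r < s") (auto simp: mult.commute)
  have norm1: "(\<integral>x. \<phi> r x * \<phi> r x \<partial>M) \<le> 1" for r
    by (rule integral_le_const[OF ij(1)]) (use bound in \<open>simp add: abs_square_le_1[symmetric] power2_eq_square[symmetric]\<close>)
  have "(\<Sum>r<R. (c r)\<^sup>2) \<le> 1" for R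
  proof -
    \<comment> \<open>Squared distance of the indicator from the sum of the
      \<open>c r * \<phi> r\<close>. As the \<open>\<phi> r\<close> have norm at most 1, it is at
      most 1 minus the sum of the squares of the coefficients.\<close>
    have "0 \<le> (\<integral>x. (I x - (\<Sum>r<R. c r * \<phi> r x))\<^sup>2 \<partial>M)" by simp
    also have "\<dots> = (\<integral>x. I x * I x - 2 * (\<Sum>r<R. c r * (I x * \<phi> r x))
        + (\<Sum>r<R. \<Sum>s<R. c r * c s * (\<phi> r x * \<phi> s x)) \<partial>M)"
      by (intro Bochner_Integration.integral_cong refl)
        (simp add: power2_eq_square algebra_simps sum_product sum_distrib_left)
    also have "\<dots> = (\<integral>x. I x * I x \<partial>M) - 2 * (\<Sum>r<R. c r * c r)
        + (\<Sum>r<R. \<Sum>s<R. c r * c s * (\<integral>x. \<phi> r x * \<phi> s x \<partial>M))"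
      using ij by (simp add: c_def)
    also have "(\<Sum>r<R. \<Sum>s<R. c r * c s * (\<integral>x. \<phi> r x * \<phi> s x \<partial>M))
        = (\<Sum>r<R. c r * c r * (\<integral>x. \<phi> r x * \<phi> r x \<partial>M))"
    proof (rule sum.cong[OF refl])
      fix r assume "r \<in> {..<R}"
      then show "(\<Sum>s<R. c r * c s * (\<integral>x. \<phi> r x * \<phi> s x \<partial>M)) = c r * c r * (\<integral>x. \<phi> r x * \<phi> r x \<partial>M)"
        by (subst sum.remove[of _ r]) (auto intro!: sum.neutral simp: orth')
    qed
    also have "\<dots> \<le> (\<Sum>r<R. c r * c r)"
      by (intro sum_mono) (use norm1 in \<open>simp add: mult_left_le\<close>)
    also have "(\<integral>x. I x * I x \<partial>M) \<le> 1"
      by (rule integral_le_const[OF ij(4)]) (simp add: I_def indicator_def)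
    finally show ?thesis by (simp add: power2_eq_square)
  qed
  then have "(\<Sum>r\<le>R. (c r)\<^sup>2) \<le> 1" for R unfolding lessThan_Suc_atMost[symmetric] .
  then have "summable (\<lambda>r. (c r)\<^sup>2)" by (intro bounded_imp_summable[where B=1]) auto
  then have "(\<lambda>r. (c r)\<^sup>2) \<longlonglongrightarrow> 0" by (rule summable_LIMSEQ_zero)
  then have "(\<lambda>r. sqrt ((c r)\<^sup>2)) \<longlonglongrightarrow> 0" using tendsto_real_sqrt by fastforce
  then show ?thesis by (simp add: c_def I_def tendsto_rabs_zero_iff)
qed

text \<open>\<open>G r\<close> is digit number r + 1 of U in base m, and \<open>Z r\<close> the
  integer formed by the first r digits. Given \<open>Z s\<close>, all earlier digits are determined
  while \<open>G s\<close> is still uniform, so any two digits are independent.\<close>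

lemma pairwise_independent_digits:
  fixes U :: "'a \<Rightarrow> real" and m :: nat
  assumes U: "uniform01 U" and m: "0 < m"
  obtains G :: "nat \<Rightarrow> 'a \<Rightarrow> nat" where "\<And>r. G r \<in> measurable M (count_space UNIV)"
    "\<And>r x. G r x < m"
    "\<And>r a. a < m \<Longrightarrow> \<P>(x in M. G r x = a) = 1 / m"
    "\<And>r s a b. r < s \<Longrightarrow> a < m \<Longrightarrow> b < m \<Longrightarrow>
       \<P>(x in M. G r x = a \<and> G s x = b) = 1 / m * (1 / m)"
proof -
  have [measurable]: "U \<in> borel_measurable M" and U0: "\<And>x. 0 \<le> U x"
    and unif: "\<And>s. 0 \<le> s \<Longrightarrow> s \<le> 1 \<Longrightarrow> \<P>(x in M. U x < s) = s"
    using U by (auto simp: uniform01_def)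
  define Z where "Z r x = nat \<lfloor>real m ^ r * U x\<rfloor>" for r x
  define G where "G r x = Z (Suc r) x mod m" for r x
  have [measurable]: "Z r \<in> measurable M (count_space UNIV)" for r unfolding Z_def by measurable
  have Gm: "G r \<in> measurable M (count_space UNIV)" for r unfolding G_def by measurable
  note [measurable] = Gm
  have Z_iff: "Z r x = z \<longleftrightarrow> real z / real m ^ r \<le> U x \<and> U x < (real z + 1) / real m ^ r" for r x z
  proof -
    have "Z r x = z \<longleftrightarrow> \<lfloor>real m ^ r * U x\<rfloor> = int z"
      using U0[of x] m by (auto simp: Z_def)
    also have "\<dots> \<longleftrightarrow> real z \<le> real m ^ r * U x \<and> real m ^ r * U x < real z + 1"
      by (simp add: floor_eq_iff add.commute)
    also have "\<dots> \<longleftrightarrow> real z / real m ^ r \<le> U x \<and> U x < (real z + 1) / real m ^ r"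
      using m by (simp add: field_simps)
    finally show ?thesis .
  qed
  have Z_div: "Z (Suc r) x div m = Z r x" for r x
  proof -
    have "Z r x = nat \<lfloor>(real m ^ Suc r * U x) / m\<rfloor>" using m by (simp add: Z_def)
    also have "\<dots> = nat (\<lfloor>real m ^ Suc r * U x\<rfloor> div int m)" using floor_divide_real_eq_div[of "int m" "real m ^ Suc r * U x"] by simp
    also have "\<dots> = Z (Suc r) x div m" by (simp add: Z_def nat_div_distrib')
    finally show ?thesis ..
  qed
  have Z_div_pow: "Z (k + r) x div m ^ k = Z r x" for k r x
    by (induction k) (simp_all add: Z_div div_mult2_eq)
  have PZ: "\<P>(x in M. Z r x = z) = 1 / m ^ r" if z: "z < m ^ r" for r z
  proof -
    have le: "(real z + 1) / real m ^ r \<le> 1"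
      using z m by (simp add: field_simps) (metis Suc_leI of_nat_Suc of_nat_le_iff of_nat_power add.commute)
    have "\<P>(x in M. Z r x = z) = prob ({x \<in> space M. U x < (real z + 1) / real m ^ r} - {x \<in> space M. U x < real z / real m ^ r})"
      by (rule arg_cong[where f=prob]) (auto simp: Z_iff)
    also have "\<dots> = \<P>(x in M. U x < (real z + 1) / real m ^ r) - \<P>(x in M. U x < real z / real m ^ r)"
      by (rule finite_measure_Diff) (auto simp: divide_right_mono intro: less_le_trans[where y="real z / real m ^ r"])
    also have "\<dots> = (real z + 1) / real m ^ r - real z / real m ^ r"
      using le order_trans[OF divide_right_mono[of "real z" "real z + 1" "real m ^ r"] le]
      by (subst (1 2) unif) auto
    finally show ?thesis by (simp add: add_divide_distrib)
  qed
  have PZG: "\<P>(x in M. Z r x = z \<and> G r x = b) = 1 / m ^ Suc r" if "z < m ^ r" "b < m" for r z b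
  proof -
    have "{x \<in> space M. Z r x = z \<and> G r x = b} = {x \<in> space M. Z (Suc r) x = m * z + b}"
      using that(2) by (auto simp: Z_div[symmetric, of r] G_def)
    moreover have "m * z + b < m ^ Suc r"
    proof -
      have "m * z + b < m * Suc z" using that by simp
      also have "\<dots> \<le> m * m ^ r" using that by (intro mult_le_mono) auto
      finally show ?thesis by simp
    qed
    ultimately show ?thesis using PZ[of "m * z + b" "Suc r"] by simp
  qed
  \<comment> \<open>U may reach 1 or more on a null set, so the range of \<open>Z r\<close> is
    controlled only almost everywhere.\<close>
  have AE_Z: "AE x in M. Z r x < m ^ r" for r
  proof -
    have "AE x in M. x \<in> {x \<in> space M. U x < 1}" by (rule AE_prob_1) (simp add: unif)
    then show ?thesis
    proof eventually_elim
      case (elim x)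
      then have "real m ^ r * U x < m ^ r" using m by simp
      then show ?case using U0[of x] by (simp add: Z_def floor_less_iff nat_less_iff)
    qed
  qed
  have split: "\<P>(x in M. P x) = (\<Sum>z<m ^ r. \<P>(x in M. Z r x = z \<and> P x))"
    if [measurable]: "Measurable.pred M P" for P r
  proof -
    have "\<P>(x in M. P x) = prob (\<Union>z\<in>{..<m ^ r}. {x \<in> space M. Z r x = z \<and> P x})"
      by (rule finite_measure_eq_AE) (use AE_Z[of r] in \<open>auto elim!: eventually_mono\<close>)
    also have "\<dots> = (\<Sum>z<m ^ r. \<P>(x in M. Z r x = z \<and> P x))"
      by (rule finite_measure_finite_Union) (auto simp: disjoint_family_on_def)
    finally show ?thesis .
  qed
  have PG: "\<P>(x in M. G r x = a) = 1 / m" if "a < m" for r a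
    using split[of "\<lambda>x. G r x = a" r] that m by (simp add: PZG)
  have PGG: "\<P>(x in M. G r x = a \<and> G s x = b) = 1 / m * (1 / m)"
    if "r < s" "a < m" "b < m" for r s a b
  proof -
    define H where "H z = (z div m ^ (s - Suc r)) mod m" for z
    have H: "G r x = H (Z s x)" for x
      using Z_div_pow[of "s - Suc r" "Suc r" x] that(1) by (simp add: G_def H_def)
    have "\<P>(x in M. Z s x = z \<and> G r x = a \<and> G s x = b)
        = 1 / m * \<P>(x in M. Z s x = z \<and> G r x = a)" if "z < m ^ s" for z
    proof (cases "H z = a")
      case True
      then have "{x \<in> space M. Z s x = z \<and> G r x = a \<and> G s x = b} = {x \<in> space M. Z s x = z \<and> G s x = b}"
        "{x \<in> space M. Z s x = z \<and> G r x = a} = {x \<in> space M. Z s x = z}" by (auto simp: H)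
      then show ?thesis using PZG[OF that \<open>b < m\<close>] PZ[OF that] by simp
    next
      case False
      then have "{x \<in> space M. Z s x = z \<and> G r x = a \<and> G s x = b} = {}"
        "{x \<in> space M. Z s x = z \<and> G r x = a} = {}" by (auto simp: H)
      then show ?thesis by (simp only: measure_empty mult_zero_right)
    qed
    then have "\<P>(x in M. G r x = a \<and> G s x = b) = (\<Sum>z<m ^ s. 1 / m * \<P>(x in M. Z s x = z \<and> G r x = a))"
      using split[of "\<lambda>x. G r x = a \<and> G s x = b" s] by simp
    also have "\<dots> = 1 / m * \<P>(x in M. G r x = a)"
      using split[of "\<lambda>x. G r x = a" s] by (simp add: sum_distrib_left)
    finally show ?thesis using PG[OF \<open>a < m\<close>] by simp
  qed
  show ?thesis using that[of G] Gm PG PGG m by (simp add: G_def)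
qed

end

context ergodic_pt begin

text \<open>The centred indicators of \<open>G r = g\<close>, composed with T^i, stay orthogonal for
  different r, so their inner products with the indicator of D tend to 0. There are finitely many
  triples (D, i, g), hence one late digit serves them all.\<close>

lemma approx_independent_letter:
  fixes U :: "'a \<Rightarrow> real" and m :: nat and \<D> :: "'a set set"
  assumes U: "uniform01 U" and m: "0 < m" and \<D>: "finite \<D>" "\<D> \<subseteq> sets M" and e: "0 < e"
  obtains G :: "'a \<Rightarrow> nat" where "G \<in> measurable M (count_space UNIV)" "\<And>x. G x < m"
    "\<And>D i g. D \<in> \<D> \<Longrightarrow> i < H \<Longrightarrow> g < m \<Longrightarrow>
       \<bar>prob {x \<in> D. G ((T ^^ i) x) = g} - prob D / m\<bar> < e"
proof -
  obtain G :: "nat \<Rightarrow> 'a \<Rightarrow> nat" where Gm [measurable]: "\<And>r. G r \<in> measurable M (count_space UNIV)"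
    and Gl: "\<And>r x. G r x < m"
    and G1: "\<And>r a. a < m \<Longrightarrow> \<P>(x in M. G r x = a) = 1 / m"
    and G2: "\<And>r s a b. r < s \<Longrightarrow> a < m \<Longrightarrow> b < m \<Longrightarrow>
       \<P>(x in M. G r x = a \<and> G s x = b) = 1 / m * (1 / m)"
    using pairwise_independent_digits[OF U m] by blast
  have lim: "(\<lambda>r. prob {x \<in> D. G r ((T ^^ i) x) = g} - prob D / m) \<longlonglongrightarrow> 0"
    if D [measurable]: "D \<in> sets M" and g: "g < m" for D i g
  proof -
    define \<phi> where "\<phi> r x = of_bool (G r ((T ^^ i) x) = g) - 1 / real m" for r x
    have m1: "1 / real m \<le> 1" "- 1 \<le> 1 / real m"
      using m order_trans[of "- 1" 0 "1 / real m"] by auto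
    have P1: "(\<integral>x. (of_bool (G r ((T ^^ i) x) = g) :: real) \<partial>M) = 1 / real m" for r
    proof -
      have "(\<integral>x. (of_bool (G r ((T ^^ i) x) = g) :: real) \<partial>M) = (\<integral>x. indicator {x \<in> space M. G r ((T ^^ i) x) = g} x \<partial>M)"
        by (rule Bochner_Integration.integral_cong) (auto simp: indicator_def)
      also have "\<dots> = \<P>(x in M. G r ((T ^^ i) x) = g)" by simp
      also have "\<dots> = 1 / m" using prob_T_pow[of "\<lambda>x. G r x = g" i] G1[OF g] by simp
      finally show ?thesis by simp
    qed
    have P2: "(\<integral>x. (of_bool (G r ((T ^^ i) x) = g) * of_bool (G s ((T ^^ i) x) = g) :: real) \<partial>M) = 1 / real m * (1 / real m)"
      if "r < s" for r s
    proof -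
      have "(\<integral>x. (of_bool (G r ((T ^^ i) x) = g) * of_bool (G s ((T ^^ i) x) = g) :: real) \<partial>M)
        = (\<integral>x. indicator {x \<in> space M. G r ((T ^^ i) x) = g \<and> G s ((T ^^ i) x) = g} x \<partial>M)"
        by (rule Bochner_Integration.integral_cong) (auto simp: indicator_def)
      also have "\<dots> = \<P>(x in M. G r ((T ^^ i) x) = g \<and> G s ((T ^^ i) x) = g)" by simp
      also have "\<dots> = 1 / m * (1 / m)"
        using prob_T_pow[of "\<lambda>x. G r x = g \<and> G s x = g" i] G2[OF that g g] by simp
      finally show ?thesis by simp
    qed
    have int: "integrable M f" if "f \<in> borel_measurable M" "\<And>x. \<bar>f x\<bar> \<le> 1" for f :: "'a \<Rightarrow> real"
      by (rule integrable_const_bound[of _ 1]) (use that in auto)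
    have "(\<lambda>r. \<integral>x. indicator D x * \<phi> r x \<partial>M) \<longlonglongrightarrow> 0"
    proof (rule orthogonal_tendsto_0)
      show "\<phi> r \<in> borel_measurable M" for r unfolding \<phi>_def by measurable
      show "\<bar>\<phi> r x\<bar> \<le> 1" for r x using m1 by (auto simp: \<phi>_def of_bool_def abs_le_iff)
      show "(\<integral>x. \<phi> r x * \<phi> s x \<partial>M) = 0" if "r < s" for r s
      proof -
        have ii: "integrable M (\<lambda>x. of_bool (G r ((T ^^ i) x) = g) :: real)"
          "integrable M (\<lambda>x. of_bool (G s ((T ^^ i) x) = g) :: real)"
          "integrable M (\<lambda>x. of_bool (G r ((T ^^ i) x) = g) * of_bool (G s ((T ^^ i) x) = g) :: real)"
          by (rule int; simp)+
        have "(\<integral>x. \<phi> r x * \<phi> s x \<partial>M) = (\<integral>x. of_bool (G r ((T ^^ i) x) = g) * of_bool (G s ((T ^^ i) x) = g)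
           - 1 / m * of_bool (G r ((T ^^ i) x) = g) - 1 / m * of_bool (G s ((T ^^ i) x) = g) + 1 / m * (1 / m) \<partial>M)"
          by (intro Bochner_Integration.integral_cong refl) (simp add: \<phi>_def algebra_simps)
        also have "\<dots> = 1 / m * (1 / m) - 1 / m * (1 / m) - 1 / m * (1 / m) + 1 / m * (1 / m)"
          using ii by (simp add: P1 P2[OF that] prob_space)
        finally show ?thesis by simp
      qed
    qed (use D in auto)
    moreover have "(\<integral>x. indicator D x * \<phi> r x \<partial>M) = prob {x \<in> D. G r ((T ^^ i) x) = g} - prob D / m" for r
    proof -
      have Ds: "D \<subseteq> space M" using sets.sets_into_space[OF D] .
      have [measurable]: "{x \<in> D. G r ((T ^^ i) x) = g} \<in> sets M"
      proof -
        have "{x \<in> D. G r ((T ^^ i) x) = g} = D \<inter> {x \<in> space M. G r ((T ^^ i) x) = g}" using Ds by auto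
        then show ?thesis by simp
      qed
      have "(\<integral>x. indicator D x * \<phi> r x \<partial>M) = (\<integral>x. indicator {x \<in> D. G r ((T ^^ i) x) = g} x - 1 / m * indicator D x \<partial>M)"
        by (intro Bochner_Integration.integral_cong refl) (auto simp: \<phi>_def indicator_def)
      also have "\<dots> = prob {x \<in> D. G r ((T ^^ i) x) = g} - prob D / m"
        by (subst Bochner_Integration.integral_diff) (auto simp: emeasure_eq_measure)
      finally show ?thesis .
    qed
    ultimately show ?thesis by simp
  qed
  have "\<forall>\<^sub>F r in sequentially. \<forall>(D, i, g)\<in>\<D> \<times> {..<H} \<times> {..<m}.
      \<bar>prob {x \<in> D. G r ((T ^^ i) x) = g} - prob D / m\<bar> < e"
  proof (rule eventually_ball_finite)
    show "\<forall>y\<in>\<D> \<times> {..<H} \<times> {..<m}. \<forall>\<^sub>F r in sequentially.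
      case y of (D, i, g) \<Rightarrow> \<bar>prob {x \<in> D. G r ((T ^^ i) x) = g} - prob D / m\<bar> < e"
    proof clarify
      fix D i g assume "D \<in> \<D>" "g < m"
      then show "\<forall>\<^sub>F r in sequentially. \<bar>prob {x \<in> D. G r ((T ^^ i) x) = g} - prob D / m\<bar> < e"
        using tendstoD[OF lim[of D g i] e] \<D> by (auto simp: dist_real_def)
    qed
  qed (use \<D> in auto)
  then obtain r where "\<forall>(D, i, g)\<in>\<D> \<times> {..<H} \<times> {..<m}.
      \<bar>prob {x \<in> D. G r ((T ^^ i) x) = g} - prob D / m\<bar> < e"
    using eventually_happens sequentially_bot by blast
  then show ?thesis by (intro that[of "G r"]) (use Gl in auto)
qed

text \<open>For names of a tower: a window of N orbit points starting at level i reads the distinct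
  positions \<open>\<tau> s = i - s\<close>, and the other H - N letters are free.\<close>

lemma card_PiE_prescribed:
  fixes H l :: nat
  assumes "N \<le> H" "inj_on \<tau> {..<N}" "\<tau> ` {..<N} \<subseteq> {..<H}" "\<And>s. s < N \<Longrightarrow> w s < l"
  shows "card {g \<in> {..<H} \<rightarrow>\<^sub>E {..<l}. \<forall>s<N. g (\<tau> s) = w s} = l ^ (H - N)"
proof -
  define J where "J = \<tau> ` {..<N}"
  define v where "v j = w (the_inv_into {..<N} \<tau> j)" for j
  have v: "v (\<tau> s) = w s" if "s < N" for s
    using that assms(2) by (simp add: v_def the_inv_into_f_f)
  have "{g \<in> {..<H} \<rightarrow>\<^sub>E {..<l}. \<forall>s<N. g (\<tau> s) = w s} = (\<Pi>\<^sub>E j\<in>{..<H}. if j \<in> J then {v j} else {..<l})"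
  proof (intro equalityI subsetI)
    fix g assume "g \<in> {g \<in> {..<H} \<rightarrow>\<^sub>E {..<l}. \<forall>s<N. g (\<tau> s) = w s}"
    then show "g \<in> (\<Pi>\<^sub>E j\<in>{..<H}. if j \<in> J then {v j} else {..<l})"
      by (auto simp: J_def v PiE_iff)
  next
    fix g assume g: "g \<in> (\<Pi>\<^sub>E j\<in>{..<H}. if j \<in> J then {v j} else {..<l})"
    have "g (\<tau> s) = w s" if "s < N" for s
      using g that assms(3) v[OF that] by (auto simp: PiE_iff J_def dest!: bspec[of _ _ "\<tau> s"])
    moreover have "g j < l" if "j < H" for j
    proof (cases "j \<in> J")
      case True
      then show ?thesis using PiE_mem[OF g, of j] that assms(4) v by (auto simp: J_def)
    next
      case False
      then show ?thesis using PiE_mem[OF g, of j] that by simp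
    qed
    ultimately show "g \<in> {g \<in> {..<H} \<rightarrow>\<^sub>E {..<l}. \<forall>s<N. g (\<tau> s) = w s}"
      using g by (auto simp: PiE_iff)
  qed
  then have "card {g \<in> {..<H} \<rightarrow>\<^sub>E {..<l}. \<forall>s<N. g (\<tau> s) = w s} = (\<Prod>j<H. if j \<in> J then 1 else l)"
    by (simp add: card_PiE if_distrib cong: if_cong)
  also have "\<dots> = l ^ card ({..<H} - J)"
    by (simp add: prod.If_cases Diff_eq)
  also have "card ({..<H} - J) = H - N"
    using assms(2,3) by (subst card_Diff_subset) (auto simp: J_def card_image)
  finally show ?thesis .
qed

text \<open>The letters \<open>\<xi>\<close> along the tower are read off a single letter \<open>G\<close> in \<open>l\<^sup>H\<close> attached to the point
  where the orbit \<^emph>\<open>enters\<close> the base; as \<open>T\<close> need not be invertible, the tower consists of the preimages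
  of its base.\<close>

lemma approx_independent_process:
  fixes U :: "'a \<Rightarrow> real" and Q :: "'a \<Rightarrow> 'c" and N l :: nat
  assumes U: "uniform01 U" and l: "0 < l" and Q [measurable]: "Q \<in> measurable M (count_space UNIV)"
    and C: "finite C" and e: "0 < e"
  obtains \<xi> :: "'a \<Rightarrow> nat" where "\<xi> \<in> measurable M (count_space UNIV)" "\<And>x. \<xi> x < l"
    "\<And>c w. c \<in> C \<Longrightarrow> w \<in> {..<N} \<rightarrow>\<^sub>E {..<l} \<Longrightarrow>
      \<bar>\<P>(x in M. Q x = c \<and> (\<forall>s<N. \<xi> ((T ^^ s) x) = w s)) - \<P>(x in M. Q x = c) / l ^ N\<bar> < e"
proof -
  have small: "\<exists>A\<in>sets M. 0 < prob A \<and> prob A < e" if "0 < e" for e :: real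
  proof -
    define s where "s = min 1 (e / 2)"
    have "0 < s" "s \<le> 1" "s < e" using that by (auto simp: s_def)
    moreover have [measurable]: "U \<in> borel_measurable M" using U by (simp add: uniform01_def)
    ultimately show ?thesis using U unfolding uniform01_def by (intro bexI[of _ "{x \<in> space M. U x < s}"]) auto
  qed
  \<comment> \<open>The N levels nearest to the base will be discarded; their total measure is at
    most N/H, hence at most e/8.\<close>
  define H where "H = Suc (N + nat \<lceil>8 * N / e\<rceil>)"
  have H0: "0 < H" "N < H" by (auto simp: H_def)
  have "8 * N / e \<le> real H" unfolding H_def using real_nat_ceiling_ge[of "8 * N / e"] by linarith
  then have HN: "N / H \<le> e / 8" using e H0 by (simp add: field_simps)
  obtain B where B [measurable]: "B \<in> sets M"
    and sep: "\<And>x i j. i < H \<Longrightarrow> j < H \<Longrightarrow> (T ^^ i) x \<in> B \<Longrightarrow> (T ^^ j) x \<in> B \<Longrightarrow> i = j"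
    and cov: "\<P>(x in M. \<forall>i<H. (T ^^ i) x \<notin> B) < e / 8"
    using rokhlin_tower[OF small H0(1), of "e / 8"] e by auto
  define W where "W = {..<H} \<rightarrow>\<^sub>E {..<l}"
  have finW: "finite W" unfolding W_def by (rule finite_PiE) auto
  have cardW: "card W = l ^ H" unfolding W_def by (simp add: card_PiE)
  then obtain name where name: "bij_betw name {..<l ^ H} W"
    using ex_bij_betw_nat_finite[OF finW] by (metis atLeast0LessThan)
  define D where "D i c = {x \<in> space M. (T ^^ i) x \<in> B \<and> Q x = c}" for i c
  have D [measurable]: "D i c \<in> sets M" for i c unfolding D_def by measurable
  have lH: "0 < l ^ H" using l by simp
  \<comment> \<open>There are at most l^H names on each of H levels, so these errors add up to at
    most e/4.\<close>
  define e' where "e' = e / (4 * H * l ^ H)"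
  have e': "0 < e'" using e H0 l by (simp add: e'_def)
  define \<D> where "\<D> = (\<lambda>(i, c). D i c) ` ({..<H} \<times> C)"
  have \<D>: "finite \<D>" "\<D> \<subseteq> sets M" using C by (auto simp: \<D>_def)
  obtain G :: "'a \<Rightarrow> nat" where G [measurable]: "G \<in> measurable M (count_space UNIV)" and Gl: "\<And>x. G x < l ^ H"
    and ind: "\<And>D i g. D \<in> \<D> \<Longrightarrow> i < H \<Longrightarrow> g < l ^ H \<Longrightarrow>
       \<bar>prob {x \<in> D. G ((T ^^ i) x) = g} - prob D / real (l ^ H)\<bar> < e'"
    by (rule approx_independent_letter[OF U lH \<D> e', of H], rule that)
  \<comment> \<open>Here i is the time left until the base is entered; off the tower the letter 0 is
    an arbitrary default.\<close>
  define \<xi> where "\<xi> x = (if \<exists>i<H. (T ^^ i) x \<in> B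
      then (let i = (LEAST i. (T ^^ i) x \<in> B) in name (G ((T ^^ i) x)) i) else 0)" for x
  have nameW: "name g \<in> W" if "g < l ^ H" for g using bij_betw_apply[OF name] that by auto
  have \<xi>_eq: "\<xi> x = name (G ((T ^^ i) x)) i" if "i < H" "(T ^^ i) x \<in> B" for x i
  proof -
    have "(LEAST i. (T ^^ i) x \<in> B) = i"
    proof (rule Least_equality)
      show "(T ^^ i) x \<in> B" by fact
    next
      fix j assume j: "(T ^^ j) x \<in> B"
      show "i \<le> j" using sep[OF that(1) _ that(2) j] by (cases "j < H") (use that(1) in auto)
    qed
    then show ?thesis using that by (auto simp: \<xi>_def Let_def)
  qed
  have \<xi>m [measurable]: "\<xi> \<in> measurable M (count_space UNIV)"
  proof -
    have [measurable]: "(\<lambda>x. name (G x) i) \<in> measurable M (count_space UNIV)" for i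
      by (rule measurable_compose[OF G]) simp
    have "(\<lambda>x. let i = (LEAST i. (T ^^ i) x \<in> B) in name (G ((T ^^ i) x)) i) \<in> measurable M (count_space UNIV)"
      unfolding Let_def
      by (rule measurable_compose_countable[where f="\<lambda>i x. name (G ((T ^^ i) x)) i" and g="\<lambda>x. LEAST i. (T ^^ i) x \<in> B"])
        measurable
    then show ?thesis unfolding \<xi>_def[abs_def] by measurable
  qed
  have \<xi>l: "\<xi> x < l" for x
  proof (cases "\<exists>i<H. (T ^^ i) x \<in> B")
    case True
    then obtain i where i: "i < H" "(T ^^ i) x \<in> B" by auto
    have "name (G ((T ^^ i) x)) \<in> W" using nameW Gl by blast
    then show ?thesis using \<xi>_eq[OF i] i(1) by (auto simp: W_def PiE_iff)
  qed (auto simp: \<xi>_def l)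
  have "\<bar>\<P>(x in M. Q x = c \<and> (\<forall>s<N. \<xi> ((T ^^ s) x) = w s)) - \<P>(x in M. Q x = c) / l ^ N\<bar> < e"
    if c: "c \<in> C" and w: "w \<in> {..<N} \<rightarrow>\<^sub>E {..<l}" for c w
  proof -
    define E where "E = {x \<in> space M. Q x = c \<and> (\<forall>s<N. \<xi> ((T ^^ s) x) = w s)}"
    define F where "F = {x \<in> space M. Q x = c}"
    have [measurable]: "E \<in> sets M" "F \<in> sets M" unfolding E_def F_def by measurable
    define X where "X i = {x \<in> space M. (T ^^ i) x \<in> B}" for i
    have [measurable]: "X i \<in> sets M" for i unfolding X_def by measurable
    \<comment> \<open>Discarded are the points off the tower and those fewer than N steps away from
      the base, whose windows may run past it.\<close>
    have decomp: "\<bar>prob S - (\<Sum>i\<in>{N..<H}. prob (S \<inter> X i))\<bar> \<le> e / 4" if [measurable]: "S \<in> sets M" for S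
    proof -
      have disj: "disjoint_family_on (\<lambda>i. S \<inter> X i) {..<H}"
        using sep by (auto simp: disjoint_family_on_def X_def)
      define R where "R = {x \<in> space M. \<forall>i<H. (T ^^ i) x \<notin> B}"
      have [measurable]: "R \<in> sets M" unfolding R_def by measurable
      have "prob S = prob ((S \<inter> R) \<union> (\<Union>i<H. S \<inter> X i))"
        using sets.sets_into_space[OF that] by (intro arg_cong[where f=prob]) (auto simp: R_def X_def)
      also have "\<dots> = prob (S \<inter> R) + prob (\<Union>i<H. S \<inter> X i)"
        by (rule finite_measure_Union) (auto simp: R_def X_def)
      also have "prob (\<Union>i<H. S \<inter> X i) = (\<Sum>i<H. prob (S \<inter> X i))"
        by (rule finite_measure_finite_Union) (use disj in auto)
      also have "{..<H} = {..<N} \<union> {N..<H}" using H0 by auto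
      also have "(\<Sum>i\<in>{..<N} \<union> {N..<H}. prob (S \<inter> X i)) = (\<Sum>i<N. prob (S \<inter> X i)) + (\<Sum>i\<in>{N..<H}. prob (S \<inter> X i))"
        by (rule sum.union_disjoint) auto
      finally have eq: "prob S = prob (S \<inter> R) + ((\<Sum>i<N. prob (S \<inter> X i)) + (\<Sum>i\<in>{N..<H}. prob (S \<inter> X i)))" .
      have PX: "prob (X i) \<le> 1 / H" for i
      proof -
        have XB: "prob (X i) = \<P>(x in M. x \<in> B)" for i unfolding X_def by (rule prob_T_pow) measurable
        have "H * prob (X i) = (\<Sum>i<H. prob (X i))" by (simp add: XB)
        also have "\<dots> = prob (\<Union>i<H. X i)"
          by (rule finite_measure_finite_Union[symmetric]) (use sep in \<open>auto simp: disjoint_family_on_def X_def\<close>)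
        also have "\<dots> \<le> 1" by (rule prob_le_1)
        finally show ?thesis using H0 by (simp add: field_simps)
      qed
      have "(\<Sum>i<N. prob (S \<inter> X i)) \<le> (\<Sum>i<N. 1 / H)"
        by (intro sum_mono order_trans[OF finite_measure_mono PX]) auto
      also have "(\<Sum>i<N. 1 / real H) = N / H" by simp
      also note HN
      finally have "(\<Sum>i<N. prob (S \<inter> X i)) \<le> e / 8" .
      moreover have "prob (S \<inter> R) \<le> e / 8"
        using finite_measure_mono[of "S \<inter> R" R] cov by (simp add: R_def[symmetric])
      moreover have "0 \<le> (\<Sum>i<N. prob (S \<inter> X i))" by (simp add: sum_nonneg)
      ultimately show ?thesis using eq measure_nonneg[of M "S \<inter> R"] by linarith
    qed
    have level: "\<bar>prob (E \<inter> X i) - prob (F \<inter> X i) / l ^ N\<bar> \<le> e / (4 * H)" if i: "i \<in> {N..<H}" for i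
    proof -
      define K where "K = {g \<in> {..<l ^ H}. \<forall>s<N. name g (i - s) = w s}"
      have DF: "D i c = F \<inter> X i" by (auto simp: D_def F_def X_def)
      have "card K = card (name ` K)"
        using name by (intro card_image[symmetric]) (auto simp: bij_betw_def K_def intro: inj_on_subset)
      also have "name ` K = {g \<in> {..<H} \<rightarrow>\<^sub>E {..<l}. \<forall>s<N. g (i - s) = w s}"
        using name by (auto simp: bij_betw_def K_def W_def image_iff)
      also have "card \<dots> = l ^ (H - N)"
        by (rule card_PiE_prescribed) (use i w in \<open>auto simp: inj_on_def PiE_iff\<close>)
      finally have cardK: "card K = l ^ (H - N)" .
      have "finite K" by (simp add: K_def)
      \<comment> \<open>For i \<ge> N the whole window heads for the same entrance point, so its
        letters are consecutive positions, read downwards, of a single name.\<close>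
      have win: "\<xi> ((T ^^ s) x) = name (G ((T ^^ i) x)) (i - s)" if "x \<in> X i" "s < N" for x s
      proof -
        have "(T ^^ (i - s)) ((T ^^ s) x) = (T ^^ i) x" using that i by (simp add: T_pow_add)
        then show ?thesis using \<xi>_eq[of "i - s" "(T ^^ s) x"] that i by (auto simp: X_def)
      qed
      have "E \<inter> X i = (\<Union>g\<in>K. {x \<in> D i c. G ((T ^^ i) x) = g})"
        using Gl by (auto simp: DF E_def F_def K_def win)
      moreover have Dm: "{x \<in> D i c. G ((T ^^ i) x) = g} \<in> sets M" for g
        unfolding D_def by measurable
      ultimately have "prob (E \<inter> X i) = (\<Sum>g\<in>K. prob {x \<in> D i c. G ((T ^^ i) x) = g})"
        using \<open>finite K\<close> by (simp, intro finite_measure_finite_Union) (auto simp: disjoint_family_on_def)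
      moreover have "prob (F \<inter> X i) / l ^ N = (\<Sum>g\<in>K. prob (D i c) / real (l ^ H))"
      proof -
        have "real l ^ H = real l ^ (H - N) * real l ^ N" using H0 by (simp flip: power_add)
        then show ?thesis using l by (simp add: cardK DF)
      qed
      ultimately have "\<bar>prob (E \<inter> X i) - prob (F \<inter> X i) / l ^ N\<bar>
          = \<bar>\<Sum>g\<in>K. prob {x \<in> D i c. G ((T ^^ i) x) = g} - prob (D i c) / real (l ^ H)\<bar>"
        by (simp add: sum_subtractf)
      also have "\<dots> \<le> (\<Sum>g\<in>K. e')"
        by (intro order_trans[OF sum_abs] sum_mono less_imp_le ind) (use i c in \<open>auto simp: K_def \<D>_def\<close>)
      also have "\<dots> = card K * e'" by simp
      also have "\<dots> \<le> l ^ H * e'"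
        using e' l by (intro mult_right_mono) (auto simp: cardK intro!: power_increasing)
      also have "\<dots> = e / (4 * H)" using l by (simp add: e'_def)
      finally show ?thesis .
    qed
    have "\<bar>(\<Sum>i\<in>{N..<H}. prob (E \<inter> X i)) - (\<Sum>i\<in>{N..<H}. prob (F \<inter> X i)) / l ^ N\<bar>
        = \<bar>\<Sum>i\<in>{N..<H}. prob (E \<inter> X i) - prob (F \<inter> X i) / l ^ N\<bar>"
      by (simp add: sum_subtractf sum_divide_distrib)
    also have "\<dots> \<le> (\<Sum>i\<in>{N..<H}. e / (4 * H))"
      by (intro order_trans[OF sum_abs] sum_mono level)
    also have "\<dots> = (H - N) * (e / (4 * H))" by simp
    also have "\<dots> \<le> H * (e / (4 * H))" using e by (intro mult_right_mono) auto
    also have "\<dots> = e / 4" using H0 by simp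
    finally have mid: "\<bar>(\<Sum>i\<in>{N..<H}. prob (E \<inter> X i)) - (\<Sum>i\<in>{N..<H}. prob (F \<inter> X i)) / l ^ N\<bar> \<le> e / 4" .
    have lN: "1 \<le> real l ^ N" using l by simp
    have "\<bar>prob F / l ^ N - (\<Sum>i\<in>{N..<H}. prob (F \<inter> X i)) / l ^ N\<bar> = \<bar>prob F - (\<Sum>i\<in>{N..<H}. prob (F \<inter> X i))\<bar> / l ^ N"
      by (simp add: abs_divide diff_divide_distrib[symmetric])
    also have "\<dots> \<le> e / 4 / 1" using decomp[of F] lN e by (intro frac_le) auto
    finally have "\<bar>prob F / l ^ N - (\<Sum>i\<in>{N..<H}. prob (F \<inter> X i)) / l ^ N\<bar> \<le> e / 4" by simp
    moreover have "\<bar>prob E - (\<Sum>i\<in>{N..<H}. prob (E \<inter> X i))\<bar> \<le> e / 4" by (rule decomp) simp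
    ultimately have "\<bar>prob E - prob F / l ^ N\<bar> < e" using mid e by linarith
    then show ?thesis by (simp add: E_def F_def)
  qed
  then show ?thesis using that \<xi>m \<xi>l by blast
qed

end

text \<open>In base 3 with digits 0 and 1 there is no ambiguity: at the first difference the term
  (1/3)^n cannot be compensated, because the whole tail is at most half of it.\<close>

lemma ternary_expansion_inj:
  fixes a b :: "nat \<Rightarrow> bool"
  assumes eq: "(\<Sum>n. of_bool (a n) * (1 / 3) ^ n :: real) = (\<Sum>n. of_bool (b n) * (1 / 3) ^ n)"
  shows "a = b"
proof (rule ccontr)
  assume "a \<noteq> b"
  then have ex: "\<exists>n. a n \<noteq> b n" by (simp add: fun_eq_iff)
  define n where "n = (LEAST n. a n \<noteq> b n)"
  have n: "a n \<noteq> b n" "\<And>k. k < n \<Longrightarrow> a k = b k"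
    unfolding n_def by (rule LeastI_ex[OF ex]) (drule not_less_Least, blast)
  define c where "c k = (of_bool (a k) - of_bool (b k) :: real)" for k
  have c1: "\<bar>c k\<bar> \<le> 1" for k by (simp add: c_def of_bool_def)
  have geo: "summable (\<lambda>k. (1 / 3) ^ k :: real)" by (simp add: summable_geometric)
  have sm: "summable (\<lambda>k. of_bool (f k) * (1 / 3) ^ k :: real)" for f :: "nat \<Rightarrow> bool"
    by (rule summable_comparison_test'[OF geo, of 0]) (simp add: of_bool_def)
  have smc: "summable (\<lambda>k. c k * (1 / 3) ^ k)"
    using summable_diff[OF sm[of a] sm[of b]] by (simp add: c_def left_diff_distrib)
  have "0 = (\<Sum>k. c k * (1 / 3) ^ k)"
    using suminf_diff[OF sm[of a] sm[of b]] eq by (simp add: c_def left_diff_distrib)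
  also have "\<dots> = (\<Sum>k. c (k + Suc n) * (1 / 3) ^ (k + Suc n)) + (\<Sum>k<Suc n. c k * (1 / 3) ^ k)"
    by (rule suminf_split_initial_segment[OF smc])
  also have "(\<Sum>k<Suc n. c k * (1 / 3) ^ k) = c n * (1 / 3) ^ n"
    using n(2) by (simp add: c_def)
  finally have "c n * (1 / 3) ^ n = - (\<Sum>k. c (k + Suc n) * (1 / 3) ^ (k + Suc n))" by linarith
  then have "\<bar>c n * (1 / 3) ^ n\<bar> = \<bar>\<Sum>k. c (k + Suc n) * (1 / 3) ^ (k + Suc n)\<bar>"
    by (simp only: abs_minus_cancel)
  then have *: "\<bar>c n\<bar> * (1 / 3) ^ n = \<bar>\<Sum>k. c (k + Suc n) * (1 / 3) ^ (k + Suc n)\<bar>"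
    by (simp add: abs_mult del: power_Suc)
  have geo': "(\<lambda>k. (1 / 3) ^ (k + Suc n) :: real) sums ((3 / 2) * (1 / 3) ^ Suc n)"
    using sums_mult2[OF geometric_sums[of "1 / 3 :: real"], of "(1 / 3) ^ Suc n"] by (simp add: power_add)
  have smt: "summable (\<lambda>k. \<bar>c (k + Suc n) * (1 / 3) ^ (k + Suc n)\<bar>)"
    by (rule summable_comparison_test'[OF sums_summable[OF geo'], of 0])
      (use c1 in \<open>simp add: abs_mult mult_left_le_one_le del: power_Suc\<close>)
  have "\<bar>\<Sum>k. c (k + Suc n) * (1 / 3) ^ (k + Suc n)\<bar> \<le> (\<Sum>k. \<bar>c (k + Suc n) * (1 / 3) ^ (k + Suc n)\<bar>)"
    by (rule summable_rabs[OF smt])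
  also have "\<dots> \<le> (\<Sum>k. (1 / 3) ^ (k + Suc n))"
    by (rule suminf_le[OF _ smt sums_summable[OF geo']])
      (use c1 in \<open>simp add: abs_mult mult_left_le_one_le del: power_Suc\<close>)
  also have "\<dots> = (1 / 2) * (1 / 3) ^ n" using sums_unique[OF geo'] by simp
  finally have "\<bar>c n\<bar> * (1 / 3) ^ n \<le> (1 / 2) * (1 / 3) ^ n" using * by simp
  moreover have "\<bar>c n\<bar> = 1" using n(1) by (auto simp: c_def)
  ultimately show False by simp
qed

section \<open>Aperiodicity yields a uniform random variable\<close>

context ergodic_pt begin

text \<open>The n-th preimages of the point all have the measure of the atom, so if it is positive
  two of them meet. A common point makes x periodic, and {x} lies in the null set of periodic
  points.\<close>

lemma aperiodic_point_null:
  assumes ap: "aperiodic_map M T" and x [measurable]: "{x} \<in> sets M"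
  shows "prob {x} = 0"
proof (rule ccontr)
  assume "prob {x} \<noteq> 0"
  then have pos: "0 < prob {x}" by (simp add: zero_less_measure_iff)
  define A where "A n = {y \<in> space M. (T ^^ n) y \<in> {x}}" for n
  have [measurable]: "A n \<in> sets M" for n unfolding A_def by measurable
  have PA: "prob (A n) = prob {x}" for n
  proof -
    have "prob (A n) = \<P>(y in M. y \<in> {x})" unfolding A_def by (rule prob_T_pow) measurable
    also have "{y \<in> space M. y \<in> {x}} = {x}" using sets.sets_into_space[OF x] by auto
    finally show ?thesis .
  qed
  have "\<exists>i j. i < j \<and> A i \<inter> A j \<noteq> {}"
  proof (rule ccontr)
    assume "\<nexists>i j. i < j \<and> A i \<inter> A j \<noteq> {}"
    then have disj: "disjoint_family_on A {..<n}" for n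
      unfolding disjoint_family_on_def by (metis Int_commute linorder_neqE_nat)
    obtain n where n: "1 < real n * prob {x}" using reals_Archimedean3[OF pos] by blast
    have "real n * prob {x} = (\<Sum>i<n. prob (A i))" by (simp add: PA)
    also have "\<dots> = prob (\<Union>i<n. A i)"
      by (rule finite_measure_finite_Union[symmetric]) (use disj in auto)
    also have "\<dots> \<le> 1" by (rule prob_le_1)
    finally show False using n by simp
  qed
  then obtain i j y where ij: "i < j" "(T ^^ i) y = x" "(T ^^ j) y = x" by (auto simp: A_def)
  then have "(T ^^ (j - i)) x = x" using T_pow_add[of "j - i" i y] by simp
  then have per: "\<exists>j\<ge>1. (T ^^ j) x = x" using ij(1) by (intro exI[of _ "j - i"]) auto
  obtain N where N: "{y \<in> space M. \<not> \<not> (\<exists>j\<ge>1. (T ^^ j) y = y)} \<subseteq> N" "emeasure M N = 0" "N \<in> sets M"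
    using ap unfolding aperiodic_map_def by (rule AE_E)
  have "x \<in> space M" using sets.sets_into_space[OF x] by auto
  then have "{x} \<subseteq> N" using N(1) per by blast
  then have "prob {x} \<le> prob N" using N(3) by (rule finite_measure_mono)
  then show False using pos N(2) by (simp add: measure_def)
qed

text \<open>Membership in the sets of a countable base, coded as ternary digits, gives a measurable
  function that is injective on the topological space. Its fibres there are at most points, hence
  null. This is where standardness and aperiodicity enter.\<close>

lemma exists_uniform:
  assumes std: "standard_prob_space M" and ap: "aperiodic_map M T"
  obtains U where "uniform01 U"
proof -
  obtain S :: "'a topology" where S: "polish_topology S" "borel_sets_of S \<subseteq> sets M" "prob (topspace S) = 1"
    using std unfolding standard_prob_space_def by blast
  have cm: "completely_metrizable_space S" and sc: "second_countable S"
    using S(1) by (auto simp: polish_topology_def)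
  have T1: "t1_space S"
    using cm by (simp add: completely_metrizable_imp_metrizable_space metrizable_imp_Hausdorff_space Hausdorff_imp_t1_space)
  have open_sets: "V \<in> sets M" if "openin S V" for V
    using that S(2) by (auto simp: borel_sets_of_def)
  obtain \<B> where \<B>: "countable \<B>" "\<And>V. V \<in> \<B> \<Longrightarrow> openin S V"
    "\<And>U x. openin S U \<Longrightarrow> x \<in> U \<Longrightarrow> \<exists>V\<in>\<B>. x \<in> V \<and> V \<subseteq> U"
    using sc unfolding second_countable_def by metis
  \<comment> \<open>The empty set is added so that the enumerated family is nonempty.\<close>
  define V where "V = from_nat_into (insert {} \<B>)"
  have rV: "range V = insert {} \<B>" unfolding V_def by (rule range_from_nat_into) (use \<B>(1) in auto)
  have Vopen: "openin S (V n)" for n using rV \<B>(2) by (metis insertE openin_empty rangeI)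
  have [measurable]: "V n \<in> sets M" for n using open_sets Vopen by simp
  define h where "h x = (\<Sum>n. of_bool (x \<in> V n) * (1 / 3) ^ n :: real)" for x
  have [measurable]: "h \<in> borel_measurable M" unfolding h_def by measurable
  have sing: "{x} \<in> sets M" if "x \<in> topspace S" for x
  proof -
    have "closedin S {x}" using T1 that by (simp add: t1_space_closedin_singleton)
    then have "topspace S - {x} \<in> sets M" "topspace S \<in> sets M"
      by (auto intro!: open_sets simp: closedin_def)
    moreover have "{x} = topspace S - (topspace S - {x})" using that by auto
    ultimately show ?thesis by (metis sets.Diff)
  qed
  have inj: "x = y" if "x \<in> topspace S" "y \<in> topspace S" "h x = h y" for x y
  proof (rule ccontr)
    assume "x \<noteq> y"
    then have "\<exists>W. openin S W \<and> x \<in> W \<and> y \<notin> W" using T1 that(1,2) by (simp add: t1_space_def)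
    then obtain W' where W': "openin S W'" "x \<in> W'" "y \<notin> W'" by auto
    obtain W where W: "W \<in> \<B>" "x \<in> W" "W \<subseteq> W'" using \<B>(3)[OF W'(1,2)] by auto
    have "W \<in> range V" using rV W(1) by simp
    then obtain n where "W = V n" by auto
    then have "x \<in> V n" "y \<notin> V n" using W W' by auto
    moreover have "(\<lambda>n. x \<in> V n) = (\<lambda>n. y \<in> V n)"
      by (rule ternary_expansion_inj) (use that(3) in \<open>simp add: h_def\<close>)
    ultimately show False by (simp add: fun_eq_iff)
  qed
  have "\<P>(x in M. h x = t) = 0" for t
  proof -
    have tS: "topspace S \<in> sets M" by (rule open_sets) simp
    have AE_S: "AE x in M. x \<in> topspace S" using S(3) by (rule AE_prob_1)
    have "\<P>(x in M. h x = t) = prob {x \<in> topspace S. h x = t}"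
    proof (rule finite_measure_eq_AE)
      show "AE x in M. (x \<in> {x \<in> space M. h x = t}) = (x \<in> {x \<in> topspace S. h x = t})"
        using AE_S AE_space by eventually_elim auto
      have "{x \<in> topspace S. h x = t} = topspace S \<inter> {x \<in> space M. h x = t}"
        using sets.sets_into_space[OF tS] by auto
      then show "{x \<in> topspace S. h x = t} \<in> sets M" using tS by simp
    qed measurable
    also have "\<dots> = 0"
    proof (cases "\<exists>x\<in>topspace S. h x = t")
      case True
      then obtain x where "x \<in> topspace S" "h x = t" by auto
      then have "{x \<in> topspace S. h x = t} = {x}" using inj by auto
      then show ?thesis using aperiodic_point_null[OF ap sing] \<open>x \<in> topspace S\<close> by simp
    next
      case False
      then have "{x \<in> topspace S. h x = t} = {}" by auto
      then show ?thesis by (simp only: measure_empty)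
    qed
    finally show ?thesis .
  qed
  from cdf_transform_uniform[OF \<open>h \<in> borel_measurable M\<close> this] that show ?thesis .
qed

end

section \<open>Coefficients of the Birkhoff sums and averages over words\<close>

text \<open>Convolution of two intervals, a trapezoid of height min n j: the coefficients of (1 +
  ... + z^(n-1)) (1 + ... + z^(j-1)).\<close>

definition overlap :: "nat \<Rightarrow> nat \<Rightarrow> nat \<Rightarrow> int" where
  "overlap n j s = (\<Sum>t<n. \<Sum>i<j. of_bool (t + i = s))"

text \<open>The coefficient of \<open>\<xi> \<circ> T\<^sup>s\<close> in the \<open>n\<close>-th Birkhoff sum of \<open>e - e \<circ> T\<^sup>d\<close>, where
  \<open>e = \<xi> + \<xi> \<circ> T + \<dots> + \<xi> \<circ> T\<^bsup>j-1\<^esup>\<close>.\<close>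

definition coef :: "nat \<Rightarrow> nat \<Rightarrow> nat \<Rightarrow> nat \<Rightarrow> int" where
  "coef j d n s = overlap n j s - (if d \<le> s then overlap n j (s - d) else 0)"

lemma sum_of_bool_shift: "(\<Sum>i<(j::nat). of_bool (t + i = s) :: int) = of_bool (t \<le> s \<and> s < t + j)"
proof (induction j)
  case (Suc j)
  then show ?case by (auto simp: of_bool_def)
qed auto

lemma overlap_commute: "overlap n j s = overlap j n s"
  unfolding overlap_def by (subst sum.swap) (simp add: add.commute)

lemma overlap_nonneg: "0 \<le> overlap n j s"
  unfolding overlap_def by (intro sum_nonneg) auto

lemma overlap_le_left: "overlap n j s \<le> n"
proof -
  have "overlap n j s \<le> (\<Sum>t<n. 1)" unfolding overlap_def sum_of_bool_shift by (intro sum_mono) auto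
  then show ?thesis by simp
qed

lemma overlap_le_right: "overlap n j s \<le> j"
  using overlap_le_left[of j n s] by (simp add: overlap_commute)

lemma overlap_full: "j \<le> Suc s \<Longrightarrow> s < n \<Longrightarrow> overlap n j s = j"
  by (subst overlap_commute) (simp add: overlap_def sum_of_bool_shift)

lemma overlap_eq_0: "n + j \<le> Suc s \<Longrightarrow> overlap n j s = 0"
  unfolding overlap_def sum_of_bool_shift by (intro sum.neutral) auto

lemma overlap_weighted_sum:
  fixes x :: "nat \<Rightarrow> 'a::comm_ring_1"
  assumes "n + j \<le> Suc N"
  shows "(\<Sum>t<n. \<Sum>i<j. x (t + i)) = (\<Sum>s<N. of_int (overlap n j s) * x s)"
proof -
  have "(\<Sum>s<N. of_int (overlap n j s) * x s) = (\<Sum>s<N. \<Sum>t<n. \<Sum>i<j. of_bool (t + i = s) * x s)"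
    by (simp add: overlap_def sum_distrib_right)
  also have "\<dots> = (\<Sum>t<n. \<Sum>i<j. \<Sum>s<N. of_bool (t + i = s) * x s)"
    by (subst sum.swap, rule sum.cong[OF refl], rule sum.swap)
  also have "\<dots> = (\<Sum>t<n. \<Sum>i<j. x (t + i))"
  proof (intro sum.cong refl)
    fix t i assume "t \<in> {..<n}" "i \<in> {..<j}"
    then have "t + i \<in> {..<N}" using assms by auto
    then show "(\<Sum>s<N. of_bool (t + i = s) * x s) = x (t + i)"
      by (subst sum.remove[of _ "t + i"]) (auto intro!: sum.neutral)
  qed
  finally show ?thesis ..
qed

lemma overlap_sum: "n + j \<le> Suc N \<Longrightarrow> (\<Sum>s<N. overlap n j s) = n * j"
  using overlap_weighted_sum[of n j N "\<lambda>_. 1 :: int"] by simp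

lemma sum_shift_if:
  fixes g :: "nat \<Rightarrow> 'a::comm_monoid_add"
  shows "(\<Sum>s<N + d. if d \<le> s then g s else 0) = (\<Sum>s<N. g (s + d))"
proof -
  have "(\<Sum>s<N + d. if d \<le> s then g s else 0) = (\<Sum>s\<in>{d..<N + d}. g s)"
    by (rule sum.mono_neutral_cong_right) auto
  also have "\<dots> = (\<Sum>s<N. g (s + d))"
    using sum.shift_bounds_nat_ivl[of g 0 d N] by (simp add: atLeast0LessThan)
  finally show ?thesis .
qed

lemma coef_weighted_sum:
  fixes x :: "nat \<Rightarrow> 'a::comm_ring_1"
  shows "(\<Sum>t<n. (\<Sum>i<j. x (t + i)) - (\<Sum>i<j. x (t + d + i))) = (\<Sum>s<n + j + d. of_int (coef j d n s) * x s)"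
proof -
  have "(\<Sum>s<n + j + d. of_int (coef j d n s) * x s)
      = (\<Sum>s<n + j + d. of_int (overlap n j s) * x s)
        - (\<Sum>s<n + j + d. if d \<le> s then of_int (overlap n j (s - d)) * x s else 0)"
    by (simp add: coef_def left_diff_distrib if_distrib[of of_int] if_distribR sum_subtractf cong: if_cong)
      (rule sum.cong, auto)
  also have "(\<Sum>s<n + j + d. if d \<le> s then of_int (overlap n j (s - d)) * x s else 0)
      = (\<Sum>s<n + j. of_int (overlap n j s) * x (s + d))" by (subst sum_shift_if) simp
  also have "\<dots> = (\<Sum>t<n. \<Sum>i<j. x (t + i + d))"
    by (rule overlap_weighted_sum[of n j "n + j" "\<lambda>s. x (s + d)", symmetric]) simp
  also have "(\<Sum>s<n + j + d. of_int (overlap n j s) * x s) = (\<Sum>t<n. \<Sum>i<j. x (t + i))"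
    by (rule overlap_weighted_sum[symmetric]) simp
  finally show ?thesis by (simp add: sum_subtractf add.assoc add.commute[of d] add.left_commute[of d])
qed

text \<open>Moving the subtracted terms across turns both sides into the sum over [0, n + d). For
  Birkhoff sums it says that the n-th sum of a coboundary with shift d has only d terms, whatever n
  is.\<close>

lemma telescope_swap:
  fixes g :: "nat \<Rightarrow> 'a::ab_group_add"
  shows "(\<Sum>t<n. g t - g (t + d)) = (\<Sum>t<d. g t - g (t + n))"
proof -
  have *: "(\<Sum>t<n. g t) + (\<Sum>t<d. g (t + n)) = (\<Sum>t<n + d. g t)" for n d
    by (induction d) (simp_all add: add.assoc[symmetric] add.commute)
  show ?thesis
    using *[of n d] *[of d n] by (simp add: sum_subtractf algebra_simps)
qed

text \<open>The generating function of the coefficients is \<open>(1 - z\<^sup>n) (1 - z\<^sup>j) (1 - z\<^sup>d) / (1 - z)\<^sup>2\<close>.\<close>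

lemma coef_swap: "coef j d n s = coef j n d s"
proof -
  define g where "g t = (\<Sum>i<j. of_bool (t + i = s) :: int)" for t
  have *: "coef j d n s = (\<Sum>t<n. g t - g (t + d))" for n d
  proof -
    have "(if d \<le> s then overlap n j (s - d) else 0) = (\<Sum>t<n. g (t + d))"
      unfolding overlap_def g_def sum_of_bool_shift
      by (auto intro!: sum.cong simp: of_bool_def)
    then show ?thesis by (simp add: coef_def overlap_def g_def sum_subtractf)
  qed
  show ?thesis by (simp only: * telescope_swap)
qed

lemma abs_coef_le: "\<bar>coef j d n s\<bar> \<le> int (min j n)"
proof -
  have le: "overlap n j r \<le> int (min j n)" for r
    using overlap_le_left[of n j r] overlap_le_right[of n j r] by simp
  show ?thesis
    using overlap_nonneg[of n j s] overlap_nonneg[of n j "s - d"] le[of s] le[of "s - d"]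
    unfolding coef_def by (cases "d \<le> s") (simp_all del: of_nat_min min.bounded_iff)
qed

lemma sum_abs_coef_le: "(\<Sum>s<n + j + d. \<bar>coef j d n s\<bar>) \<le> 2 * int n * int j"
proof -
  have "(\<Sum>s<n + j + d. \<bar>coef j d n s\<bar>)
      \<le> (\<Sum>s<n + j + d. overlap n j s + (if d \<le> s then overlap n j (s - d) else 0))"
    by (intro sum_mono) (use overlap_nonneg[of n j] in \<open>auto simp: coef_def abs_le_iff\<close>)
  also have "\<dots> = 2 * int n * int j"
    by (simp add: sum.distrib overlap_sum sum_shift_if)
  finally show ?thesis .
qed

lemma sum_coef_sq_le: "(\<Sum>s<n + j + d. (coef j d n s)\<^sup>2) \<le> 2 * int n * int j * int (min j n)"
proof -
  have "(\<Sum>s<n + j + d. (coef j d n s)\<^sup>2) \<le> (\<Sum>s<n + j + d. \<bar>coef j d n s\<bar> * int (min j n))"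
  proof (rule sum_mono)
    fix s
    have "(coef j d n s)\<^sup>2 = \<bar>coef j d n s\<bar> * \<bar>coef j d n s\<bar>" by (simp add: power2_eq_square)
    also have "\<dots> \<le> \<bar>coef j d n s\<bar> * int (min j n)" by (intro mult_left_mono abs_coef_le) auto
    finally show "(coef j d n s)\<^sup>2 \<le> \<bar>coef j d n s\<bar> * int (min j n)" .
  qed
  also have "\<dots> \<le> 2 * int n * int j * int (min j n)"
    unfolding sum_distrib_right[symmetric] by (intro mult_right_mono sum_abs_coef_le) auto
  finally show ?thesis .
qed

text \<open>Exchanging n and d makes the bound independent of n; it is the better one once n exceeds
  d.\<close>

lemma sum_coef_sq_le': "(\<Sum>s<n + j + d. (coef j d n s)\<^sup>2) \<le> 2 * int d * int j * int (min j d)"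
  using sum_coef_sq_le[where n=d and d=n and j=j] by (simp add: coef_swap[of j n d] add.commute add.left_commute)

lemma coef_eq_0: "n + j + d \<le> s \<Longrightarrow> coef j d n s = 0"
  by (simp add: coef_def overlap_eq_0)

lemma coef_full: "j \<le> Suc s \<Longrightarrow> s < n \<Longrightarrow> n \<le> d \<Longrightarrow> coef j d n s = j"
  by (simp add: coef_def overlap_full)

lemma coef_full': "0 < j \<Longrightarrow> j \<le> Suc s \<Longrightarrow> s < n \<Longrightarrow> n \<le> d \<Longrightarrow> coef j d n (s + d) = - int j"
  by (simp add: coef_def overlap_full overlap_eq_0)

text \<open>Only the two plateaus are kept: the coefficient is j on {j - 1..<n} and -j on its
  translate by d. They are disjoint because n \<le> d.\<close>

lemma sum_coef_ge:
  fixes g :: "int \<Rightarrow> real"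
  assumes g: "\<And>x. 0 \<le> g x" and j: "0 < j" "j \<le> n" "n \<le> d"
  shows "(real n - real j) * (g j + g (- int j)) \<le> (\<Sum>s<n + j + d. g (coef j d n s))"
proof -
  define A where "A = {j - 1..<n}"
  have A: "A \<inter> (\<lambda>s. s + d) ` A = {}" "finite A" using j by (auto simp: A_def)
  have "(real n - real j) * (g j + g (- int j)) \<le> card A * (g j + g (- int j))"
    using j g by (intro mult_right_mono add_nonneg_nonneg) (auto simp: A_def)
  also have "\<dots> = (\<Sum>s\<in>A. g (coef j d n s)) + (\<Sum>s\<in>A. g (coef j d n (s + d)))"
  proof -
    have "(\<Sum>s\<in>A. g (coef j d n s)) = (\<Sum>s\<in>A. g j)"
      by (intro sum.cong refl arg_cong[where f=g] coef_full) (use j in \<open>auto simp: A_def\<close>)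
    moreover have "(\<Sum>s\<in>A. g (coef j d n (s + d))) = (\<Sum>s\<in>A. g (- int j))"
      by (intro sum.cong refl arg_cong[where f=g] coef_full') (use j in \<open>auto simp: A_def\<close>)
    ultimately show ?thesis by (simp add: distrib_left)
  qed
  also have "\<dots> = (\<Sum>s\<in>A \<union> (\<lambda>s. s + d) ` A. g (coef j d n s))"
    using A by (subst sum.union_disjoint) (auto simp: sum.reindex)
  also have "\<dots> \<le> (\<Sum>s<n + j + d. g (coef j d n s))"
    by (rule sum_mono2) (use j g in \<open>auto simp: A_def\<close>)
  finally show ?thesis .
qed

section \<open>Averages over words of independent uniform letters\<close>

definition word_mean :: "nat \<Rightarrow> nat \<Rightarrow> ((nat \<Rightarrow> nat) \<Rightarrow> 'b::field) \<Rightarrow> 'b" where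
  "word_mean N l F = (\<Sum>w\<in>{..<N} \<rightarrow>\<^sub>E {..<l}. F w) / of_nat (l ^ N)"

text \<open>A sparse step is read off a uniform letter: with l symbols, each sign gets probability
  1/l and the remaining symbols give 0.\<close>

definition letter :: "nat \<Rightarrow> int" where
  "letter x = (if x = 0 then 1 else if x = 1 then -1 else 0)"

lemma abs_letter_le: "\<bar>letter x\<bar> \<le> 1"
  by (simp add: letter_def)

lemma sum_letter:
  fixes f :: "int \<Rightarrow> 'b::comm_ring_1"
  assumes "2 \<le> l"
  shows "(\<Sum>x<l. f (letter x)) = f 1 + f (-1) + of_nat (l - 2) * f 0"
proof -
  obtain k where k: "l = Suc (Suc k)" using assms by (metis add_2_eq_Suc le_Suc_ex)
  have "(\<Sum>x<l. f (letter x)) = f (letter 0) + (f (letter 1) + (\<Sum>x<k. f (letter (Suc (Suc x)))))"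
    unfolding k by (simp only: sum.lessThan_Suc_shift o_def One_nat_def)
  then show ?thesis by (simp add: letter_def k)
qed

lemma word_mean_prod:
  fixes f :: "nat \<Rightarrow> nat \<Rightarrow> 'b::field"
  shows "word_mean N l (\<lambda>w. \<Prod>s<N. f s (w s)) = (\<Prod>s<N. (\<Sum>x<l. f s x) / of_nat l)"
proof -
  have "(\<Prod>s<N. \<Sum>x<l. f s x) = (\<Sum>w\<in>{..<N} \<rightarrow>\<^sub>E {..<l}. \<Prod>s<N. f s (w s))"
    by (rule prod_sum_PiE) auto
  then show ?thesis by (simp add: word_mean_def prod_dividef)
qed

lemma word_mean_sum: "word_mean N l (\<lambda>w. \<Sum>i\<in>I. F i w) = (\<Sum>i\<in>I. word_mean N l (F i))"
  unfolding word_mean_def by (subst sum.swap) (simp add: sum_divide_distrib)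

lemma word_mean_add: "word_mean N l (\<lambda>w. F w + G w) = word_mean N l F + word_mean N l G"
  by (simp add: word_mean_def sum.distrib add_divide_distrib)

lemma word_mean_cmult: "word_mean N l (\<lambda>w. c * F w) = c * word_mean N l F"
  by (simp add: word_mean_def sum_distrib_left)

lemma card_words: "card ({..<N} \<rightarrow>\<^sub>E {..<l}) = l ^ N" for N l :: nat
  by (simp add: card_PiE)

lemma word_mean_const: "0 < l \<Longrightarrow> word_mean N l (\<lambda>w. c) = (c :: 'b::field_char_0)"
  by (simp add: word_mean_def card_words)

lemma word_mean_letter:
  assumes "2 \<le> l" "s < N"
  shows "word_mean N l (\<lambda>w. of_int (letter (w s))) = (0 :: 'b::field_char_0)"
proof -
  have "word_mean N l (\<lambda>w. of_int (letter (w s)) :: 'b)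
      = word_mean N l (\<lambda>w. \<Prod>r<N. if r = s then of_int (letter (w r)) else 1)"
    using assms(2) by (simp add: prod.If_cases Int_absorb1)
  also have "\<dots> = (\<Prod>r<N. (\<Sum>x<l. if r = s then of_int (letter x) else 1) / of_nat l)"
    by (rule word_mean_prod)
  also have "\<dots> = 0"
    by (rule prod_zero) (use assms sum_letter[OF assms(1), of "of_int :: int \<Rightarrow> 'b"] in \<open>auto intro!: bexI[of _ s]\<close>)
  finally show ?thesis .
qed

lemma word_mean_letter_letter:
  assumes "2 \<le> l" "s < N" "s' < N"
  shows "word_mean N l (\<lambda>w. of_int (letter (w s)) * of_int (letter (w s')))
    = (if s = s' then 2 / of_nat l else 0 :: 'b::field_char_0)"
proof (cases "s = s'")
  case True
  have "word_mean N l (\<lambda>w. of_int (letter (w s)) * of_int (letter (w s')) :: 'b)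
      = word_mean N l (\<lambda>w. \<Prod>r<N. if r = s then (of_int (letter (w r)))\<^sup>2 else 1)"
    using assms(2) True by (simp add: prod.If_cases Int_absorb1 power2_eq_square)
  also have "\<dots> = (\<Prod>r<N. (\<Sum>x<l. if r = s then (of_int (letter x))\<^sup>2 else 1) / of_nat l)"
    by (rule word_mean_prod)
  also have "\<dots> = (\<Prod>r<N. if r = s then 2 / of_nat l else 1)"
    using assms(1) sum_letter[OF assms(1), of "\<lambda>y. (of_int y)\<^sup>2 :: 'b"] by (intro prod.cong) auto
  also have "\<dots> = 2 / of_nat l" using assms(2) by (simp add: prod.If_cases Int_absorb1)
  finally show ?thesis using True by simp
next
  case False
  have "word_mean N l (\<lambda>w. of_int (letter (w s)) * of_int (letter (w s')) :: 'b)
      = word_mean N l (\<lambda>w. \<Prod>r<N. if r = s \<or> r = s' then of_int (letter (w r)) else 1)"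
  proof -
    have "{..<N} \<inter> {r. r = s \<or> r = s'} = {s, s'}" using assms by auto
    then show ?thesis using False by (simp add: prod.If_cases)
  qed
  also have "\<dots> = (\<Prod>r<N. (\<Sum>x<l. if r = s \<or> r = s' then of_int (letter x) else 1) / of_nat l)"
    by (rule word_mean_prod)
  also have "\<dots> = 0"
    by (rule prod_zero) (use assms sum_letter[OF assms(1), of "of_int :: int \<Rightarrow> 'b"] in \<open>auto intro!: bexI[of _ s]\<close>)
  finally show ?thesis using False by simp
qed

lemma word_mean_square:
  fixes c :: real and a :: "nat \<Rightarrow> real"
  assumes l: "2 \<le> l"
  shows "word_mean N l (\<lambda>w. (c + (\<Sum>s<N. a s * of_int (letter (w s))))\<^sup>2) = c\<^sup>2 + 2 / l * (\<Sum>s<N. (a s)\<^sup>2)"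
proof -
  have "word_mean N l (\<lambda>w. (c + (\<Sum>s<N. a s * of_int (letter (w s))))\<^sup>2)
    = word_mean N l (\<lambda>w. c\<^sup>2 + (\<Sum>s<N. 2 * c * a s * of_int (letter (w s)))
       + (\<Sum>s<N. \<Sum>s'<N. a s * a s' * (of_int (letter (w s)) * of_int (letter (w s')))))"
    by (rule arg_cong[where f="word_mean N l"])
      (simp add: fun_eq_iff power2_eq_square algebra_simps sum_product sum_distrib_left sum_distrib_right)
  also have "\<dots> = c\<^sup>2 + (\<Sum>s<N. \<Sum>s'<N. a s * a s' * (if s = s' then 2 / l else 0))"
    using l by (simp add: word_mean_add word_mean_sum word_mean_cmult word_mean_const word_mean_letter word_mean_letter_letter)
  also have "\<dots> = c\<^sup>2 + 2 / l * (\<Sum>s<N. (a s)\<^sup>2)"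
    by (simp add: sum_distrib_left power2_eq_square if_distrib[where f="\<lambda>x. _ * x"] sum.delta mult.commute cong: if_cong)
  finally show ?thesis .
qed

text \<open>Complex exponentials factor over the independent letters. The law of a letter is
  symmetric, so every factor is real and taking real parts affects only
  \<open>cis (\<theta> * c)\<close>.\<close>

lemma word_mean_cos:
  fixes c \<theta> :: real and a :: "nat \<Rightarrow> real"
  assumes l: "2 \<le> l"
  shows "word_mean N l (\<lambda>w. cos (\<theta> * (c + (\<Sum>s<N. a s * of_int (letter (w s))))))
    = cos (\<theta> * c) * (\<Prod>s<N. 1 - 2 / l * (1 - cos (\<theta> * a s)))"
proof -
  have Re_mean: "Re (word_mean N l F) = word_mean N l (\<lambda>w. Re (F w))" for F
    by (simp add: word_mean_def Re_divide_of_nat del: of_nat_power)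
  have cis_sum: "cis (\<Sum>s<N. g s) = (\<Prod>s<N. cis (g s))" for g
    by (induction N) (auto simp: cis_mult[symmetric])
  have "word_mean N l (\<lambda>w. cis (\<theta> * (c + (\<Sum>s<N. a s * of_int (letter (w s))))))
      = word_mean N l (\<lambda>w. cis (\<theta> * c) * (\<Prod>s<N. cis (\<theta> * a s * of_int (letter (w s)))))"
    by (simp add: distrib_left cis_mult[symmetric] sum_distrib_left cis_sum mult.assoc)
  also have "\<dots> = cis (\<theta> * c) * (\<Prod>s<N. (\<Sum>x<l. cis (\<theta> * a s * of_int (letter x))) / of_nat l)"
    by (simp add: word_mean_cmult word_mean_prod[where f="\<lambda>s x. cis (\<theta> * a s * of_int (letter x))"])
  also have "\<dots> = cis (\<theta> * c) * (\<Prod>s<N. of_real (1 - 2 / l * (1 - cos (\<theta> * a s))))"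
  proof -
    have "(\<Sum>x<l. cis (\<theta> * a s * of_int (letter x))) / of_nat l = of_real (1 - 2 / l * (1 - cos (\<theta> * a s)))" for s
    proof -
      have "(\<Sum>x<l. cis (\<theta> * a s * of_int (letter x))) = of_real (2 * cos (\<theta> * a s) + (real l - 2))"
        using l by (subst sum_letter[OF l, of "\<lambda>y. cis (\<theta> * a s * of_int y)"])
          (simp add: complex_eq_iff of_nat_diff)
      also have "\<dots> / of_nat l = of_real ((2 * cos (\<theta> * a s) + (real l - 2)) / l)" by simp
      also have "(2 * cos (\<theta> * a s) + (real l - 2)) / l = 1 - 2 / l * (1 - cos (\<theta> * a s))"
        using l by (simp add: field_simps)
      finally show ?thesis .
    qed
    then show ?thesis by simp
  qed
  finally have "Re (word_mean N l (\<lambda>w. cis (\<theta> * (c + (\<Sum>s<N. a s * of_int (letter (w s)))))))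
      = Re (cis (\<theta> * c) * of_real (\<Prod>s<N. 1 - 2 / l * (1 - cos (\<theta> * a s))))"
    by (simp only: of_real_prod)
  then show ?thesis by (simp add: Re_mean del: of_real_prod)
qed

section \<open>The model process and its local limit theorem\<close>

text \<open>The parameters of the summand \<open>f\<^sub>k = e\<^sub>k - e\<^sub>k \<circ> T\<^sup>d\<close>: \<open>blk k\<close> is the length \<open>j\<close> of the moving average
  \<open>e\<^sub>k\<close>, \<open>shf k\<close> is \<open>d\<close>, and \<open>\<xi>\<close> takes the values \<open>1\<close> and \<open>-1\<close> with probability \<open>1 / lets k\<close> each. For
  \<open>blk k \<ll> n \<ll> shf k\<close> the \<open>n\<close>-th Birkhoff sum then has variance about \<open>2 n / (k + 1)\<close>, and since
  \<open>shf k = blk (2 k)\<close> the summands in this range contribute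
  \<open>2 n (1 / (m/2) + \<dots> + 1 / m) \<approx> 2 n ln 2\<close> when \<open>n\<close> is about \<open>blk m\<close>.\<close>

fun blk :: "nat \<Rightarrow> nat" where
  "blk 0 = 2"
| "blk (Suc k) = blk k ^ 8 + 1"

definition shf :: "nat \<Rightarrow> nat" where "shf k = blk (2 * k)"

definition lets :: "nat \<Rightarrow> nat" where "lets k = 2 * Suc k * blk k ^ 2"

definition cf :: "nat \<Rightarrow> nat \<Rightarrow> nat \<Rightarrow> real" where
  "cf k n s = of_int (coef (blk k) (shf k) n s)"

text \<open>Variance of the model of the n-th Birkhoff sum of f_k: independent letters of variance
  \<open>2 / lets k\<close>, weighted by their coefficients.\<close>

definition var :: "nat \<Rightarrow> nat \<Rightarrow> real" where
  "var k n = 2 / lets k * (\<Sum>s<n + blk k + shf k. (cf k n s)\<^sup>2)"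

text \<open>Characteristic function of the same model, real by the symmetry of the letters.\<close>

definition fac :: "nat \<Rightarrow> nat \<Rightarrow> real \<Rightarrow> real" where
  "fac k n \<theta> = (\<Prod>s<n + blk k + shf k. 1 - 2 / lets k * (1 - cos (\<theta> * cf k n s)))"

lemma blk_ge_2: "2 \<le> blk k"
proof (induction k)
  case (Suc k)
  have "blk k ^ 1 \<le> blk k ^ 8" using Suc by (intro power_increasing) auto
  then show ?case using Suc by simp
qed auto

lemma blk_pos [simp]: "0 < blk k"
  using blk_ge_2[of k] by linarith

lemma blk_nonzero [simp]: "blk k \<noteq> 0"
  by (rule blk_pos[THEN less_imp_neq, symmetric])

lemma blk_Suc_ge: "4 * blk k \<le> blk (Suc k)"
proof -
  have "4 * blk k \<le> blk k ^ 2 * blk k"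
    using power_mono[OF blk_ge_2[of k], of 2] by (intro mult_right_mono) auto
  also have "\<dots> = blk k ^ 3" by (simp add: power2_eq_square power3_eq_cube)
  also have "\<dots> \<le> blk k ^ 8" using blk_ge_2[of k] by (intro power_increasing) auto
  finally show ?thesis by simp
qed

lemma blk_mono: "i \<le> k \<Longrightarrow> blk i \<le> blk k"
proof (rule lift_Suc_mono_le[of blk])
  show "blk n \<le> blk (Suc n)" for n using blk_Suc_ge[of n] by linarith
qed

lemma blk_geometric: "4 ^ i * blk k \<le> blk (k + i)"
proof (induction i)
  case (Suc i)
  then show ?case using blk_Suc_ge[of "k + i"] by simp
qed auto

lemma blk_ge_power: "4 ^ k \<le> blk k"
  using blk_geometric[of k 0] by simp

lemma blk_ge_Suc: "Suc k \<le> blk k"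
proof -
  have "Suc k \<le> 2 ^ k" by (rule Suc_leI) (rule less_exp)
  also have "(2::nat) ^ k \<le> 4 ^ k" by (rule power_mono) auto
  also note blk_ge_power
  finally show ?thesis .
qed

lemma blk_pow8: "k < m \<Longrightarrow> blk k ^ 8 \<le> blk m"
  using blk_mono[of "Suc k" m] by (simp add: blk.simps(2))

declare blk.simps(2) [simp del]

lemma two_div_lets: "2 / real (lets k) = 1 / (real (Suc k) * real (blk k) ^ 2)"
  by (simp add: lets_def del: of_nat_Suc mult_Suc mult_Suc_right)

lemma lets_ge: "8 \<le> lets k"
proof -
  have "2 * 1 * 2 ^ 2 \<le> lets k" unfolding lets_def
    by (intro mult_mono power_mono) (use blk_ge_2 in auto)
  then show ?thesis by simp
qed

lemma cf_sq_sum_le: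
  "(\<Sum>s<n + blk k + shf k. (cf k n s)\<^sup>2) \<le> 2 * real n * blk k * real (min (blk k) n)"
  "(\<Sum>s<n + blk k + shf k. (cf k n s)\<^sup>2) \<le> 2 * real (shf k) * blk k * real (min (blk k) (shf k))"
proof -
  have eq: "(\<Sum>s<n + blk k + shf k. (cf k n s)\<^sup>2) = of_int (\<Sum>s<n + blk k + shf k. (coef (blk k) (shf k) n s)\<^sup>2)"
    by (simp add: cf_def)
  have "real_of_int (\<Sum>s<n + blk k + shf k. (coef (blk k) (shf k) n s)\<^sup>2) \<le> of_int (2 * int n * int (blk k) * int (min (blk k) n))"
    by (rule of_int_le_iff[THEN iffD2], rule sum_coef_sq_le)
  then show "(\<Sum>s<n + blk k + shf k. (cf k n s)\<^sup>2) \<le> 2 * real n * blk k * real (min (blk k) n)"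
    unfolding eq by simp
  have "real_of_int (\<Sum>s<n + blk k + shf k. (coef (blk k) (shf k) n s)\<^sup>2) \<le> of_int (2 * int (shf k) * int (blk k) * int (min (blk k) (shf k)))"
    by (rule of_int_le_iff[THEN iffD2], rule sum_coef_sq_le')
  then show "(\<Sum>s<n + blk k + shf k. (cf k n s)\<^sup>2) \<le> 2 * real (shf k) * blk k * real (min (blk k) (shf k))"
    unfolding eq by simp
qed

lemma var_nonneg: "0 \<le> var k n"
  by (simp add: var_def sum_nonneg)

lemma var_le: "var k n \<le> 2 * n / Suc k"
proof -
  have "(\<Sum>s<n + blk k + shf k. (cf k n s)\<^sup>2) \<le> 2 * real n * blk k * blk k"
    by (rule order_trans[OF cf_sq_sum_le(1)]) (intro mult_left_mono, auto)
  then have "var k n \<le> 1 / (real (Suc k) * real (blk k) ^ 2) * (2 * real n * blk k * blk k)"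
    unfolding var_def two_div_lets by (intro mult_left_mono) auto
  then show ?thesis by (simp add: power2_eq_square del: of_nat_Suc)
qed

text \<open>No coefficient exceeds n, which before time \<open>blk k\<close> gains a factor n / blk
  k over \<open>var_le\<close>. It makes the summands beyond the current scale negligible and, at n
  = 1, gives square integrability of the limit function.\<close>

lemma var_le_early: "var k n \<le> 2 * real n ^ 2 / (real (Suc k) * real (blk k))"
proof -
  have "(\<Sum>s<n + blk k + shf k. (cf k n s)\<^sup>2) \<le> 2 * real n * blk k * n"
    by (rule order_trans[OF cf_sq_sum_le(1)]) (intro mult_left_mono, auto)
  then have "var k n \<le> 1 / (real (Suc k) * real (blk k) ^ 2) * (2 * real n * blk k * n)"
    unfolding var_def two_div_lets by (intro mult_left_mono) auto
  then show ?thesis by (simp add: power2_eq_square mult_ac del: of_nat_Suc)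
qed

text \<open>The bound obtained by exchanging n and the shift: the variance stays bounded after time
  \<open>shf k\<close>.\<close>

lemma var_le_late: "var k n \<le> 2 * shf k / Suc k"
proof -
  have "(\<Sum>s<n + blk k + shf k. (cf k n s)\<^sup>2) \<le> 2 * real (shf k) * blk k * blk k"
    by (rule order_trans[OF cf_sq_sum_le(2)]) (intro mult_left_mono, auto)
  then have "var k n \<le> 1 / (real (Suc k) * real (blk k) ^ 2) * (2 * real (shf k) * blk k * blk k)"
    unfolding var_def two_div_lets by (intro mult_left_mono) auto
  then show ?thesis by (simp add: power2_eq_square del: of_nat_Suc)
qed

lemma cf_sum_ge:
  assumes "\<And>x. 0 \<le> g x" "blk k \<le> n" "n \<le> shf k"
  shows "(real n - blk k) * (g (blk k) + g (- real (blk k))) \<le> (\<Sum>s<n + blk k + shf k. g (cf k n s))"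
  using sum_coef_ge[of "\<lambda>x. g (of_int x)" "blk k" n "shf k"] assms by (simp add: cf_def)

lemma var_ge:
  assumes "blk k \<le> n" "n \<le> shf k"
  shows "2 * (real n - blk k) / Suc k \<le> var k n"
proof -
  have "2 * (real n - blk k) / Suc k
      = 1 / (real (Suc k) * real (blk k) ^ 2) * ((real n - blk k) * ((real (blk k))\<^sup>2 + (- real (blk k))\<^sup>2))"
    by (simp add: field_simps del: of_nat_Suc)
  also have "\<dots> \<le> var k n"
    unfolding var_def two_div_lets by (intro mult_left_mono cf_sum_ge[of "\<lambda>x. x\<^sup>2"] assms) auto
  finally show ?thesis .
qed

lemma abs_cf_le: "\<bar>cf k n s\<bar> \<le> blk k"
  using abs_coef_le[of "blk k" "shf k" n s] unfolding cf_def by linarith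

text \<open>A difference of harmonic numbers: the Euler-Mascheroni constants cancel and leave the
  logarithm of m / (m div 2 + 1), a ratio tending to 2.\<close>

lemma harmonic_window: "(\<lambda>m. \<Sum>k\<in>{m div 2 + 1..<m}. 2 / real (Suc k)) \<longlonglongrightarrow> 2 * ln 2"
proof -
  define \<gamma> where "\<gamma> n = harm n - ln (real n)" for n
  have \<gamma>: "\<gamma> \<longlonglongrightarrow> euler_mascheroni" unfolding \<gamma>_def by (rule euler_mascheroni_LIMSEQ)
  have half: "filterlim (\<lambda>m::nat. m div 2 + 1) at_top at_top"
    unfolding filterlim_at_top eventually_at_top_linorder
  proof
    fix Z :: nat
    show "\<exists>N. \<forall>n\<ge>N. Z \<le> n div 2 + 1" by (rule exI[of _ "2 * Z"]) auto
  qed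
  have ratio: "(\<lambda>m. real m / real (m div 2 + 1)) \<longlonglongrightarrow> 2"
  proof (rule tendsto_sandwich)
    show "\<forall>\<^sub>F m in sequentially. 2 - 4 / real m \<le> real m / real (m div 2 + 1)"
    proof (rule eventually_sequentiallyI[of 1])
      fix m :: nat assume "1 \<le> m"
      then have "2 - 4 / real m \<le> real m / (real m / 2 + 1)" by (simp add: field_simps)
      also have "2 * (m div 2) \<le> m" by simp
      then have "real (m div 2 + 1) \<le> real m / 2 + 1" by linarith
      then have "real m / (real m / 2 + 1) \<le> real m / real (m div 2 + 1)"
        by (intro divide_left_mono) auto
      finally show "2 - 4 / real m \<le> real m / real (m div 2 + 1)" .
    qed
    show "\<forall>\<^sub>F m in sequentially. real m / real (m div 2 + 1) \<le> 2"
    proof (rule always_eventually, rule allI)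
      fix m :: nat
      have "m \<le> 2 * (m div 2 + 1)" by auto
      then have "real m \<le> 2 * real (m div 2 + 1)" by linarith
      then show "real m / real (m div 2 + 1) \<le> 2" by (simp add: field_simps)
    qed
    show "(\<lambda>m. 2 - 4 / real m) \<longlonglongrightarrow> 2"
      using tendsto_diff[OF tendsto_const lim_const_over_n, of 2 4] by simp
  qed auto
  have "(\<lambda>m. 2 * (\<gamma> m - \<gamma> (m div 2 + 1) + ln (real m / real (m div 2 + 1)))) \<longlonglongrightarrow>
      2 * (euler_mascheroni - euler_mascheroni + ln 2)"
    by (intro tendsto_intros \<gamma> filterlim_compose[OF \<gamma> half] ratio) auto
  moreover have "\<forall>\<^sub>F m in sequentially. 2 * (\<gamma> m - \<gamma> (m div 2 + 1) + ln (real m / real (m div 2 + 1)))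
      = (\<Sum>k\<in>{m div 2 + 1..<m}. 2 / real (Suc k))"
  proof (rule eventually_sequentiallyI[of 2])
    fix m :: nat assume m: "2 \<le> m"
    have h: "harm n = (\<Sum>k<n. 1 / real (Suc k))" for n
      by (induction n) (simp_all add: harm_Suc harm_expand(1) inverse_eq_divide del: of_nat_Suc)
    have "2 * (\<gamma> m - \<gamma> (m div 2 + 1) + ln (real m / real (m div 2 + 1))) = 2 * (harm m - harm (m div 2 + 1))"
      using m by (simp add: \<gamma>_def ln_div del: of_nat_Suc of_nat_add)
    also have "harm m - harm (m div 2 + 1) = (\<Sum>k\<in>{m div 2 + 1..<m}. 1 / real (Suc k))"
    proof -
      have "{..<m} = {..<m div 2 + 1} \<union> {m div 2 + 1..<m}" using m by auto
      then have "harm m = (\<Sum>k\<in>{..<m div 2 + 1} \<union> {m div 2 + 1..<m}. 1 / real (Suc k))" by (simp only: h)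
      also have "\<dots> = harm (m div 2 + 1) + (\<Sum>k\<in>{m div 2 + 1..<m}. 1 / real (Suc k))"
        unfolding h by (rule sum.union_disjoint) auto
      finally show ?thesis by simp
    qed
    finally show "2 * (\<gamma> m - \<gamma> (m div 2 + 1) + ln (real m / real (m div 2 + 1)))
      = (\<Sum>k\<in>{m div 2 + 1..<m}. 2 / real (Suc k))" by (simp add: sum_distrib_left)
  qed
  ultimately show ?thesis by (simp add: Lim_transform_eventually)
qed

text \<open>\<open>lev n\<close> is the \<open>m\<close> with \<open>blk m \<le> n < blk (m + 1)\<close>, except that \<open>lev 0 = lev 1 = 0\<close>.\<close>

definition lev :: "nat \<Rightarrow> nat" where "lev n = (LEAST m. n < blk (Suc m))"

lemma lev_less: "n < blk (Suc (lev n))"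
  unfolding lev_def
proof (rule LeastI)
  show "n < blk (Suc n)" using blk_ge_Suc[of "Suc n"] by linarith
qed

lemma lev_le: "2 \<le> n \<Longrightarrow> blk (lev n) \<le> n"
proof (cases "lev n")
  case (Suc m)
  then have "\<not> n < blk (Suc m)" unfolding lev_def using not_less_Least by (metis lessI)
  then show ?thesis using Suc by simp
qed auto

lemma filterlim_lev: "filterlim lev at_top sequentially"
  unfolding filterlim_at_top eventually_at_top_linorder
proof
  fix Z
  have "Z \<le> lev n" if "n \<ge> blk Z" for n
  proof (rule ccontr)
    assume "\<not> Z \<le> lev n"
    then have "blk (Suc (lev n)) \<le> blk Z" by (intro blk_mono) auto
    then show False using lev_less[of n] that by linarith
  qed
  then show "\<exists>N. \<forall>n\<ge>N. Z \<le> lev n" by blast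
qed

text \<open>The time n lies at scale m. Summands below \<open>k0\<close> will be those without
  independence left, and those from \<open>K\<close> on are cut off; the bound on \<open>k0\<close>
  keeps the whole active window inside [k0, K).\<close>

locale scale =
  fixes n m k0 K :: nat
  assumes m: "6 \<le> m" and n: "blk m \<le> n" "n < blk (Suc m)"
    and k0: "2 * k0 \<le> m + 2" and K: "m < K"
begin

lemma n_pos: "0 < n" using n(1) blk_pos[of m] by linarith

text \<open>The longest moving average among the active summands; even its eighth power is at most
  n.\<close>

definition j where "j = blk (m - 1)"

lemma j_pow8: "j ^ 8 \<le> n"
  using blk_pow8[of "m - 1" m] m n(1) by (simp add: j_def)

lemma j_ge: "m \<le> j" "2 \<le> j"
  using blk_ge_Suc[of "m - 1"] m by (auto simp: j_def)

lemma j_sq: "real m * real j ^ 2 \<le> n"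
proof -
  have "m * j ^ 2 \<le> j * j ^ 2" using j_ge by (intro mult_right_mono) auto
  also have "\<dots> = j ^ 3" by (simp add: power2_eq_square power3_eq_cube)
  also have "\<dots> \<le> j ^ 8" using j_ge by (intro power_increasing) auto
  also note j_pow8
  finally show ?thesis by (simp flip: of_nat_power of_nat_mult)
qed

lemma mj_le: "real m * real j \<le> n / m"
proof -
  have "real m * (real m * real j) \<le> real m * (real j * real j)"
    using j_ge by (intro mult_left_mono mult_right_mono) auto
  also have "\<dots> \<le> n" using j_sq by (simp add: power2_eq_square)
  finally show ?thesis using m by (simp add: field_simps)
qed

abbreviation "act \<equiv> {m div 2 + 1..<m}"

lemma act: "k \<in> act \<Longrightarrow> k0 \<le> k \<and> k < K \<and> blk k \<le> j \<and> blk k \<le> n \<and> n \<le> shf k"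
proof -
  assume k: "k \<in> act"
  then have "blk (Suc m) \<le> shf k" unfolding shf_def by (intro blk_mono) auto
  moreover have "blk k \<le> blk m" "blk k \<le> j" using k by (auto simp: j_def intro!: blk_mono)
  ultimately show ?thesis using k k0 K n by auto
qed

text \<open>The summand k = m may be entering its active range, but its weight is at most 2/m.
  Beyond it, block lengths of at least 4^i n turn \<open>var_le_early\<close> into a geometric
  series.\<close>

lemma var_tail: "(\<Sum>k\<in>{m..<K}. var k n) \<le> 6 * (real n / real m)"
proof -
  have "{m..<K} = insert m {Suc m..<K}" using K by auto
  then have "(\<Sum>k\<in>{m..<K}. var k n) = var m n + (\<Sum>k\<in>{Suc m..<K}. var k n)" by simp
  moreover have "var m n \<le> 2 * n / m"
    using m by (intro order_trans[OF var_le] frac_le) auto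
  moreover have "(\<Sum>k\<in>{Suc m..<K}. var k n) \<le> 4 * n / m"
  proof -
    have "(\<Sum>k\<in>{Suc m..<K}. var k n) = (\<Sum>i<K - Suc m. var (Suc m + i) n)"
      using sum.shift_bounds_nat_ivl[of "\<lambda>k. var k n" 0 "Suc m" "K - Suc m"] K
      by (simp add: atLeast0LessThan add.commute)
    also have "\<dots> \<le> (\<Sum>i<K - Suc m. 2 * n / m * (1 / 4) ^ i)"
    proof (rule sum_mono)
      fix i
      have "4 ^ i * n \<le> blk (Suc m + i)"
        using blk_geometric[of i "Suc m"] n(2) by (metis le_trans less_imp_le_nat mult_le_mono2)
      then have "real (4 ^ i * n) \<le> blk (Suc m + i)" by (simp only: of_nat_le_iff)
      then have b: "4 ^ i * real n \<le> blk (Suc m + i)" by simp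
      have "var (Suc m + i) n \<le> 2 * real n ^ 2 / (real (Suc (Suc m + i)) * real (blk (Suc m + i)))" by (rule var_le_early)
      also have "\<dots> \<le> 2 * real n ^ 2 / (m * (4 ^ i * real n))"
        using m n_pos b by (intro divide_left_mono mult_mono mult_pos_pos) auto
      also have "\<dots> = 2 * n / m * (1 / 4) ^ i" using n_pos by (simp add: power2_eq_square field_simps)
      finally show "var (Suc m + i) n \<le> 2 * n / m * (1 / 4) ^ i" .
    qed
    also have "\<dots> = 2 * n / m * (\<Sum>i<K - Suc m. (1 / 4) ^ i)" by (simp add: sum_distrib_left)
    also have "\<dots> \<le> 2 * n / m * 2"
    proof (rule mult_left_mono)
      have "(\<Sum>i<K - Suc m. (1 / 4 :: real) ^ i) \<le> (\<Sum>i. (1 / 4) ^ i)"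
        by (rule sum_le_suminf) (auto simp: summable_geometric)
      also have "\<dots> \<le> 2" by (simp add: suminf_geometric)
      finally show "(\<Sum>i<K - Suc m. (1 / 4 :: real) ^ i) \<le> 2" .
    qed auto
    finally show ?thesis by simp
  qed
  ultimately show ?thesis by simp
qed

text \<open>For k < m div 2 the shift blk (2 k) is at most \<open>j\<close>, so these summands
  contribute at most 2 j each. The borderline k = m div 2 is estimated by its weight, at most
  4/m.\<close>

lemma var_head: "(\<Sum>k\<in>{k0..<m div 2 + 1}. var k n) \<le> 6 * (real n / real m)"
proof -
  have "(\<Sum>k\<in>{k0..<m div 2 + 1}. var k n) \<le> (\<Sum>k\<in>{..m div 2}. var k n)"
    by (rule sum_mono2) (auto simp: var_nonneg)
  also have "\<dots> = (\<Sum>k<m div 2. var k n) + var (m div 2) n"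
    by (simp add: lessThan_Suc_atMost[symmetric])
  also have "(\<Sum>k<m div 2. var k n) \<le> (\<Sum>k<m div 2. 2 * real j)"
  proof (rule sum_mono)
    fix k assume "k \<in> {..<m div 2}"
    then have "shf k \<le> j" unfolding shf_def j_def by (intro blk_mono) auto
    have "var k n \<le> 2 * shf k / Suc k" by (rule var_le_late)
    also have "\<dots> \<le> 2 * real j / 1" using \<open>shf k \<le> j\<close> by (intro frac_le) auto
    finally show "var k n \<le> 2 * real j" by simp
  qed
  also have "\<dots> \<le> 2 * (real m * real j)"
  proof -
    have "real (m div 2) * real j \<le> real m * real j" by (intro mult_right_mono) auto
    then show ?thesis by simp
  qed
  also have "\<dots> \<le> 2 * (n / m)" using mj_le by simp
  also have "var (m div 2) n \<le> 4 * n / m"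
  proof -
    have "m \<le> 2 * Suc (m div 2)" by auto
    then have "real m \<le> 2 * real (Suc (m div 2))" by linarith
    then have "4 * real n / (2 * real (Suc (m div 2))) \<le> 4 * real n / m"
      using m by (intro divide_left_mono) auto
    then have "2 * real n / real (Suc (m div 2)) \<le> 4 * real n / m" by (simp del: of_nat_Suc)
    then show ?thesis using var_le[of "m div 2" n] by simp
  qed
  finally show ?thesis by simp
qed

lemma var_split: "(\<Sum>k\<in>{k0..<K}. var k n)
    = (\<Sum>k\<in>{k0..<m div 2 + 1}. var k n) + (\<Sum>k\<in>act. var k n) + (\<Sum>k\<in>{m..<K}. var k n)"
proof -
  have le: "k0 \<le> m div 2 + 1" "m div 2 + 1 \<le> m" "m \<le> K" using k0 m K by auto
  have "(\<Sum>k\<in>{k0..<K}. var k n) = (\<Sum>k\<in>{k0..<m}. var k n) + (\<Sum>k\<in>{m..<K}. var k n)"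
    using le by (intro sum.atLeastLessThan_concat[symmetric]) auto
  also have "(\<Sum>k\<in>{k0..<m}. var k n) = (\<Sum>k\<in>{k0..<m div 2 + 1}. var k n) + (\<Sum>k\<in>act. var k n)"
    using le by (intro sum.atLeastLessThan_concat[symmetric]) auto
  finally show ?thesis .
qed

text \<open>The constant is 6 + 6 + 2: head, tail, and the boundary terms \<open>blk k\<close> lost
  in \<open>var_ge\<close>.\<close>

lemma var_total: "\<bar>(\<Sum>k\<in>{k0..<K}. var k n) / n - (\<Sum>k\<in>act. 2 / real (Suc k))\<bar> \<le> 14 / m"
proof -
  have "(\<Sum>k\<in>act. var k n) \<le> (\<Sum>k\<in>act. n * (2 / real (Suc k)))"
    by (rule sum_mono) (use var_le[of _ n] in \<open>simp add: mult.commute\<close>)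
  moreover have "(\<Sum>k\<in>act. n * (2 / real (Suc k))) - 2 * (n / m) \<le> (\<Sum>k\<in>act. var k n)"
  proof -
    have "(\<Sum>k\<in>act. n * (2 / real (Suc k)) - 2 * real j) \<le> (\<Sum>k\<in>act. var k n)"
    proof (rule sum_mono)
      fix k assume k: "k \<in> act"
      have "real n * (2 / real (Suc k)) - 2 * real j \<le> 2 * (real n - blk k) / Suc k"
      proof -
        have "2 * real (blk k) / Suc k \<le> 2 * real j / 1" using act[OF k] by (intro frac_le) auto
        then show ?thesis by (simp add: right_diff_distrib diff_divide_distrib mult.commute)
      qed
      also have "\<dots> \<le> var k n" using act[OF k] by (intro var_ge) auto
      finally show "real n * (2 / real (Suc k)) - 2 * real j \<le> var k n" .
    qed
    moreover have "(\<Sum>k\<in>act. 2 * real j) \<le> 2 * (n / m)"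
    proof -
      have "(\<Sum>k\<in>act. 2 * real j) = 2 * (real (card act) * real j)" by simp
      also have "\<dots> \<le> 2 * (real m * real j)" by (intro mult_left_mono mult_right_mono) auto
      also have "\<dots> \<le> 2 * (n / m)" using mj_le by simp
      finally show ?thesis .
    qed
    ultimately show ?thesis by (simp add: sum_subtractf)
  qed
  moreover have "0 \<le> (\<Sum>k\<in>{k0..<m div 2 + 1}. var k n)" "0 \<le> (\<Sum>k\<in>{m..<K}. var k n)"
    by (simp_all add: sum_nonneg var_nonneg)
  ultimately have "\<bar>(\<Sum>k\<in>{k0..<K}. var k n) - (\<Sum>k\<in>act. n * (2 / real (Suc k)))\<bar> \<le> 14 * (real n / real m)"
    using var_split var_tail var_head unfolding abs_le_iff by linarith
  moreover have "(\<Sum>k\<in>{k0..<K}. var k n) / n - (\<Sum>k\<in>act. 2 / real (Suc k))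
      = ((\<Sum>k\<in>{k0..<K}. var k n) - (\<Sum>k\<in>act. n * (2 / real (Suc k)))) / n"
    using n_pos by (simp add: diff_divide_distrib sum_divide_distrib)
  ultimately show ?thesis using n_pos by (simp add: abs_divide field_simps)
qed

end

section \<open>Characteristic functions: decay and Gaussian approximation\<close>

definition Phi :: "nat \<Rightarrow> nat \<Rightarrow> nat \<Rightarrow> real \<Rightarrow> real" where
  "Phi k0 K n \<theta> = (\<Prod>k\<in>{k0..<K}. fac k n \<theta>)"

lemma one_minus_cos: "1 - cos x = 2 * (sin (x / 2))\<^sup>2" for x :: real
  using cos_double_sin[of "x / 2"] by simp

lemma one_minus_cos_le: "1 - cos x \<le> x\<^sup>2 / 2" for x :: real
proof -
  have "(sin (x / 2))\<^sup>2 \<le> (x / 2)\<^sup>2" using abs_sin_x_le_abs_x[of "x / 2"] abs_le_square_iff[of "sin (x / 2)" "x / 2"] by blast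
  then show ?thesis by (simp add: one_minus_cos power_divide)
qed

text \<open>Jordan's inequality sin y \<ge> 2 y / pi on [0, pi/2], from concavity of the
  sine.\<close>

lemma one_minus_cos_ge:
  fixes x :: real
  assumes "\<bar>x\<bar> \<le> pi"
  shows "2 * x\<^sup>2 / pi\<^sup>2 \<le> 1 - cos x"
proof -
  have *: "2 / pi * y \<le> sin y" if y: "0 \<le> y" "y \<le> pi / 2" for y :: real
  proof -
    define u where "u = 2 * y / pi"
    have u: "0 \<le> u" "u \<le> 1" using y by (auto simp: u_def field_simps)
    have conc: "concave_on {0..pi} sin"
      by (rule f''_le0_imp_concave[where f'=cos and f''="\<lambda>x. - sin x"])
        (auto intro!: derivative_eq_intros sin_ge_zero)
    have "(1 - u) * sin 0 + u * sin (pi / 2) \<le> sin ((1 - u) *\<^sub>R 0 + u *\<^sub>R (pi / 2))"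
      by (rule concave_onD[OF conc]) (use u in auto)
    then show ?thesis by (simp add: u_def)
  qed
  have "2 / pi * (\<bar>x\<bar> / 2) \<le> sin (\<bar>x\<bar> / 2)" by (rule *) (use assms in auto)
  then have "(2 / pi * (\<bar>x\<bar> / 2))\<^sup>2 \<le> (sin (\<bar>x\<bar> / 2))\<^sup>2" by (intro power_mono) auto
  moreover have "(sin (\<bar>x\<bar> / 2))\<^sup>2 = (sin (x / 2))\<^sup>2" by (cases "0 \<le> x") auto
  ultimately show ?thesis by (simp add: one_minus_cos power_divide power_mult_distrib)
qed

text \<open>A triangle inequality: the modulus of sin (x/2) is subadditive, and 1 - cos x is twice
  its square.\<close>

lemma one_minus_cos_diff_le: "1 - cos (a - b) \<le> 2 * (1 - cos a) + 2 * (1 - cos b)" for a b :: real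
proof -
  define s where "s = sin (a / 2)" define t where "t = sin (b / 2)"
  have "\<bar>sin (a / 2 - b / 2)\<bar> \<le> \<bar>s\<bar> + \<bar>t\<bar>"
  proof -
    have "\<bar>sin (a / 2 - b / 2)\<bar> \<le> \<bar>s * cos (b / 2)\<bar> + \<bar>cos (a / 2) * t\<bar>"
      unfolding sin_diff s_def t_def by (rule abs_triangle_ineq4)
    also have "\<dots> \<le> \<bar>s\<bar> * 1 + 1 * \<bar>t\<bar>"
      unfolding abs_mult by (intro add_mono mult_mono abs_cos_le_one) auto
    finally show ?thesis by simp
  qed
  then have "(sin (a / 2 - b / 2))\<^sup>2 \<le> (\<bar>s\<bar> + \<bar>t\<bar>)\<^sup>2"
    by (metis abs_ge_zero power2_abs power_mono)
  also have "\<dots> \<le> 2 * s\<^sup>2 + 2 * t\<^sup>2"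
    using zero_le_power2[of "\<bar>s\<bar> - \<bar>t\<bar>"] by (simp add: power2_sum power2_diff)
  finally show ?thesis by (simp add: one_minus_cos s_def t_def diff_divide_distrib)
qed

lemma one_minus_cos_mult_le: "1 - cos (real N * x) \<le> (real N)\<^sup>2 * (1 - cos x)"
proof -
  have "\<bar>sin (real N * y)\<bar> \<le> real N * \<bar>sin y\<bar>" for y
  proof (induction N)
    case (Suc N)
    have "\<bar>sin (real (Suc N) * y)\<bar> \<le> \<bar>sin (real N * y) * cos y\<bar> + \<bar>cos (real N * y) * sin y\<bar>"
      by (simp add: distrib_right sin_add add.commute) (metis abs_triangle_ineq add.commute mult.commute)
    also have "\<dots> \<le> \<bar>sin (real N * y)\<bar> * 1 + 1 * \<bar>sin y\<bar>"
      unfolding abs_mult by (intro add_mono mult_mono abs_cos_le_one) auto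
    finally show ?case using Suc by (simp add: distrib_right)
  qed auto
  from power_mono[OF this[of "x / 2"], of 2] show ?thesis
    by (simp add: one_minus_cos power_mult_distrib)
qed

text \<open>Taylor expansion of exp (i x) to third order; the cubic term is imaginary, so the real
  part has a quartic error.\<close>

lemma cos_quartic: "\<bar>1 - cos x - x\<^sup>2 / 2\<bar> \<le> x ^ 4 / 24" for x :: real
proof -
  have "cmod (iexp x - (\<Sum>k\<le>3. (\<i> * x) ^ k / fact k)) \<le> \<bar>x\<bar> ^ Suc 3 / fact (Suc 3)"
    by (rule iexp_approx1)
  moreover have "Re (iexp x - (\<Sum>k\<le>3. (\<i> * x) ^ k / fact k)) = cos x - 1 + x\<^sup>2 / 2"
    by (simp add: numeral_3_eq_3 power2_eq_square flip: cis_conv_exp)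
  ultimately have "\<bar>cos x - 1 + x\<^sup>2 / 2\<bar> \<le> \<bar>x\<bar> ^ 4 / 24"
    using abs_Re_le_cmod[of "iexp x - (\<Sum>k\<le>3. (\<i> * x) ^ k / fact k)"] by (simp add: fact_numeral)
  moreover have "1 - cos x - x\<^sup>2 / 2 = - (cos x - 1 + x\<^sup>2 / 2)" by simp
  ultimately show ?thesis by (simp only: abs_minus_cancel power_even_abs_numeral even_numeral)
qed

lemma exp_minus_bounds:
  fixes y :: real
  assumes "0 \<le> y"
  shows "1 - y \<le> exp (- y)" "exp (- y) \<le> 1 - y + y\<^sup>2" "exp (- y) \<le> 1"
proof -
  show "1 - y \<le> exp (- y)" using exp_ge_add_one_self[of "- y"] by simp
  show "exp (- y) \<le> 1" using assms by simp
  have "exp (- y) = 1 / exp y" by (simp add: exp_minus field_simps)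
  also have "\<dots> \<le> 1 / (1 + y)" using assms exp_ge_add_one_self[of y] by (intro divide_left_mono) auto
  also have "\<dots> \<le> 1 - y + y\<^sup>2"
  proof -
    have "1 \<le> (1 - y + y\<^sup>2) * (1 + y)" using assms by (simp add: algebra_simps power2_eq_square)
    then show ?thesis using assms by (simp add: divide_le_eq)
  qed
  finally show "exp (- y) \<le> 1 - y + y\<^sup>2" .
qed

text \<open>The quartic bound serves the summands k < m, whose coefficients are small against sqrt
  n. For k \<ge> m they may be large, and the quadratic bound is used because the total variance
  there is negligible.\<close>

lemma factor_approx:
  fixes q b :: real
  assumes q: "0 \<le> q" "q \<le> 1"
  shows "\<bar>(1 - q * (1 - cos b)) - exp (- (q * b\<^sup>2 / 2))\<bar> \<le> q * b ^ 4"
    and "\<bar>(1 - q * (1 - cos b)) - exp (- (q * b\<^sup>2 / 2))\<bar> \<le> q * b\<^sup>2"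
proof -
  define y where "y = q * b\<^sup>2 / 2"
  have y: "0 \<le> y" using q by (simp add: y_def)
  note e = exp_minus_bounds[OF y]
  have c1: "q * (1 - cos b) \<le> y" using mult_left_mono[OF one_minus_cos_le[of b] q(1)] by (simp add: y_def)
  have c0: "0 \<le> q * (1 - cos b)" using q by simp
  show "\<bar>(1 - q * (1 - cos b)) - exp (- (q * b\<^sup>2 / 2))\<bar> \<le> q * b\<^sup>2"
    using e c1 c0 y unfolding y_def abs_le_iff by linarith
  have "q * (1 - cos b) - y = q * (1 - cos b - b\<^sup>2 / 2)" by (simp add: y_def algebra_simps)
  then have "\<bar>q * (1 - cos b) - y\<bar> = q * \<bar>1 - cos b - b\<^sup>2 / 2\<bar>"
    using q by (simp only: abs_mult abs_of_nonneg)
  also have "\<dots> \<le> q * (b ^ 4 / 24)" by (intro mult_left_mono cos_quartic q)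
  finally have d1: "\<bar>q * (1 - cos b) - y\<bar> \<le> q * b ^ 4 / 24" by simp
  have "y\<^sup>2 = (q * q) * (b ^ 4 / 4)" by (simp add: y_def power2_eq_square power4_eq_xxxx)
  also have "\<dots> \<le> q * (b ^ 4 / 4)" using q by (intro mult_right_mono mult_left_le) auto
  finally have d2: "y\<^sup>2 \<le> q * b ^ 4 / 4" by simp
  have b4: "0 \<le> q * b ^ 4" using q by simp
  show "\<bar>(1 - q * (1 - cos b)) - exp (- (q * b\<^sup>2 / 2))\<bar> \<le> q * b ^ 4"
    using e d1 d2 b4 unfolding y_def[symmetric] abs_le_iff by linarith
qed

lemma fac_factor:
  fixes \<theta> :: real
  shows "0 \<le> 1 - 2 / real (lets k) * (1 - cos \<theta>)" "1 - 2 / real (lets k) * (1 - cos \<theta>) \<le> 1"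
    "2 / real (lets k) \<le> 1"
proof -
  have l: "8 \<le> real (lets k)" using lets_ge[of k] by linarith
  have "2 / real (lets k) * (1 - cos \<theta>) \<le> 2 / 8 * 2"
    using l cos_ge_minus_one[of \<theta>] by (intro mult_mono divide_left_mono) auto
  then have "2 / real (lets k) * (1 - cos \<theta>) \<le> 1" by (rule order_trans) simp
  then show "0 \<le> 1 - 2 / real (lets k) * (1 - cos \<theta>)" by (simp only: diff_ge_0_iff_ge)
  show "1 - 2 / real (lets k) * (1 - cos \<theta>) \<le> 1" by simp
  show "2 / real (lets k) \<le> 1" using l by simp
qed

lemma fac_nonneg: "0 \<le> fac k n \<theta>" and fac_le_1: "fac k n \<theta> \<le> 1"
  unfolding fac_def by (intro prod_nonneg prod_le_1 ballI conjI fac_factor)+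

lemma Phi_nonneg: "0 \<le> Phi k0 K n \<theta>" and Phi_le_1: "Phi k0 K n \<theta> \<le> 1"
  unfolding Phi_def by (intro prod_nonneg prod_le_1 ballI conjI fac_nonneg fac_le_1)+

lemma continuous_on_Phi [continuous_intros]:
  fixes f :: "real \<Rightarrow> real"
  assumes [continuous_intros]: "continuous_on A f"
  shows "continuous_on A (\<lambda>x. Phi k0 K n (f x))"
  unfolding Phi_def fac_def by (intro continuous_intros)

lemma Phi_measurable [measurable]: "Phi k0 K n \<in> borel_measurable borel"
  by (intro borel_measurable_continuous_onI continuous_intros)

abbreviation decay :: "nat \<Rightarrow> nat \<Rightarrow> real \<Rightarrow> real" where
  "decay k n \<theta> \<equiv> n / (real (Suc k) * real (blk k) ^ 2) * (1 - cos (\<theta> * real (blk k)))"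

text \<open>Each factor 1 - y is at most exp (-y). The exponent keeps only the two plateaus with
  coefficients plus or minus \<open>blk k\<close>, each counted with length n/2, which is at most n
  - blk k.\<close>

lemma fac_le_exp:
  fixes \<theta> :: real
  assumes "blk k \<le> n" "n \<le> shf k" "2 * blk k \<le> n"
  shows "fac k n \<theta> \<le> exp (- (decay k n \<theta>))"
proof -
  define q where "q = 2 / real (lets k)"
  have q: "0 \<le> q" by (simp add: q_def)
  have "fac k n \<theta> \<le> (\<Prod>s<n + blk k + shf k. exp (- (q * (1 - cos (\<theta> * cf k n s)))))"
    unfolding fac_def q_def[symmetric]
  proof (intro prod_mono conjI)
    fix s
    show "0 \<le> 1 - q * (1 - cos (\<theta> * cf k n s))" unfolding q_def by (rule fac_factor)
    show "1 - q * (1 - cos (\<theta> * cf k n s)) \<le> exp (- (q * (1 - cos (\<theta> * cf k n s))))"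
      using exp_ge_add_one_self[of "- (q * (1 - cos (\<theta> * cf k n s)))"] by simp
  qed
  also have "\<dots> = exp (- (q * (\<Sum>s<n + blk k + shf k. 1 - cos (\<theta> * cf k n s))))"
    by (simp add: exp_sum[symmetric] sum_negf sum_distrib_left)
  also have "\<dots> \<le> exp (- (q * (n * (1 - cos (\<theta> * blk k)))))"
  proof -
    have "n * (1 - cos (\<theta> * blk k)) = (n / 2) * ((1 - cos (\<theta> * blk k)) + (1 - cos (\<theta> * - real (blk k))))" by simp
    also have "\<dots> \<le> (real n - blk k) * ((1 - cos (\<theta> * blk k)) + (1 - cos (\<theta> * - real (blk k))))"
      using assms(3) by (intro mult_right_mono) auto
    also have "\<dots> \<le> (\<Sum>s<n + blk k + shf k. 1 - cos (\<theta> * cf k n s))"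
      by (rule cf_sum_ge[of "\<lambda>x. 1 - cos (\<theta> * x)"]) (use assms in auto)
    finally show ?thesis using q by (simp add: mult_left_mono)
  qed
  finally show ?thesis unfolding q_def two_div_lets by simp
qed

context scale begin

lemma Phi_le_exp: "Phi k0 K n \<theta> \<le> exp (- (\<Sum>k\<in>act. decay k n \<theta>))"
  for \<theta> :: real
proof -
  have "Phi k0 K n \<theta> \<le> (\<Prod>k\<in>act. fac k n \<theta>)"
  proof -
    have sub: "act \<subseteq> {k0..<K}" by (rule subsetI) (use act in auto)
    have "Phi k0 K n \<theta> = (\<Prod>k\<in>{k0..<K} - act. fac k n \<theta>) * (\<Prod>k\<in>act. fac k n \<theta>)"
      unfolding Phi_def by (rule prod.subset_diff[OF sub]) simp
    also have "\<dots> \<le> 1 * (\<Prod>k\<in>act. fac k n \<theta>)"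
      by (intro mult_right_mono prod_le_1 prod_nonneg conjI fac_nonneg fac_le_1)
    finally show ?thesis by simp
  qed
  also have "\<dots> \<le> (\<Prod>k\<in>act. exp (- (decay k n \<theta>)))"
  proof (intro prod_mono conjI fac_nonneg fac_le_exp)
    fix k assume k: "k \<in> act"
    have "2 * j \<le> j ^ 2" using j_ge by (simp add: power2_eq_square)
    also have "\<dots> \<le> j ^ 8" using j_ge by (intro power_increasing) auto
    also note j_pow8
    finally show "2 * blk k \<le> n" using act[OF k] by linarith
  qed (use act in auto)
  also have "\<dots> = exp (- (\<Sum>k\<in>act. decay k n \<theta>))"
    by (simp add: exp_sum[symmetric] sum_negf)
  finally show ?thesis .
qed

text \<open>Here \<open>\<theta> * blk k\<close> lies in [-pi, pi] for every active k, where 1 - cos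
  is bounded below by a square. At least m/4 summands are active, each giving at least a constant
  times n \<theta>^2 / m.\<close>

lemma Phi_low_frequency:
  fixes \<theta> :: real
  assumes "\<bar>\<theta>\<bar> * j \<le> pi"
  shows "Phi k0 K n \<theta> \<le> exp (- (n * \<theta>\<^sup>2 / (2 * pi\<^sup>2)))"
proof -
  have "n * \<theta>\<^sup>2 / (2 * pi\<^sup>2) \<le> (\<Sum>k\<in>act. 2 * n * \<theta>\<^sup>2 / (pi\<^sup>2 * m))"
  proof -
    have "card act = m - (m div 2 + 1)" by simp
    then have "m \<le> 4 * card act" using m by linarith
    then have "real m \<le> 4 * card act" by linarith
    then have "real m * (n * \<theta>\<^sup>2) \<le> 4 * card act * (n * \<theta>\<^sup>2)" by (rule mult_right_mono) auto
    then have "n * \<theta>\<^sup>2 / (2 * pi\<^sup>2) \<le> card act * (2 * n * \<theta>\<^sup>2 / (pi\<^sup>2 * m))" using m by (simp add: field_simps)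
    then show ?thesis by simp
  qed
  also have "\<dots> \<le> (\<Sum>k\<in>act. decay k n \<theta>)"
  proof (rule sum_mono)
    fix k assume k: "k \<in> act"
    have "\<bar>\<theta> * blk k\<bar> \<le> \<bar>\<theta>\<bar> * j" using act[OF k] by (auto simp: abs_mult intro!: mult_left_mono)
    then have "2 * (\<theta> * blk k)\<^sup>2 / pi\<^sup>2 \<le> 1 - cos (\<theta> * blk k)" using assms by (intro one_minus_cos_ge) auto
    then have "n / (real (Suc k) * real (blk k) ^ 2) * (2 * (\<theta> * blk k)\<^sup>2 / pi\<^sup>2)
        \<le> decay k n \<theta>" by (intro mult_left_mono) auto
    moreover have "n / (real (Suc k) * real (blk k) ^ 2) * (2 * (\<theta> * blk k)\<^sup>2 / pi\<^sup>2) = 2 * n * \<theta>\<^sup>2 / (pi\<^sup>2 * Suc k)"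
      by (simp add: power_mult_distrib field_simps del: of_nat_Suc)
    moreover have "2 * n * \<theta>\<^sup>2 / (pi\<^sup>2 * m) \<le> 2 * n * \<theta>\<^sup>2 / (pi\<^sup>2 * Suc k)"
      using k by (intro divide_left_mono mult_left_mono mult_pos_pos) auto
    ultimately show "2 * n * \<theta>\<^sup>2 / (pi\<^sup>2 * m) \<le> decay k n \<theta>" by linarith
  qed
  finally show ?thesis using Phi_le_exp[of \<theta>] by (meson exp_le_cancel_iff neg_le_iff_le order_trans)
qed

text \<open>Two consecutive block lengths are coprime, \<open>blk (k + 1) = blk k * blk k ^ 7 + 1\<close>, so that
  no frequency away from \<open>0\<close> is (nearly) invisible to both.\<close>

lemma Phi_high_frequency:
  fixes \<theta> :: real
  assumes \<theta>: "pi < \<bar>\<theta>\<bar> * j" "\<bar>\<theta>\<bar> \<le> pi"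
  shows "Phi k0 K n \<theta> \<le> 8 ^ 8 / n"
proof -
  define i where "i = blk (m - 2)"
  have ij: "j = i ^ 8 + 1"
  proof -
    have "m - 1 = Suc (m - 2)" using m by simp
    then show ?thesis unfolding i_def j_def by (simp only: blk.simps)
  qed
  have i0: "0 < i" by (simp add: i_def)
  have jr: "real j = real i * real i ^ 7 + 1" unfolding ij by (simp add: power_eq_if)
  define A where "A = 1 - cos (\<theta> * j)"
  define B where "B = 1 - cos (\<theta> * i)"
  have AB: "0 \<le> A" "0 \<le> B" by (auto simp: A_def B_def)
  have "2 / real j ^ 2 \<le> 1 - cos \<theta>"
  proof -
    have "(pi / j)\<^sup>2 \<le> \<bar>\<theta>\<bar>\<^sup>2" using \<theta>(1) j_ge by (intro power_mono) (auto simp: field_simps)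
    then have "2 * (pi / j)\<^sup>2 / pi\<^sup>2 \<le> 2 * \<theta>\<^sup>2 / pi\<^sup>2" by (intro divide_right_mono) auto
    then show ?thesis using one_minus_cos_ge[OF \<theta>(2)] by (simp add: power_divide)
  qed
  also have "1 - cos \<theta> \<le> 2 * A + 2 * (1 - cos (real (i ^ 7) * (\<theta> * i)))"
  proof -
    \<comment> \<open>Bezout relation j - i^7 i = 1: if \<open>\<theta> * j\<close> and
      \<open>\<theta> * i\<close> were both close to multiples of 2 pi, so would be \<theta>, which
      the preceding bound excludes.\<close>
    have "\<theta> = \<theta> * j - real (i ^ 7) * (\<theta> * i)" by (simp add: jr algebra_simps)
    then show ?thesis using one_minus_cos_diff_le[of "\<theta> * j" "real (i ^ 7) * (\<theta> * i)"] by (simp add: A_def)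
  qed
  also have "1 - cos (real (i ^ 7) * (\<theta> * i)) \<le> (real (i ^ 7))\<^sup>2 * B"
    unfolding B_def by (rule one_minus_cos_mult_le)
  finally have 1: "1 / real j ^ 2 \<le> A + (real (i ^ 7))\<^sup>2 * B" by simp
  also have "\<dots> \<le> real j ^ 2 * A + real j ^ 2 * B"
  proof (intro add_mono)
    have "1 \<le> real j ^ 2" using j_ge by simp
    then show "A \<le> real j ^ 2 * A" using AB mult_right_mono[of 1 "real j ^ 2" A] by simp
    have "real (i ^ 7) \<le> j"
    proof -
      have "i ^ 7 \<le> i ^ 8" using i0 by (intro power_increasing) auto
      then have "i ^ 7 \<le> j" by (simp add: ij)
      then show ?thesis by (simp only: of_nat_le_iff)
    qed
    then show "(real (i ^ 7))\<^sup>2 * B \<le> real j ^ 2 * B" using AB by (intro mult_right_mono power_mono) auto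
  qed
  finally have "1 / real j ^ 4 \<le> A + B" using j_ge by (simp add: field_simps power2_eq_square power4_eq_xxxx)
  then have "n / (real m * real j ^ 2) * (1 / real j ^ 4) \<le> n / (real m * real j ^ 2) * (A + B)"
    by (rule mult_left_mono) simp
  also have "n / (real m * real j ^ 2) * (A + B)
      \<le> (\<Sum>k\<in>{m - 2, m - 1}. decay k n \<theta>)"
  proof -
    have "i \<le> j" unfolding i_def j_def by (rule blk_mono) simp
    then have "n / (real m * real j ^ 2) \<le> n / (real (Suc (m - 2)) * real i ^ 2)"
      using m i0 by (intro divide_left_mono mult_mono power_mono mult_pos_pos) auto
    then have "n / (real m * real j ^ 2) * B \<le> n / (real (Suc (m - 2)) * real i ^ 2) * B"
      using AB by (intro mult_right_mono)
    moreover have "(\<Sum>k\<in>{m - 2, m - 1}. decay k n \<theta>)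
        = n / (real (Suc (m - 2)) * real i ^ 2) * B + n / (real m * real j ^ 2) * A"
    proof -
      have "Suc (m - 1) = m" "m - 2 \<noteq> m - 1" using m by auto
      then show ?thesis by (simp only: sum.insert sum.empty finite.intros A_def B_def i_def j_def) simp
    qed
    ultimately show ?thesis unfolding distrib_left by linarith
  qed
  also have "\<dots> \<le> (\<Sum>k\<in>act. decay k n \<theta>)"
    by (rule sum_mono2) (use m in auto)
  also have "n / (real m * real j ^ 2) * (1 / real j ^ 4) = n / (real m * real j ^ 6)"
    by (simp add: power_add[symmetric] mult.assoc)
  finally have 2: "n / (real m * real j ^ 6) \<le> (\<Sum>k\<in>act. decay k n \<theta>)" .
  \<comment> \<open>Here the exponent 8 in \<open>blk\<close> is used: j^8 \<le> n gives y^8 = n^8 /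
    j^56 \<ge> n, and exp (-y) is at most a constant times y^(-8).\<close>
  define y where "y = n / real j ^ 7"
  have y0: "0 < y" using n_pos j_ge by (simp add: y_def)
  have "y \<le> n / (real m * real j ^ 6)"
  proof -
    have "real m * real j ^ 6 \<le> real j * real j ^ 6" using j_ge by (intro mult_right_mono) auto
    then show ?thesis unfolding y_def using m j_ge
      by (intro divide_left_mono mult_pos_pos) (auto simp: power_Suc[symmetric] simp del: power_Suc)
  qed
  then have "Phi k0 K n \<theta> \<le> exp (- y)"
    using 2 Phi_le_exp[of \<theta>] by (meson exp_le_cancel_iff neg_le_iff_le order_trans)
  also have "exp (- y) \<le> 8 ^ 8 / y ^ 8"
  proof -
    have "(1 + y / real 8) ^ 8 \<le> exp y" by (rule exp_ge_one_plus_x_over_n_power_n) (use y0 in auto)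
    moreover have "(y / 8) ^ 8 \<le> (1 + y / 8) ^ 8" using y0 by (intro power_mono) auto
    ultimately have "y ^ 8 / 8 ^ 8 \<le> exp y" by (simp add: power_divide)
    then show ?thesis using y0 by (simp add: exp_minus field_simps)
  qed
  also have "8 ^ 8 / y ^ 8 \<le> 8 ^ 8 / n"
  proof -
    have "(real j ^ 8) ^ 7 \<le> real n ^ 7" using j_pow8 by (intro power_mono) (auto simp flip: of_nat_power)
    then have "real n * (real j ^ 8) ^ 7 \<le> real n * real n ^ 7" by (intro mult_left_mono) auto
    then have "real n * real j ^ 56 \<le> real n ^ 8" by (simp flip: power_Suc power_mult)
    then have "real n \<le> y ^ 8" using j_ge by (simp add: y_def power_divide field_simps flip: power_mult)
    then show ?thesis using n_pos y0 by (intro divide_left_mono) auto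
  qed
  finally show ?thesis .
qed

text \<open>The two frequency ranges merge into one integrable majorant. A bound of order 1/n is
  enough at high frequencies, because t^2 is at most pi^2 n on the domain of integration.\<close>

lemma Phi_dominated:
  assumes t: "\<bar>t\<bar> \<le> pi * sqrt n"
  shows "Phi k0 K n (t / sqrt n) \<le> 8 ^ 8 * (1 + pi\<^sup>2) * (1 / (1 + t\<^sup>2))"
proof -
  have sn: "0 < sqrt n" using n_pos by simp
  have pi1: "1 \<le> pi\<^sup>2" using pi_ge_two by (simp add: one_le_power)
  show ?thesis
  proof (cases "\<bar>t / sqrt n\<bar> * j \<le> pi")
    case True
    have "Phi k0 K n (t / sqrt n) \<le> exp (- (t\<^sup>2 / (2 * pi\<^sup>2)))"
      using Phi_low_frequency[OF True] n_pos by (simp add: power_divide)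
    also have "\<dots> \<le> 1 / (1 + t\<^sup>2 / (2 * pi\<^sup>2))"
      using exp_ge_add_one_self[of "t\<^sup>2 / (2 * pi\<^sup>2)"]
      by (simp add: exp_minus inverse_eq_divide) (intro divide_left_mono, auto intro!: mult_pos_pos add_pos_nonneg)
    also have "\<dots> \<le> 1 / ((1 + t\<^sup>2) / (2 * pi\<^sup>2))"
      using pi1 by (intro divide_left_mono mult_pos_pos) (auto simp: add_divide_distrib intro!: add_pos_nonneg divide_pos_pos)
    also have "\<dots> = 2 * pi\<^sup>2 * (1 / (1 + t\<^sup>2))" by simp
    also have "\<dots> \<le> 8 ^ 8 * (1 + pi\<^sup>2) * (1 / (1 + t\<^sup>2))" by (intro mult_right_mono mult_mono) auto
    finally show ?thesis .
  next
    case False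
    have "\<bar>t / sqrt n\<bar> \<le> pi" using t sn by (simp add: field_simps)
    then have "Phi k0 K n (t / sqrt n) \<le> 8 ^ 8 / n" using False by (intro Phi_high_frequency) auto
    also have "\<dots> \<le> 8 ^ 8 * (1 + pi\<^sup>2) * (1 / (1 + t\<^sup>2))"
    proof -
      have "t\<^sup>2 \<le> (pi * sqrt n)\<^sup>2" using t by (metis abs_ge_zero power2_abs power_mono)
      then have "1 + t\<^sup>2 \<le> n + pi\<^sup>2 * n" using n_pos by (simp add: power_mult_distrib)
      then have "1 + t\<^sup>2 \<le> (1 + pi\<^sup>2) * n" by (simp add: distrib_right)
      moreover have "0 < 1 + t\<^sup>2" by (intro add_pos_nonneg) auto
      ultimately show ?thesis using n_pos by (simp add: field_simps)
    qed
    finally show ?thesis .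
  qed
qed

text \<open>For numbers of modulus at most 1, products differ by at most the sum of the differences
  of the factors. For k < m the coefficients are at most \<open>j\<close> and j^2 / n \<le> 1/m; for
  k \<ge> m the quadratic bound and \<open>var_tail\<close> apply.\<close>

lemma Phi_exp_approx:
  "\<bar>Phi k0 K n (t / sqrt n) - exp (- ((\<Sum>k\<in>{k0..<K}. var k n) / n * t\<^sup>2 / 2))\<bar>
     \<le> t ^ 4 / m * ((\<Sum>k\<in>{k0..<K}. var k n) / n) + 6 * t\<^sup>2 / m"
proof -
  define \<theta> where "\<theta> = t / sqrt n"
  have \<theta>2: "\<theta>\<^sup>2 = t\<^sup>2 / n" by (simp add: \<theta>_def power_divide)
  define q where "q k = 2 / real (lets k)" for k
  have q: "0 \<le> q k" "q k \<le> 1" for k using fac_factor(3)[of k] by (auto simp: q_def)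
  define W where "W k = {..<n + blk k + shf k}" for k
  define z where "z = (\<lambda>(k, s). 1 - q k * (1 - cos (\<theta> * cf k n s)))"
  define w where "w = (\<lambda>(k, s). exp (- (q k * (\<theta> * cf k n s)\<^sup>2 / 2)))"
  have varq: "var k n = (\<Sum>s\<in>W k. q k * (cf k n s)\<^sup>2)" for k
    by (simp add: var_def q_def W_def sum_distrib_left)
  have "Phi k0 K n \<theta> = (\<Prod>x\<in>Sigma {k0..<K} W. z x)"
    unfolding Phi_def fac_def z_def q_def W_def by (subst prod.Sigma) auto
  moreover have "exp (- ((\<Sum>k\<in>{k0..<K}. var k n) / n * t\<^sup>2 / 2)) = (\<Prod>x\<in>Sigma {k0..<K} W. w x)"
  proof -
    have "(\<Prod>x\<in>Sigma {k0..<K} W. w x) = (\<Prod>k\<in>{k0..<K}. \<Prod>s\<in>W k. exp (- (q k * (\<theta> * cf k n s)\<^sup>2 / 2)))"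
      unfolding w_def by (subst prod.Sigma) (auto simp: W_def)
    also have "\<dots> = exp (\<Sum>k\<in>{k0..<K}. \<Sum>s\<in>W k. - (q k * (\<theta> * cf k n s)\<^sup>2 / 2))"
      by (simp add: exp_sum W_def)
    also have "(\<Sum>k\<in>{k0..<K}. \<Sum>s\<in>W k. - (q k * (\<theta> * cf k n s)\<^sup>2 / 2)) = - ((\<Sum>k\<in>{k0..<K}. var k n) / n * t\<^sup>2 / 2)"
      by (simp add: varq \<theta>2 power_mult_distrib sum_negf sum_distrib_left sum_distrib_right sum_divide_distrib mult_ac)
    finally show ?thesis ..
  qed
  moreover have "norm ((\<Prod>x\<in>Sigma {k0..<K} W. z x) - (\<Prod>x\<in>Sigma {k0..<K} W. w x))
      \<le> (\<Sum>x\<in>Sigma {k0..<K} W. norm (z x - w x))"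
  proof (rule norm_prod_diff)
    fix x assume "x \<in> Sigma {k0..<K} W"
    obtain k s where x: "x = (k, s)" by (cases x)
    show "norm (z x) \<le> 1" unfolding x z_def prod.case q_def real_norm_def
      by (subst abs_of_nonneg) (rule fac_factor)+
    show "norm (w x) \<le> 1" unfolding x w_def using q by simp
  qed
  ultimately have "\<bar>Phi k0 K n \<theta> - exp (- ((\<Sum>k\<in>{k0..<K}. var k n) / n * t\<^sup>2 / 2))\<bar>
      \<le> (\<Sum>x\<in>Sigma {k0..<K} W. \<bar>z x - w x\<bar>)"
    by (simp only: real_norm_def)
  also have "\<dots> = (\<Sum>k\<in>{k0..<K}. \<Sum>s\<in>W k. \<bar>z (k, s) - w (k, s)\<bar>)"
    by (subst sum.Sigma) (auto simp: W_def)
  also have "\<dots> \<le> (\<Sum>k\<in>{k0..<K}. t ^ 4 / m * (var k n / n) + (if m \<le> k then t\<^sup>2 * var k n / n else 0))"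
  proof (rule sum_mono)
    fix k
    have p: "0 \<le> t ^ 4 / m * (var k n / n)" by (simp add: var_nonneg)
    show "(\<Sum>s\<in>W k. \<bar>z (k, s) - w (k, s)\<bar>) \<le> t ^ 4 / m * (var k n / n) + (if m \<le> k then t\<^sup>2 * var k n / n else 0)"
    proof (cases "m \<le> k")
      case True
      have "(\<Sum>s\<in>W k. \<bar>z (k, s) - w (k, s)\<bar>) \<le> (\<Sum>s\<in>W k. q k * (\<theta> * cf k n s)\<^sup>2)"
        unfolding z_def w_def prod.case by (intro sum_mono factor_approx q)
      also have "\<dots> = t\<^sup>2 * var k n / n"
        by (simp add: varq power_mult_distrib \<theta>2 sum_distrib_left sum_divide_distrib mult_ac)
      finally show ?thesis using True p by simp
    next
      case False
      have "(\<Sum>s\<in>W k. \<bar>z (k, s) - w (k, s)\<bar>) \<le> (\<Sum>s\<in>W k. q k * (\<theta> * cf k n s) ^ 4)"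
        unfolding z_def w_def prod.case by (intro sum_mono factor_approx q)
      also have "\<dots> \<le> (\<Sum>s\<in>W k. q k * (\<theta> ^ 4 * (real j ^ 2 * (cf k n s)\<^sup>2)))"
      proof (intro sum_mono mult_left_mono q)
        fix s
        have "blk k \<le> j" unfolding j_def using False by (intro blk_mono) auto
        then have "\<bar>cf k n s\<bar> \<le> real j" using abs_cf_le[of k n s] by linarith
        then have "\<bar>cf k n s\<bar>\<^sup>2 \<le> real j ^ 2" by (intro power_mono) auto
        then have "(cf k n s)\<^sup>2 * (cf k n s)\<^sup>2 \<le> real j ^ 2 * (cf k n s)\<^sup>2" by (intro mult_right_mono) auto
        then show "(\<theta> * cf k n s) ^ 4 \<le> \<theta> ^ 4 * (real j ^ 2 * (cf k n s)\<^sup>2)"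
          unfolding power_mult_distrib
          by (intro mult_left_mono zero_le_even_power) (simp_all add: power2_eq_square power4_eq_xxxx mult_ac)
      qed
      also have "\<dots> = \<theta> ^ 4 * real j ^ 2 * var k n" by (simp add: varq sum_distrib_left mult_ac)
      also have "\<theta> ^ 4 = t ^ 4 / n / n"
      proof -
        have "\<theta> ^ 4 = (\<theta>\<^sup>2)\<^sup>2" by simp
        also have "\<dots> = t ^ 4 / n / n" unfolding \<theta>2 by (simp add: power_divide power2_eq_square power4_eq_xxxx)
        finally show ?thesis .
      qed
      also have "t ^ 4 / n / n * real j ^ 2 * var k n = (real j ^ 2 / n) * (t ^ 4 * (var k n / n))" by simp
      also have "\<dots> \<le> (1 / m) * (t ^ 4 * (var k n / n))"
        using j_sq n_pos m by (intro mult_right_mono) (auto simp: field_simps var_nonneg)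
      finally show ?thesis using False by simp
    qed
  qed
  also have "\<dots> = t ^ 4 / m * ((\<Sum>k\<in>{k0..<K}. var k n) / n) + t\<^sup>2 / n * (\<Sum>k\<in>{k0..<K}. if m \<le> k then var k n else 0)"
    by (simp add: sum.distrib sum_distrib_left sum_divide_distrib if_distrib[where f="\<lambda>x. _ * x"] cong: if_cong)
  also have "(\<Sum>k\<in>{k0..<K}. if m \<le> k then var k n else 0) = (\<Sum>k\<in>{m..<K}. var k n)"
    by (rule sum.mono_neutral_cong_right) (use k0 m K in auto)
  also have "t\<^sup>2 / n * (\<Sum>k\<in>{m..<K}. var k n) \<le> t\<^sup>2 / n * (6 * (n / m))"
    by (intro mult_left_mono var_tail) auto
  also have "\<dots> = 6 * t\<^sup>2 / m" using n_pos by simp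
  finally show ?thesis by (simp add: \<theta>_def)
qed

end

section \<open>Fourier inversion and the local limit theorem for the model\<close>

lemma integrable_inverse_one_plus_square: "integrable lborel (\<lambda>t::real. 1 / (1 + t\<^sup>2))"
  using integrable_inverse_1_plus_square
  by (simp add: set_integrable_def inverse_eq_divide)

text \<open>The characteristic function of the standard normal law, rescaled by sqrt v.\<close>

lemma
  fixes v :: real
  assumes v: "0 < v"
  shows integrable_gauss: "integrable lborel (\<lambda>t. exp (- (v * t\<^sup>2 / 2)))"
    and integral_gauss_cos:
      "(\<integral>t. exp (- (v * t\<^sup>2 / 2)) * cos (t * y) \<partial>lborel) = sqrt (2 * pi / v) * exp (- (y\<^sup>2 / (2 * v)))"
proof -
  have std: "integrable lborel (\<lambda>x. exp (- (x\<^sup>2 / 2)) :: real)"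
  proof -
    have "integrable lborel (\<lambda>x. sqrt (2 * pi) * (std_normal_density x * x ^ 0))"
      by (intro integrable_mult_right integrable_std_normal_moment)
    then show ?thesis by (simp add: std_normal_density_def)
  qed
  have sv: "sqrt v \<noteq> 0" using v by simp
  have "integrable lborel (\<lambda>x. exp (- ((0 + sqrt v * x)\<^sup>2 / 2)))"
    by (rule lborel_integrable_real_affine[OF std sv])
  then show "integrable lborel (\<lambda>t. exp (- (v * t\<^sup>2 / 2)))" using v by (simp add: power_mult_distrib)
  have std_cos: "(\<integral>x. exp (- (x\<^sup>2 / 2)) * cos (s * x) \<partial>lborel) = sqrt (2 * pi) * exp (- (s\<^sup>2 / 2))" for s :: real
  proof -
    interpret std: prob_space std_normal_distribution by (rule prob_space_normal_density) simp
    have "exp (- (s\<^sup>2 / 2)) = Re (char std_normal_distribution s)"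
      by (simp add: char_std_normal_distribution)
    also have "\<dots> = (\<integral>x. cos (s * x) \<partial>std_normal_distribution)"
    proof -
      have int: "integrable std_normal_distribution (\<lambda>x. iexp (s * x))"
        by (rule std.integrable_const_bound[of _ 1]) auto
      show ?thesis unfolding char_def by (subst integral_Re[OF int, symmetric]) (simp flip: cis_conv_exp of_real_mult)
    qed
    also have "\<dots> = (\<integral>x. std_normal_density x * cos (s * x) \<partial>lborel)"
      by (subst integral_density) auto
    also have "\<dots> = (\<integral>x. 1 / sqrt (2 * pi) * (exp (- (x\<^sup>2 / 2)) * cos (s * x)) \<partial>lborel)"
      by (simp add: std_normal_density_def)
    also have "\<dots> = 1 / sqrt (2 * pi) * (\<integral>x. exp (- (x\<^sup>2 / 2)) * cos (s * x) \<partial>lborel)"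
      by (rule integral_mult_right_zero)
    finally show ?thesis by (simp add: field_simps)
  qed
  have "sqrt (2 * pi) * exp (- ((y / sqrt v)\<^sup>2 / 2))
      = \<bar>sqrt v\<bar> *\<^sub>R (\<integral>x. exp (- ((0 + sqrt v * x)\<^sup>2 / 2)) * cos (y / sqrt v * (0 + sqrt v * x)) \<partial>lborel)"
    unfolding std_cos[symmetric] by (rule lborel_integral_real_affine[OF sv])
  also have "\<dots> = sqrt v * (\<integral>x. exp (- (v * x\<^sup>2 / 2)) * cos (x * y) \<partial>lborel)"
    using v by (simp add: power_mult_distrib mult.commute)
  finally show "(\<integral>t. exp (- (v * t\<^sup>2 / 2)) * cos (t * y) \<partial>lborel) = sqrt (2 * pi / v) * exp (- (y\<^sup>2 / (2 * v)))"
    using v by (simp add: power_divide real_sqrt_divide field_simps)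
qed

text \<open>Fourier inversion: for an integer \<open>z\<close> this is the probability of \<open>z\<close> under the distribution with
  characteristic function \<open>Phi k0 K n\<close>.\<close>

definition Phi_prob :: "nat \<Rightarrow> nat \<Rightarrow> nat \<Rightarrow> real \<Rightarrow> real" where
  "Phi_prob k0 K n z = 1 / (2 * pi) * (\<integral>\<theta>. indicator {-pi..pi} \<theta> * (Phi k0 K n \<theta> * cos (\<theta> * z)) \<partial>lborel)"

text \<open>The cutoffs are abstract because \<open>K n\<close> is fixed only after the limit
  function is known; any choice beyond \<open>lev n\<close> leads to the same limit.\<close>

locale scales =
  fixes k0 K :: "nat \<Rightarrow> nat"
  assumes k0: "\<And>n. 2 * k0 n \<le> lev n + 2" and K: "\<And>n. lev n < K n"
begin

lemma eventually_scale: "\<forall>\<^sub>F n in sequentially. scale n (lev n) (k0 n) (K n)"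
proof -
  have "\<forall>\<^sub>F n in sequentially. 6 \<le> lev n" using filterlim_lev by (simp add: filterlim_at_top)
  then show ?thesis using eventually_ge_at_top[of 2]
  proof eventually_elim
    case (elim n)
    then show ?case by unfold_locales (use k0 K lev_le lev_less in auto)
  qed
qed

lemma inverse_lev_tendsto_0: "(\<lambda>n. c / real (lev n)) \<longlonglongrightarrow> 0"
  by (rule filterlim_compose[OF lim_const_over_n filterlim_lev])

lemma var_tendsto: "(\<lambda>n. (\<Sum>k\<in>{k0 n..<K n}. var k n) / n) \<longlonglongrightarrow> 2 * ln 2"
proof -
  define h where "h m = (\<Sum>k\<in>{m div 2 + 1..<m}. 2 / real (Suc k))" for m
  have h: "(\<lambda>n. h (lev n)) \<longlonglongrightarrow> 2 * ln 2"
    using filterlim_compose[OF harmonic_window filterlim_lev] by (simp add: h_def)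
  have "(\<lambda>n. (\<Sum>k\<in>{k0 n..<K n}. var k n) / n - h (lev n)) \<longlonglongrightarrow> 0"
  proof (rule Lim_null_comparison[OF _ inverse_lev_tendsto_0[of 14]])
    show "\<forall>\<^sub>F n in sequentially. norm ((\<Sum>k\<in>{k0 n..<K n}. var k n) / n - h (lev n)) \<le> 14 / real (lev n)"
      using eventually_scale by eventually_elim (simp add: h_def scale.var_total[simplified])
  qed
  from tendsto_add[OF this h] show ?thesis by simp
qed

lemma Phi_tendsto: "(\<lambda>n. Phi (k0 n) (K n) n (t / sqrt n)) \<longlonglongrightarrow> exp (- (2 * ln 2 * t\<^sup>2 / 2))"
proof -
  define V where "V n = (\<Sum>k\<in>{k0 n..<K n}. var k n) / n" for n
  have V: "V \<longlonglongrightarrow> 2 * ln 2" unfolding V_def by (rule var_tendsto)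
  have "(\<lambda>n. Phi (k0 n) (K n) n (t / sqrt n) - exp (- (V n * t\<^sup>2 / 2))) \<longlonglongrightarrow> 0"
  proof (rule Lim_null_comparison)
    show "\<forall>\<^sub>F n in sequentially. norm (Phi (k0 n) (K n) n (t / sqrt n) - exp (- (V n * t\<^sup>2 / 2)))
        \<le> t ^ 4 / lev n * V n + 6 * t\<^sup>2 / lev n"
      using eventually_scale by eventually_elim (simp only: V_def real_norm_def scale.Phi_exp_approx)
    show "(\<lambda>n. t ^ 4 / lev n * V n + 6 * t\<^sup>2 / lev n) \<longlonglongrightarrow> 0"
      using tendsto_add[OF tendsto_mult[OF inverse_lev_tendsto_0 V] inverse_lev_tendsto_0] by simp
  qed
  moreover have "(\<lambda>n. exp (- (V n * t\<^sup>2 / 2))) \<longlonglongrightarrow> exp (- (2 * ln 2 * t\<^sup>2 / 2))"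
    by (intro tendsto_intros V) simp
  ultimately have "(\<lambda>n. (Phi (k0 n) (K n) n (t / sqrt n) - exp (- (V n * t\<^sup>2 / 2))) + exp (- (V n * t\<^sup>2 / 2)))
      \<longlonglongrightarrow> 0 + exp (- (2 * ln 2 * t\<^sup>2 / 2))" by (rule tendsto_add)
  then show ?thesis by simp
qed

text \<open>The factor \<open>Phi\<close> of the inversion integrand after the substitution \<theta>
  = t / sqrt n, extended by 0 so that it can be compared with a Gaussian on the whole line.\<close>

definition scaled :: "nat \<Rightarrow> real \<Rightarrow> real" where
  "scaled n t = indicator {t. \<bar>t\<bar> \<le> pi * sqrt n} t * Phi (k0 n) (K n) n (t / sqrt n)"

lemma scaled_measurable [measurable]: "scaled n \<in> borel_measurable borel"
  unfolding scaled_def by measurable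

lemma scaled_L1: "(\<lambda>n. \<integral>t. \<bar>scaled n t - exp (- (2 * ln 2 * t\<^sup>2 / 2))\<bar> \<partial>lborel) \<longlonglongrightarrow> 0"
  and scaled_integrable: "\<forall>\<^sub>F n in sequentially. integrable lborel (scaled n)"
proof -
  define w where "w t = 8 ^ 8 * (1 + pi\<^sup>2) * (1 / (1 + t\<^sup>2))" for t :: real
  define g where "g t = exp (- (2 * ln 2 * t\<^sup>2 / 2))" for t :: real
  have w: "integrable lborel w" unfolding w_def by (intro integrable_mult_right integrable_inverse_one_plus_square)
  have g: "integrable lborel g" unfolding g_def by (rule integrable_gauss) simp
  have [measurable]: "g \<in> borel_measurable borel" unfolding g_def by measurable
  have w0: "0 \<le> w t" for t unfolding w_def by (intro mult_nonneg_nonneg divide_nonneg_nonneg add_nonneg_nonneg) auto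
  have s0: "0 \<le> scaled n t" for n t unfolding scaled_def by (intro mult_nonneg_nonneg Phi_nonneg) auto
  obtain n0 where n0: "\<And>n. n0 \<le> n \<Longrightarrow> scale n (lev n) (k0 n) (K n)"
    using eventually_scale by (auto simp: eventually_sequentially)
  have bound: "scaled n t \<le> w t" if "n0 \<le> n" for n t
    using scale.Phi_dominated[OF n0[OF that], of t] w0[of t] by (auto simp: scaled_def w_def indicator_def)
  have "(\<lambda>n. scaled n t) \<longlonglongrightarrow> g t" for t
  proof (rule Lim_transform_eventually)
    show "(\<lambda>n. Phi (k0 n) (K n) n (t / sqrt n)) \<longlonglongrightarrow> g t" unfolding g_def by (rule Phi_tendsto)
    obtain N :: nat where N: "(\<bar>t\<bar> / pi)\<^sup>2 \<le> N" using real_arch_simple by blast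
    show "\<forall>\<^sub>F n in sequentially. Phi (k0 n) (K n) n (t / sqrt n) = scaled n t"
    proof (rule eventually_sequentiallyI[of N])
      fix n assume "N \<le> n"
      then have "(\<bar>t\<bar> / pi)\<^sup>2 \<le> real n" using N by linarith
      then have "\<bar>t\<bar> / pi \<le> sqrt n" by (rule real_le_rsqrt)
      then show "Phi (k0 n) (K n) n (t / sqrt n) = scaled n t" by (simp add: scaled_def field_simps)
    qed
  qed
  then have lim: "(\<lambda>n. \<bar>scaled (n + n0) t - g t\<bar>) \<longlonglongrightarrow> 0" for t
    using tendsto_rabs_zero[OF LIM_zero[OF LIMSEQ_ignore_initial_segment]] by blast
  \<comment> \<open>The majorant is available only from \<open>n0\<close> on, hence the shifted
    sequence.\<close>
  have "(\<lambda>n. \<integral>t. \<bar>scaled (n + n0) t - g t\<bar> \<partial>lborel) \<longlonglongrightarrow> (\<integral>t. 0 \<partial>(lborel :: real measure))"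
  proof (rule integral_dominated_convergence)
    show "integrable lborel (\<lambda>t. w t + g t)" by (intro Bochner_Integration.integrable_add w g)
    show "AE t in lborel. (\<lambda>n. \<bar>scaled (n + n0) t - g t\<bar>) \<longlonglongrightarrow> 0" using lim by simp
    show "AE t in lborel. norm \<bar>scaled (n + n0) t - g t\<bar> \<le> w t + g t" for n
    proof (rule AE_I2)
      fix t
      have "0 \<le> g t" by (simp add: g_def)
      then show "norm \<bar>scaled (n + n0) t - g t\<bar> \<le> w t + g t" using bound[of "n + n0" t] s0[of "n + n0" t] by simp
    qed
  qed auto
  then show "(\<lambda>n. \<integral>t. \<bar>scaled n t - exp (- (2 * ln 2 * t\<^sup>2 / 2))\<bar> \<partial>lborel) \<longlonglongrightarrow> 0"
    unfolding g_def by (simp add: LIMSEQ_offset)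
  show "\<forall>\<^sub>F n in sequentially. integrable lborel (scaled n)"
  proof (rule eventually_sequentiallyI[of n0])
    fix n assume "n0 \<le> n"
    then show "integrable lborel (scaled n)"
      by (intro Bochner_Integration.integrable_bound[OF w]) (use bound s0 w0 in auto)
  qed
qed

text \<open>The cosine has modulus at most 1, so the L1 distance of \<open>scaled n\<close> from the
  Gaussian bounds the error for all z at once.\<close>

lemma Phi_prob_LLT:
  assumes e: "0 < e"
  shows "\<forall>\<^sub>F n in sequentially. \<forall>z. \<bar>sqrt n * Phi_prob (k0 n) (K n) n z
    - exp (- z\<^sup>2 / (2 * real n * (2 * ln 2))) / sqrt (2 * pi * (2 * ln 2))\<bar> \<le> e"
proof -
  define v :: real where "v = 2 * ln 2"
  have v: "0 < v" by (simp add: v_def)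
  have "\<forall>\<^sub>F n in sequentially. (\<integral>t. \<bar>scaled n t - exp (- (v * t\<^sup>2 / 2))\<bar> \<partial>lborel) < e"
    using order_tendstoD(2)[OF scaled_L1 e] by (simp add: v_def)
  then have "\<forall>\<^sub>F n in sequentially. \<forall>z. \<bar>sqrt n * Phi_prob (k0 n) (K n) n z
    - exp (- z\<^sup>2 / (2 * real n * v)) / sqrt (2 * pi * v)\<bar> \<le> e"
    using scaled_integrable eventually_gt_at_top[of 0]
  proof eventually_elim
    case (elim n)
    note int = elim(2) integrable_gauss[OF v]
    have sn: "0 < sqrt n" using elim(3) by simp
    have int_cos: "integrable lborel (\<lambda>t. f t * cos (t * y))" if f: "integrable lborel f" for f :: "real \<Rightarrow> real" and y
      by (rule Bochner_Integration.integrable_bound[OF f])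
        (use borel_measurable_integrable[OF f] in \<open>auto simp: abs_mult mult_left_le\<close>)
    show ?case
    proof
      fix z :: real
      define y where "y = z / sqrt n"
      have "sqrt n * Phi_prob (k0 n) (K n) n z
          = sqrt n * (1 / (2 * pi) * (\<bar>1 / sqrt n\<bar> *\<^sub>R (\<integral>t. indicator {-pi..pi} (0 + 1 / sqrt n * t) *
              (Phi (k0 n) (K n) n (0 + 1 / sqrt n * t) * cos ((0 + 1 / sqrt n * t) * z)) \<partial>lborel)))"
        unfolding Phi_prob_def by (subst lborel_integral_real_affine[of "1 / sqrt n" _ 0]) (use sn in auto)
      also have "\<dots> = 1 / (2 * pi) * (\<integral>t. indicator {-pi..pi} (0 + 1 / sqrt n * t) *
              (Phi (k0 n) (K n) n (0 + 1 / sqrt n * t) * cos ((0 + 1 / sqrt n * t) * z)) \<partial>lborel)"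
        using sn by simp
      also have "(\<integral>t. indicator {-pi..pi} (0 + 1 / sqrt n * t) *
              (Phi (k0 n) (K n) n (0 + 1 / sqrt n * t) * cos ((0 + 1 / sqrt n * t) * z)) \<partial>lborel)
          = (\<integral>t. scaled n t * cos (t * y) \<partial>lborel)"
      proof (intro Bochner_Integration.integral_cong refl)
        fix t :: real
        have "0 + 1 / sqrt n * t \<in> {-pi..pi} \<longleftrightarrow> t \<in> {t. \<bar>t\<bar> \<le> pi * sqrt n}"
          using sn by (auto simp: abs_le_iff field_simps)
        then show "indicator {-pi..pi} (0 + 1 / sqrt n * t) *
              (Phi (k0 n) (K n) n (0 + 1 / sqrt n * t) * cos ((0 + 1 / sqrt n * t) * z)) = scaled n t * cos (t * y)"
          by (simp add: scaled_def y_def indicator_def)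
      qed
      finally have 1: "sqrt n * Phi_prob (k0 n) (K n) n z = 1 / (2 * pi) * (\<integral>t. scaled n t * cos (t * y) \<partial>lborel)" .
      have 2: "exp (- z\<^sup>2 / (2 * real n * v)) / sqrt (2 * pi * v) = 1 / (2 * pi) * (\<integral>t. exp (- (v * t\<^sup>2 / 2)) * cos (t * y) \<partial>lborel)"
      proof -
        have "1 / (2 * pi) * sqrt (2 * pi / v) = 1 / sqrt (2 * pi * v)"
        proof -
          have "sqrt (2 * pi / v) * sqrt (2 * pi * v) = sqrt ((2 * pi)\<^sup>2)"
            using v by (simp add: real_sqrt_mult[symmetric] power2_eq_square)
          also have "\<dots> = 2 * pi" by (rule real_sqrt_unique) auto
          finally show ?thesis using v by (simp add: field_simps)
        qed
        moreover have "y\<^sup>2 / (2 * v) = z\<^sup>2 / (2 * real n * v)" using sn by (simp add: y_def power_divide)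
        ultimately show ?thesis unfolding integral_gauss_cos[OF v] by (simp add: mult.assoc[symmetric])
      qed
      have "\<bar>sqrt n * Phi_prob (k0 n) (K n) n z - exp (- z\<^sup>2 / (2 * real n * v)) / sqrt (2 * pi * v)\<bar>
          = 1 / (2 * pi) * \<bar>\<integral>t. (scaled n t - exp (- (v * t\<^sup>2 / 2))) * cos (t * y) \<partial>lborel\<bar>"
        unfolding 1 2 using int int_cos
        by (simp add: left_diff_distrib Bochner_Integration.integral_diff flip: diff_divide_distrib)
      also have "\<dots> \<le> 1 / (2 * pi) * (\<integral>t. \<bar>scaled n t - exp (- (v * t\<^sup>2 / 2))\<bar> \<partial>lborel)"
      proof (rule mult_left_mono)
        have "\<bar>\<integral>t. (scaled n t - exp (- (v * t\<^sup>2 / 2))) * cos (t * y) \<partial>lborel\<bar>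
            \<le> (\<integral>t. \<bar>(scaled n t - exp (- (v * t\<^sup>2 / 2))) * cos (t * y)\<bar> \<partial>lborel)"
          by (rule integral_abs_bound)
        also have "\<dots> \<le> (\<integral>t. \<bar>scaled n t - exp (- (v * t\<^sup>2 / 2))\<bar> \<partial>lborel)"
          using int by (intro integral_mono integrable_abs int_cos Bochner_Integration.integrable_diff)
            (auto simp: abs_mult mult_left_le)
        finally show "\<bar>\<integral>t. (scaled n t - exp (- (v * t\<^sup>2 / 2))) * cos (t * y) \<partial>lborel\<bar>
            \<le> (\<integral>t. \<bar>scaled n t - exp (- (v * t\<^sup>2 / 2))\<bar> \<partial>lborel)" .
      qed simp
      also have "\<dots> \<le> 1 * e"
        using elim(1) pi_ge_two by (intro mult_mono) auto
      finally show "\<bar>sqrt n * Phi_prob (k0 n) (K n) n z - exp (- z\<^sup>2 / (2 * real n * v)) / sqrt (2 * pi * v)\<bar> \<le> e" by simp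
    qed
  qed
  then show ?thesis by (simp only: v_def)
qed

end

section \<open>Construction of the function\<close>

text \<open>The summand \<open>f\<^sub>k\<close> is chosen nearly independent of \<open>f\<^sub>0, \<dots>, f\<^bsub>k-1\<^esub>\<close> on orbit segments of length
  \<open>hor k\<close>; for longer ones the bound \<open>2 shf k blk k\<close> on its Birkhoff sums is negligible against \<open>sqrt n\<close>.\<close>

definition hor :: "nat \<Rightarrow> nat" where
  "hor k = (Suc k * (\<Sum>i\<le>k. 2 * shf i * blk i)) ^ 2"

text \<open>The geometric factor makes the errors summable over k; the other factor keeps their sum
  of order 1/n at every time n within the horizons, small even after multiplication by sqrt
  n.\<close>

definition tol :: "nat \<Rightarrow> real" where
  "tol k = (1 / 4) ^ k / (1 + real (hor k))"

lemma tol_pos: "0 < tol k"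
  unfolding tol_def by (intro divide_pos_pos add_pos_nonneg) auto

text \<open>One increment of the Birkhoff sums, with the letters replaced by independent ones.\<close>

definition incr_mean :: "nat \<Rightarrow> nat \<Rightarrow> (int \<Rightarrow> real) \<Rightarrow> real" where
  "incr_mean k n g = word_mean (hor k + blk k + shf k) (lets k)
     (\<lambda>w. g (\<Sum>s<hor k + blk k + shf k. coef (blk k) (shf k) n s * letter (w s)))"

lemma measurable_map_list:
  fixes g :: "'i \<Rightarrow> 'a \<Rightarrow> 'b::countable"
  assumes "\<And>i. g i \<in> measurable M (count_space UNIV)"
  shows "(\<lambda>x. map (\<lambda>i. g i x) is) \<in> measurable M (count_space UNIV)"
proof (induction "is")
  case (Cons a "is")
  have "(\<lambda>x. v # map (\<lambda>i. g i x) is) \<in> measurable M (count_space UNIV)" for v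
    by (rule measurable_compose[OF Cons]) simp
  then have "(\<lambda>x. g a x # map (\<lambda>i. g i x) is) \<in> measurable M (count_space UNIV)"
    by (rule measurable_compose_countable[where f="\<lambda>v x. v # map (\<lambda>i. g i x) is", OF _ assms])
  then show ?case by simp
qed simp

lemma measurable_of_int_imp_measurable:
  fixes g :: "'a \<Rightarrow> int"
  assumes [measurable]: "(\<lambda>x. real_of_int (g x)) \<in> borel_measurable M"
  shows "g \<in> measurable M (count_space UNIV)"
proof -
  have "(\<lambda>x. \<lfloor>real_of_int (g x)\<rfloor>) \<in> measurable M (count_space UNIV)" by measurable
  then show ?thesis by (simp only: floor_of_int)
qed

section \<open>Adding one nearly independent summand\<close>

context ergodic_pt begin

lemma birkhoff_sum_measurable [measurable]:
  assumes [measurable]: "f \<in> measurable M (count_space UNIV)"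
  shows "birkhoff_sum T f n \<in> measurable M (count_space UNIV)"
proof -
  have "(\<lambda>x. real_of_int (birkhoff_sum T f n x)) \<in> borel_measurable M"
    unfolding birkhoff_sum_def of_int_sum by measurable
  then show ?thesis by (rule measurable_of_int_imp_measurable)
qed

abbreviation S :: "('a \<Rightarrow> int) \<Rightarrow> nat \<Rightarrow> 'a \<Rightarrow> int" where
  "S \<equiv> birkhoff_sum T"

abbreviation mom2 :: "('a \<Rightarrow> int) \<Rightarrow> nat \<Rightarrow> real" where
  "mom2 h n \<equiv> \<integral>x. (real_of_int (S h n x))\<^sup>2 \<partial>M"

lemma abs_birkhoff_sum_le:
  assumes "\<And>x. \<bar>f x\<bar> \<le> b"
  shows "\<bar>S f n x\<bar> \<le> int n * b"
proof -
  have "\<bar>S f n x\<bar> \<le> (\<Sum>k<n. b)"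
    unfolding birkhoff_sum_def by (intro order_trans[OF sum_abs] sum_mono assms)
  then show ?thesis by simp
qed

lemma integral_finite_valued:
  fixes X :: "'a \<Rightarrow> 'c" and G :: "'c \<Rightarrow> real"
  assumes C: "finite C" "\<And>x. x \<in> space M \<Longrightarrow> X x \<in> C"
    and meas: "\<And>c. c \<in> C \<Longrightarrow> {x \<in> space M. X x = c} \<in> sets M"
  shows "(\<integral>x. G (X x) \<partial>M) = (\<Sum>c\<in>C. \<P>(x in M. X x = c) * G c)"
proof -
  have "(\<integral>x. G (X x) \<partial>M) = (\<integral>x. (\<Sum>c\<in>C. indicator {x \<in> space M. X x = c} x * G c) \<partial>M)"
  proof (rule Bochner_Integration.integral_cong[OF refl])
    fix x assume x: "x \<in> space M"
    have "(\<Sum>c\<in>C. indicator {x \<in> space M. X x = c} x * G c) = (\<Sum>c\<in>{X x}. indicator {x \<in> space M. X x = c} x * G c)"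
      using C x by (intro sum.mono_neutral_right) auto
    then show "G (X x) = (\<Sum>c\<in>C. indicator {x \<in> space M. X x = c} x * G c)" using x by simp
  qed
  also have "\<dots> = (\<Sum>c\<in>C. (\<integral>x. indicator {x \<in> space M. X x = c} x * G c \<partial>M))"
    using meas by (intro Bochner_Integration.integral_sum integrable_mult_left) (auto simp: emeasure_eq_measure)
  also have "\<dots> = (\<Sum>c\<in>C. \<P>(x in M. X x = c) * G c)"
    using meas by (intro sum.cong refl) (simp add: emeasure_eq_measure)
  finally show ?thesis .
qed

text \<open>The last clause is near independence in integrated form: S f n may be replaced by a
  model independent of S F n. Test functions of quadratic growth cover squares, for the variance,
  and bounded functions, for local probabilities. The bound uniform in n reflects the coboundary
  form.\<close>

definition increment :: "nat \<Rightarrow> ('a \<Rightarrow> int) \<Rightarrow> ('a \<Rightarrow> int) \<Rightarrow> bool" where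
  "increment k F f \<longleftrightarrow> f \<in> measurable M (count_space UNIV) \<and> (\<forall>x. \<bar>f x\<bar> \<le> 2 * int (blk k)) \<and>
    (\<forall>n x. \<bar>S f n x\<bar> \<le> 2 * int (shf k) * int (blk k)) \<and>
    (\<integral>x. real_of_int (f x) \<partial>M) = 0 \<and>
    (\<forall>n u. n \<le> hor k \<longrightarrow> (\<forall>c s. \<bar>u c s\<bar> \<le> 2 * (1 + (real_of_int c)\<^sup>2 + (real_of_int s)\<^sup>2)) \<longrightarrow>
      \<bar>(\<integral>x. u (S F n x) (S f n x) \<partial>M)
       - (\<integral>x. incr_mean k n (u (S F n x)) \<partial>M)\<bar> \<le> tol k)"

text \<open>The sums S F n with n \<le> hor k take finitely many values, so together they form one
  finite partition Q. The letters are made nearly independent of Q on a window containing every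
  letter that enters S f n; expectations then become finite sums over values of Q and words.\<close>

lemma exists_increment:
  assumes U: "uniform01 U" and F [measurable]: "F \<in> measurable M (count_space UNIV)" and b: "\<And>x. \<bar>F x\<bar> \<le> b"
  shows "\<exists>f. increment k F f"
proof -
  define L where "L = hor k"
  define e where "e = tol k"
  have e: "0 < e" unfolding e_def by (rule tol_pos)
  define N where "N = L + blk k + shf k"
  define j where "j = blk k"
  define d where "d = shf k"
  define l where "l = lets k"
  have l0: "0 < l" using lets_ge[of k] by (simp add: l_def)
  define Q where "Q x = map (\<lambda>n. S F n x) [0..<Suc L]" for x
  have Q [measurable]: "Q \<in> measurable M (count_space UNIV)"
    unfolding Q_def by (rule measurable_map_list) measurable
  have b0: "0 \<le> b" using b[of undefined] by linarith
  define C where "C = {xs. set xs \<subseteq> {- (int L * b)..int L * b} \<and> length xs = Suc L}"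
  have C: "finite C" unfolding C_def by (rule finite_lists_length_eq) simp
  have QC: "Q x \<in> C" for x
  proof -
    have "\<bar>S F n x\<bar> \<le> int L * b" if "n \<le> L" for n
      using abs_birkhoff_sum_le[of F b n x, OF b] mult_right_mono[of "int n" "int L" b] that b0 by simp
    then show ?thesis by (auto simp: C_def Q_def abs_le_iff minus_le_iff simp del: upt_Suc)
  qed
  define W where "W = {..<N} \<rightarrow>\<^sub>E {..<l}"
  have W: "finite W" unfolding W_def by (rule finite_PiE) auto
  \<comment> \<open>Bounds the test functions on all values that can occur: S F n is at most L b in
    modulus, and S f n at most N j, since no coefficient exceeds j.\<close>
  define B where "B = 2 * (1 + (real_of_int (int L * b))\<^sup>2 + (real (N * j))\<^sup>2)"
  have B0: "0 \<le> B" by (simp add: B_def)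
  \<comment> \<open>Each pair of a value in \<open>C\<close> and a word in \<open>W\<close> costs at
    most e' B; the added 1 keeps the denominator positive.\<close>
  define e' where "e' = e / (1 + real (card C) * real (card W) * B)"
  have den: "0 < 1 + real (card C) * real (card W) * B" using B0 by (intro add_pos_nonneg) auto
  have e': "0 < e'" using e den by (simp add: e'_def)
  obtain \<xi> :: "'a \<Rightarrow> nat" where \<xi> [measurable]: "\<xi> \<in> measurable M (count_space UNIV)" and \<xi>l: "\<And>x. \<xi> x < l"
    and ind: "\<And>c w. c \<in> C \<Longrightarrow> w \<in> {..<N} \<rightarrow>\<^sub>E {..<l} \<Longrightarrow>
      \<bar>\<P>(x in M. Q x = c \<and> (\<forall>s<N. \<xi> ((T ^^ s) x) = w s)) - \<P>(x in M. Q x = c) / real (l ^ N)\<bar> < e'"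
    by (rule approx_independent_process[OF U l0 Q C e', of N], rule that)
  define y where "y x s = letter (\<xi> ((T ^^ s) x))" for x s
  define f where "f x = (\<Sum>i<j. y x i) - (\<Sum>i<j. y x (d + i))" for x
  have y1: "\<bar>y x s\<bar> \<le> 1" for x s by (simp add: y_def abs_letter_le)
  have yT: "y ((T ^^ t) x) s = y x (t + s)" for x t s by (simp add: y_def T_pow_add add.commute)
  define Y where "Y x t = (\<Sum>i<j. y x (t + i))" for x t
  have Y1: "\<bar>Y x t\<bar> \<le> int j" for x t
    unfolding Y_def by (rule order_trans[OF sum_abs]) (use sum_mono[of "{..<j}" "\<lambda>i. \<bar>y x (t + i)\<bar>" "\<lambda>_. 1"] y1 in auto)
  have fT: "f ((T ^^ t) x) = Y x t - Y x (t + d)" for x t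
    by (simp add: f_def yT Y_def add.assoc)
  have Sf: "S f n x = (\<Sum>t<n. Y x t - Y x (t + d))" for n x
    by (simp add: birkhoff_sum_def fT)
  have ym [measurable]: "(\<lambda>x. y x s) \<in> measurable M (count_space UNIV)" for s
    unfolding y_def by (rule measurable_compose[where N="count_space UNIV" and g=letter]) measurable
  have Ym: "(\<lambda>x. real_of_int (Y x t)) \<in> borel_measurable M" for t
    unfolding Y_def of_int_sum by measurable
  have fm: "f \<in> measurable M (count_space UNIV)"
  proof -
    have "real_of_int (f x) = real_of_int (Y x 0) - real_of_int (Y x d)" for x by (simp add: f_def Y_def)
    then have "(\<lambda>x. real_of_int (f x)) \<in> borel_measurable M" using Ym by simp
    then show ?thesis by (rule measurable_of_int_imp_measurable)
  qed
  have fb: "\<bar>f x\<bar> \<le> 2 * int j" for x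
    using fT[of 0 x] Y1[of x 0] Y1[of x d] by simp
  have fS: "\<bar>S f n x\<bar> \<le> 2 * int d * int j" for n x
  proof -
    \<comment> \<open>After exchanging n and d only d terms remain, each at most 2 j.\<close>
    have "\<bar>S f n x\<bar> = \<bar>\<Sum>t<d. Y x t - Y x (t + n)\<bar>"
      unfolding Sf by (subst telescope_swap) simp
    also have "\<dots> \<le> (\<Sum>t<d. 2 * int j)"
    proof (rule order_trans[OF sum_abs], rule sum_mono)
      fix t show "\<bar>Y x t - Y x (t + n)\<bar> \<le> 2 * int j" using Y1[of x t] Y1[of x "t + n"] by linarith
    qed
    finally show ?thesis by simp
  qed
  have f0: "(\<integral>x. real_of_int (f x) \<partial>M) = 0"
  proof -
    have "\<bar>real_of_int (Y x t)\<bar> \<le> real j" for x t using Y1[of x t] by linarith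
    then have Yi: "integrable M (\<lambda>x. real_of_int (Y x t))" for t
      by (intro integrable_const_bound[of _ "real j"]) (use Ym in auto)
    have "(\<integral>x. real_of_int (f x) \<partial>M) = (\<integral>x. real_of_int (Y x 0) - real_of_int (Y x d) \<partial>M)"
      by (simp add: f_def Y_def)
    also have "\<dots> = (\<integral>x. real_of_int (Y x 0) \<partial>M) - (\<integral>x. real_of_int (Y x d) \<partial>M)"
      by (intro Bochner_Integration.integral_diff Yi)
    also have "(\<integral>x. real_of_int (Y x d) \<partial>M) = (\<integral>x. real_of_int (Y ((T ^^ d) x) 0) \<partial>M)"
      by (simp add: Y_def yT)
    also have "\<dots> = (\<integral>x. real_of_int (Y x 0) \<partial>M)" by (rule integral_T_pow[OF Ym])
    finally show ?thesis by simp
  qed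
  have coefN: "(\<Sum>s<N. coef j d n s * z s) = (\<Sum>s<n + j + d. coef j d n s * z s)" if "n \<le> L" for n z
    by (rule sum.mono_neutral_right) (use that coef_eq_0[of n j d] in \<open>auto simp: N_def j_def d_def not_less\<close>)
  have Sf_coef: "S f n x = (\<Sum>s<N. coef j d n s * y x s)" if "n \<le> L" for n x
    using coef_weighted_sum[of "y x" j d n] unfolding Sf Y_def coefN[OF that] by simp
  have main: "\<bar>(\<integral>x. u (S F n x) (S f n x) \<partial>M)
       - (\<integral>x. word_mean N l (\<lambda>w. u (S F n x) (\<Sum>s<N. coef j d n s * letter (w s))) \<partial>M)\<bar> \<le> e"
    if n: "n \<le> L" and u: "\<And>c s. \<bar>u c s\<bar> \<le> 2 * (1 + (real_of_int c)\<^sup>2 + (real_of_int s)\<^sup>2)" for n u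
  proof -
    define G where "G c w = u (c ! n) (\<Sum>s<N. coef j d n s * letter (w s))" for c and w :: "nat \<Rightarrow> nat"
    have GB: "\<bar>G c w\<bar> \<le> B" if "c \<in> C" for c w
    proof -
      have "c ! n \<in> set c" using that n by (auto simp: C_def)
      then have "c ! n \<in> {- (int L * b)..int L * b}" using that unfolding C_def by blast
      then have "\<bar>c ! n\<bar> \<le> int L * b" by (simp add: abs_le_iff)
      then have "\<bar>real_of_int (c ! n)\<bar> \<le> real_of_int (int L * b)" by (metis of_int_abs of_int_le_iff)
      then have 1: "(real_of_int (c ! n))\<^sup>2 \<le> (real_of_int (int L * b))\<^sup>2"
        by (intro abs_le_square_iff[THEN iffD1]) linarith
      define s' where "s' = (\<Sum>s<N. coef j d n s * letter (w s))"
      have "\<bar>s'\<bar> \<le> (\<Sum>s<N. int j)" unfolding s'_def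
      proof (rule order_trans[OF sum_abs], rule sum_mono)
        fix s
        have "\<bar>coef j d n s * letter (w s)\<bar> \<le> int j * 1"
          unfolding abs_mult using abs_coef_le[of j d n s] abs_letter_le[of "w s"] by (intro mult_mono) auto
        then show "\<bar>coef j d n s * letter (w s)\<bar> \<le> int j" by simp
      qed
      then have "\<bar>s'\<bar> \<le> int (N * j)" by simp
      then have "\<bar>real_of_int s'\<bar> \<le> real (N * j)" by (metis of_int_abs of_int_le_iff of_int_of_nat_eq)
      then have 2: "(real_of_int s')\<^sup>2 \<le> (real (N * j))\<^sup>2"
        by (intro abs_le_square_iff[THEN iffD1]) linarith
      show ?thesis using u[of "c ! n" s'] 1 2 by (simp add: G_def s'_def[symmetric] B_def)
    qed
    have Qn: "Q x ! n = S F n x" for x using n by (simp add: Q_def del: upt_Suc)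
    define win where "win x = restrict (\<lambda>s. \<xi> ((T ^^ s) x)) {..<N}" for x
    have winW: "win x \<in> W" for x using \<xi>l by (auto simp: win_def W_def)
    have win_eq: "win x = w \<longleftrightarrow> (\<forall>s<N. \<xi> ((T ^^ s) x) = w s)" if "w \<in> W" for w x
      using that by (auto simp: win_def W_def PiE_iff extensional_def fun_eq_iff restrict_def)
    define p where "p c w = \<P>(x in M. Q x = c \<and> (\<forall>s<N. \<xi> ((T ^^ s) x) = w s))" for c w
    have "(\<integral>x. u (S F n x) (S f n x) \<partial>M) = (\<integral>x. (\<lambda>(c, w). G c w) (Q x, win x) \<partial>M)"
    proof (intro Bochner_Integration.integral_cong refl)
      fix x
      have "(\<Sum>s<N. coef j d n s * letter (win x s)) = (\<Sum>s<N. coef j d n s * y x s)"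
        by (intro sum.cong) (auto simp: win_def y_def)
      then show "u (S F n x) (S f n x) = (\<lambda>(c, w). G c w) (Q x, win x)"
        by (simp add: G_def Qn Sf_coef[OF n])
    qed
    also have "\<dots> = (\<Sum>v\<in>C \<times> W. \<P>(x in M. (Q x, win x) = v) * (\<lambda>(c, w). G c w) v)"
    proof (rule integral_finite_valued)
      fix v assume "v \<in> C \<times> W"
      then obtain c w where v: "v = (c, w)" "w \<in> W" by auto
      have "{x \<in> space M. (Q x, win x) = v} = {x \<in> space M. Q x = c \<and> (\<forall>s<N. \<xi> ((T ^^ s) x) = w s)}"
        using win_eq v by auto
      then show "{x \<in> space M. (Q x, win x) = v} \<in> sets M" by simp
    qed (use C W QC winW in auto)
    also have "\<dots> = (\<Sum>c\<in>C. \<Sum>w\<in>W. p c w * G c w)"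
      unfolding sum.cartesian_product by (rule sum.cong) (auto simp: p_def win_eq)
    finally have 1: "(\<integral>x. u (S F n x) (S f n x) \<partial>M) = (\<Sum>c\<in>C. \<Sum>w\<in>W. p c w * G c w)" .
    have "(\<integral>x. word_mean N l (\<lambda>w. u (S F n x) (\<Sum>s<N. coef j d n s * letter (w s))) \<partial>M)
        = (\<integral>x. (\<lambda>c. word_mean N l (G c)) (Q x) \<partial>M)" by (simp add: G_def[abs_def] Qn)
    also have "\<dots> = (\<Sum>c\<in>C. \<P>(x in M. Q x = c) * word_mean N l (G c))"
      by (rule integral_finite_valued) (use C QC in auto)
    also have "\<dots> = (\<Sum>c\<in>C. \<Sum>w\<in>W. \<P>(x in M. Q x = c) / real (l ^ N) * G c w)"
      by (simp add: word_mean_def W_def sum_distrib_left sum_divide_distrib)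
    finally have 2: "(\<integral>x. word_mean N l (\<lambda>w. u (S F n x) (\<Sum>s<N. coef j d n s * letter (w s))) \<partial>M)
        = (\<Sum>c\<in>C. \<Sum>w\<in>W. \<P>(x in M. Q x = c) / real (l ^ N) * G c w)" .
    have "\<bar>(\<Sum>c\<in>C. \<Sum>w\<in>W. p c w * G c w) - (\<Sum>c\<in>C. \<Sum>w\<in>W. \<P>(x in M. Q x = c) / real (l ^ N) * G c w)\<bar>
        = \<bar>\<Sum>c\<in>C. \<Sum>w\<in>W. (p c w - \<P>(x in M. Q x = c) / real (l ^ N)) * G c w\<bar>"
      by (simp add: left_diff_distrib sum_subtractf)
    also have "\<dots> \<le> (\<Sum>c\<in>C. \<Sum>w\<in>W. e' * B)"
    proof (rule order_trans[OF sum_abs], rule sum_mono, rule order_trans[OF sum_abs], rule sum_mono)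
      fix c w assume cw: "c \<in> C" "w \<in> W"
      have "\<bar>p c w - \<P>(x in M. Q x = c) / real (l ^ N)\<bar> \<le> e'"
        unfolding p_def using ind[OF cw(1), of w] cw(2) by (simp add: W_def)
      then show "\<bar>(p c w - \<P>(x in M. Q x = c) / real (l ^ N)) * G c w\<bar> \<le> e' * B"
        unfolding abs_mult using GB[OF cw(1)] e' by (intro mult_mono) auto
    qed
    also have "\<dots> = e' * (real (card C) * real (card W) * B)" by simp
    also have "\<dots> \<le> e' * (1 + real (card C) * real (card W) * B)" using e' by (intro mult_left_mono) auto
    also have "\<dots> = e" using den by (simp add: e'_def)
    finally show ?thesis unfolding 1 2 .
  qed
  note fb' = fb[unfolded j_def] and fS' = fS[unfolded j_def d_def] and main' = main[unfolded N_def j_def d_def l_def L_def e_def]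
  show ?thesis unfolding increment_def incr_mean_def by (intro exI[of _ f] conjI allI impI fm fb' fS' f0 main') blast+
qed

end

section \<open>Which summands are still nearly independent at time n\<close>

definition start :: "nat \<Rightarrow> nat" where
  "start n = (LEAST k. n \<le> hor k)"

lemma hor_mono: "i \<le> k \<Longrightarrow> hor i \<le> hor k"
  unfolding hor_def by (intro power_mono mult_mono sum_mono2) auto

lemma shf_le_hor: "shf k \<le> hor k" and Suc_le_hor: "Suc k \<le> hor k"
proof -
  define b where "b = (\<Sum>i\<le>k. 2 * shf i * blk i)"
  have "shf k * 1 \<le> 2 * shf k * blk k" using blk_ge_2[of k] by (intro mult_mono) auto
  also have "\<dots> \<le> b" unfolding b_def by (rule member_le_sum) auto
  finally have b: "shf k \<le> b" by simp
  have b1: "1 \<le> b" using b blk_ge_2[of "2 * k"] by (simp add: shf_def)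
  have "(Suc k * b) ^ 1 \<le> (Suc k * b) ^ 2" using b1 by (intro power_increasing) auto
  then have h: "Suc k * b \<le> hor k" by (simp add: hor_def b_def)
  have "1 * b \<le> Suc k * b" by (intro mult_right_mono) auto
  then show "shf k \<le> hor k" using b h by linarith
  have "Suc k * 1 \<le> Suc k * b" using b1 by (intro mult_left_mono) auto
  from order_trans[OF this h] show "Suc k \<le> hor k" by simp
qed

lemma start_le: "n \<le> hor k \<Longrightarrow> start n \<le> k"
  unfolding start_def by (rule Least_le)

lemma le_hor: "start n \<le> k \<Longrightarrow> n \<le> hor k"
proof -
  have "n \<le> hor n" using Suc_le_hor[of n] by linarith
  then have "n \<le> hor (start n)" unfolding start_def by (rule LeastI)
  then show "start n \<le> k \<Longrightarrow> n \<le> hor k" using hor_mono order_trans by blast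
qed

text \<open>With m = lev n and k = m div 2 + 1, n < blk (m + 1) \<le> shf k \<le> hor k. Thus all
  active summands are still within their horizon of independence.\<close>

lemma start_le_lev: "2 * start n \<le> lev n + 2"
proof -
  define k where "k = lev n div 2 + 1"
  have "n < blk (Suc (lev n))" by (rule lev_less)
  also have "\<dots> \<le> shf k" unfolding shf_def k_def by (rule blk_mono) auto
  also have "\<dots> \<le> hor k" by (rule shf_le_hor)
  finally have "start n \<le> k" by (intro start_le) auto
  then show ?thesis by (simp add: k_def)
qed

lemma filterlim_start: "filterlim start at_top sequentially"
  unfolding filterlim_at_top eventually_at_top_linorder
proof
  fix Z
  have "Z \<le> start n" if "n \<ge> Suc (hor Z)" for n
  proof (rule ccontr)
    assume "\<not> Z \<le> start n"
    then have "n \<le> hor Z" by (intro le_hor) auto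
    then show False using that by simp
  qed
  then show "\<exists>N. \<forall>n\<ge>N. Z \<le> start n" by blast
qed

text \<open>By minimality n > hor (start n - 1), and \<open>hor\<close> was defined as the square of
  exactly this product.\<close>

lemma start_bound: "start n * (\<Sum>i<start n. 2 * real (shf i) * real (blk i)) \<le> sqrt n"
proof (cases "start n")
  case (Suc k)
  define b where "b = (\<Sum>i\<le>k. 2 * shf i * blk i)"
  have "\<not> n \<le> hor k" using start_le[of n k] Suc by auto
  then have "(Suc k * b) ^ 2 \<le> n" by (simp add: hor_def b_def)
  then have "(real (Suc k * b))\<^sup>2 \<le> real n" by (metis of_nat_le_iff of_nat_power)
  then have "real (Suc k * b) \<le> sqrt n" by (rule real_le_rsqrt)
  moreover have "(\<Sum>i<Suc k. 2 * real (shf i) * real (blk i)) = real b"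
    by (simp add: b_def flip: lessThan_Suc_atMost)
  ultimately show ?thesis by (simp only: Suc of_nat_mult)
qed auto

lemma tol_le: "n \<le> hor k \<Longrightarrow> tol k \<le> (1 / 4) ^ k / (1 + real n)"
  unfolding tol_def by (intro divide_left_mono mult_pos_pos add_pos_nonneg) auto

lemma sum_tol_le: "(\<Sum>k\<in>{start n..<K}. tol k) \<le> 2 / (1 + real n)"
proof -
  have "(\<Sum>k\<in>{start n..<K}. tol k) \<le> (\<Sum>k\<in>{start n..<K}. (1 / 4) ^ k / (1 + real n))"
    by (rule sum_mono, rule tol_le, rule le_hor) simp
  also have "\<dots> = (\<Sum>k\<in>{start n..<K}. (1 / 4) ^ k) / (1 + real n)" by (simp add: sum_divide_distrib)
  also have "\<dots> \<le> 2 / (1 + real n)"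
  proof (rule divide_right_mono)
    have "(\<Sum>k\<in>{start n..<K}. (1 / 4 :: real) ^ k) \<le> (\<Sum>k. (1 / 4) ^ k)"
      by (rule sum_le_suminf) (auto simp: summable_geometric)
    also have "\<dots> \<le> 2" by (simp add: suminf_geometric)
    finally show "(\<Sum>k\<in>{start n..<K}. (1 / 4 :: real) ^ k) \<le> 2" .
  qed simp
  finally show ?thesis .
qed

text \<open>The words have the length required at the horizon and serve all earlier n, where the
  additional coefficients vanish.\<close>

lemma window_sum:
  assumes "n \<le> hor k" "g 0 = (0::real)"
  shows "(\<Sum>s<hor k + blk k + shf k. g (cf k n s)) = (\<Sum>s<n + blk k + shf k. g (cf k n s))"
  by (rule sum.mono_neutral_right) (use assms coef_eq_0[of n "blk k" "shf k"] in \<open>auto simp: cf_def not_less\<close>)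

lemma window_prod:
  assumes "n \<le> hor k" "g 0 = (1::real)"
  shows "(\<Prod>s<hor k + blk k + shf k. g (cf k n s)) = (\<Prod>s<n + blk k + shf k. g (cf k n s))"
  by (rule prod.mono_neutral_right) (use assms coef_eq_0[of n "blk k" "shf k"] in \<open>auto simp: cf_def not_less\<close>)

lemma lets_ge_2: "2 \<le> lets k"
  using lets_ge[of k] by linarith

lemma incr_mean_square: "n \<le> hor k \<Longrightarrow> incr_mean k n (\<lambda>s. (c + of_int s)\<^sup>2) = c\<^sup>2 + var k n"
  using word_mean_square[OF lets_ge_2[of k], where N="hor k + blk k + shf k" and c=c and a="cf k n"] window_sum[of n k "\<lambda>x. x\<^sup>2"]
  by (simp add: incr_mean_def var_def cf_def)

lemma incr_mean_cos: "n \<le> hor k \<Longrightarrow> incr_mean k n (\<lambda>s. cos (\<theta> * (c + of_int s))) = cos (\<theta> * c) * fac k n \<theta>"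
  using word_mean_cos[OF lets_ge_2[of k], where N="hor k + blk k + shf k" and c=c and \<theta>=\<theta> and a="cf k n"] window_prod[of n k "\<lambda>x. 1 - 2 / lets k * (1 - cos (\<theta> * x))"]
  by (simp add: incr_mean_def fac_def cf_def)

lemma incr_mean_integral:
  fixes g :: "int \<Rightarrow> real \<Rightarrow> real"
  assumes "\<And>s. integrable lborel (g s)"
  shows "incr_mean k n (\<lambda>s. \<integral>\<theta>. g s \<theta> \<partial>lborel) = (\<integral>\<theta>. incr_mean k n (\<lambda>s. g s \<theta>) \<partial>lborel)"
  unfolding incr_mean_def word_mean_def using assms
  by (simp add: Bochner_Integration.integral_sum)

lemma integrable_Phi_cos:
  "integrable lborel (\<lambda>\<theta>. indicator {-pi..pi} \<theta> * (Phi i K n \<theta> * cos (\<theta> * z)))"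
proof -
  have "integrable lborel (\<lambda>\<theta>. indicator {-pi..pi} \<theta> *\<^sub>R (Phi i K n \<theta> * cos (\<theta> * z)))"
    by (rule borel_integrable_compact) (auto intro!: continuous_intros)
  then show ?thesis by simp
qed

text \<open>Convolution with the law of the k-th increment: averaging the cosine multiplies the
  integrand by \<open>fac k\<close>, which is the factor missing from
  \<open>Phi (Suc k) K\<close>.\<close>

lemma incr_mean_Phi_prob:
  assumes "k < K" "n \<le> hor k"
  shows "incr_mean k n (\<lambda>s. Phi_prob (Suc k) K n (c + of_int s)) = Phi_prob k K n c"
proof -
  have "incr_mean k n (\<lambda>s. Phi_prob (Suc k) K n (c + of_int s))
      = 1 / (2 * pi) * incr_mean k n (\<lambda>s. \<integral>\<theta>. indicator {-pi..pi} \<theta> * (Phi (Suc k) K n \<theta> * cos (\<theta> * (c + of_int s))) \<partial>lborel)"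
    unfolding Phi_prob_def incr_mean_def by (rule word_mean_cmult)
  also have "\<dots> = 1 / (2 * pi) * (\<integral>\<theta>. incr_mean k n (\<lambda>s. indicator {-pi..pi} \<theta> * (Phi (Suc k) K n \<theta> * cos (\<theta> * (c + of_int s)))) \<partial>lborel)"
    by (subst incr_mean_integral[OF integrable_Phi_cos]) simp
  also have "\<dots> = 1 / (2 * pi) * (\<integral>\<theta>. indicator {-pi..pi} \<theta> * (Phi k K n \<theta> * cos (\<theta> * c)) \<partial>lborel)"
  proof (intro arg_cong[where f="\<lambda>x. 1 / (2 * pi) * x"] Bochner_Integration.integral_cong refl)
    fix \<theta> :: real
    have "incr_mean k n (\<lambda>s. indicator {-pi..pi} \<theta> * (Phi (Suc k) K n \<theta> * cos (\<theta> * (c + of_int s))))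
        = indicator {-pi..pi} \<theta> * Phi (Suc k) K n \<theta> * incr_mean k n (\<lambda>s. cos (\<theta> * (c + of_int s)))"
      unfolding incr_mean_def by (simp add: word_mean_cmult mult.assoc)
    also have "\<dots> = indicator {-pi..pi} \<theta> * (Phi k K n \<theta> * cos (\<theta> * c))"
      using assms by (simp add: incr_mean_cos Phi_def prod.atLeast_Suc_lessThan)
    finally show "incr_mean k n (\<lambda>s. indicator {-pi..pi} \<theta> * (Phi (Suc k) K n \<theta> * cos (\<theta> * (c + of_int s))))
        = indicator {-pi..pi} \<theta> * (Phi k K n \<theta> * cos (\<theta> * c))" .
  qed
  finally show ?thesis by (simp add: Phi_prob_def)
qed

text \<open>The empty product belongs to the point mass at 0: cos (\<theta> z) integrates to 0 over
  [-pi, pi] for integers z \<noteq> 0.\<close>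

lemma Phi_prob_empty: "Phi_prob K K n (of_int z) = of_bool (z = 0)"
proof -
  have "(\<integral>\<theta>. indicator {-pi..pi} \<theta> *\<^sub>R cos (\<theta> * of_int z) \<partial>lborel) = 2 * pi * of_bool (z = 0)"
  proof (cases "z = 0")
    case False
    have "(\<integral>\<theta>. indicator {-pi..pi} \<theta> *\<^sub>R cos (\<theta> * of_int z) \<partial>lborel)
        = sin (pi * of_int z) / of_int z - sin ((-pi) * of_int z) / of_int z"
    proof (rule integral_FTC_atLeastAtMost)
      fix x :: real
      show "((\<lambda>\<theta>. sin (\<theta> * of_int z) / of_int z) has_vector_derivative cos (x * of_int z)) (at x within {-pi..pi})"
        unfolding has_real_derivative_iff_has_vector_derivative[symmetric]
        using False by (auto intro!: derivative_eq_intros)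
    qed (use pi_ge_two in \<open>auto intro!: continuous_intros\<close>)
    also have "\<dots> = 0" by (simp add: sin_npi_int)
    finally show ?thesis using False by simp
  qed simp
  then show ?thesis by (simp add: Phi_prob_def Phi_def)
qed

lemma abs_Phi_prob_le: "\<bar>Phi_prob i K n z\<bar> \<le> 1"
proof -
  have i1: "integrable lborel (\<lambda>\<theta>. indicator {-pi..pi} \<theta> :: real)" by simp
  have "\<bar>\<integral>\<theta>. indicator {-pi..pi} \<theta> * (Phi i K n \<theta> * cos (\<theta> * z)) \<partial>lborel\<bar>
      \<le> (\<integral>\<theta>. \<bar>indicator {-pi..pi} \<theta> * (Phi i K n \<theta> * cos (\<theta> * z))\<bar> \<partial>lborel)"
    by (rule integral_abs_bound)
  also have "\<dots> \<le> (\<integral>\<theta>. indicator {-pi..pi} \<theta> \<partial>lborel)"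
  proof (rule integral_mono[OF integrable_abs[OF integrable_Phi_cos] i1])
    fix \<theta> :: real
    have "Phi i K n \<theta> * \<bar>cos (\<theta> * z)\<bar> \<le> 1"
      by (intro mult_le_one Phi_le_1 abs_cos_le_one) auto
    then show "\<bar>indicator {-pi..pi} \<theta> * (Phi i K n \<theta> * cos (\<theta> * z))\<bar> \<le> indicator {-pi..pi} \<theta>"
      by (auto simp: indicator_def abs_mult abs_of_nonneg[OF Phi_nonneg])
  qed
  also have "\<dots> = 2 * pi" by simp
  finally have "1 / (2 * pi) * \<bar>\<integral>\<theta>. indicator {-pi..pi} \<theta> * (Phi i K n \<theta> * cos (\<theta> * z)) \<partial>lborel\<bar> \<le> 1 / (2 * pi) * (2 * pi)"
    by (intro mult_left_mono) auto
  then show ?thesis by (simp add: Phi_prob_def abs_mult)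
qed

context ergodic_pt begin

text \<open>Each f_k depends on its predecessors only through their sum, which has to be measurable
  and bounded; the recursion runs over these partial sums with that as its invariant.\<close>

lemma exists_increments:
  assumes "standard_prob_space M" "aperiodic_map M T"
  obtains f where "\<And>k. increment k (\<lambda>x. \<Sum>i<k. f i x) (f k)"
proof -
  obtain U where U: "uniform01 U"
    by (rule exists_uniform[OF assms]) (rule that)
  have step: "\<exists>f. increment k F f" if F: "F \<in> measurable M (count_space UNIV)" "\<And>x. \<bar>F x\<bar> \<le> b" for k F b
    by (rule exists_increment[OF U F])
  define P where "P k F \<longleftrightarrow> F \<in> measurable M (count_space UNIV) \<and> (\<exists>b. \<forall>x. \<bar>F x\<bar> \<le> b) \<and> (k = 0 \<longrightarrow> F = (\<lambda>_. 0))"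
    for k :: nat and F :: "'a \<Rightarrow> int"
  have "\<exists>F. \<forall>k. P k (F k) \<and> (\<exists>f. increment k (F k) f \<and> F (Suc k) = (\<lambda>x. F k x + f x))"
  proof (rule dependent_nat_choice)
    show "\<exists>F. P 0 F" by (rule exI[of _ "\<lambda>_. 0"]) (auto simp: P_def)
    fix F k assume "P k F"
    then obtain b where F: "F \<in> measurable M (count_space UNIV)" "\<And>x. \<bar>F x\<bar> \<le> b" by (auto simp: P_def)
    then obtain f where f: "increment k F f" using step by blast
    have fm: "f \<in> measurable M (count_space UNIV)" and fb: "\<And>x. \<bar>f x\<bar> \<le> 2 * int (blk k)"
      using f by (auto simp: increment_def)
    have "(\<lambda>x. F x + f x) \<in> measurable M (count_space UNIV)"
      by (rule measurable_of_int_imp_measurable) (use F(1) fm in simp)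
    moreover have "\<bar>F x + f x\<bar> \<le> b + 2 * int (blk k)" for x using F(2)[of x] fb[of x] by linarith
    ultimately have "P (Suc k) (\<lambda>x. F x + f x)" by (auto simp: P_def)
    then show "\<exists>F'. P (Suc k) F' \<and> (\<exists>f. increment k F f \<and> F' = (\<lambda>x. F x + f x))" using f by blast
  qed
  then obtain F where F: "\<And>k. P k (F k)" "\<And>k. \<exists>f. increment k (F k) f \<and> F (Suc k) = (\<lambda>x. F k x + f x)" by blast
  then obtain f where f: "\<And>k. increment k (F k) (f k)" "\<And>k. F (Suc k) = (\<lambda>x. F k x + f k x)" by metis
  have "F k = (\<lambda>x. \<Sum>i<k. f i x)" for k
  proof (induction k)
    case 0
    then show ?case using F(1)[of 0] by (auto simp: P_def)
  next
    case (Suc k)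
    then show ?case by (simp add: f(2))
  qed
  then show ?thesis using that[of f] f(1) by simp
qed

end

section \<open>Second moments and local probabilities of the partial sums\<close>

locale increments = ergodic_pt +
  fixes f :: "nat \<Rightarrow> 'a \<Rightarrow> int"
  assumes incr: "\<And>k. increment k (\<lambda>x. \<Sum>i<k. f i x) (f k)"
begin

definition F :: "nat \<Rightarrow> 'a \<Rightarrow> int" where "F k x = (\<Sum>i<k. f i x)"

lemma f_measurable [measurable]: "f k \<in> measurable M (count_space UNIV)"
  and f_bound: "\<bar>f k x\<bar> \<le> 2 * int (blk k)"
  and Sf_bound: "\<bar>S (f k) n x\<bar> \<le> 2 * int (shf k) * int (blk k)"
  and f_mean: "(\<integral>x. real_of_int (f k x) \<partial>M) = 0"
  using incr[of k] unfolding increment_def by blast+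

lemma f_indep: "n \<le> hor k \<Longrightarrow> (\<And>c s. \<bar>u c s\<bar> \<le> 2 * (1 + (real_of_int c)\<^sup>2 + (real_of_int s)\<^sup>2)) \<Longrightarrow>
    \<bar>(\<integral>x. u (S (F k) n x) (S (f k) n x) \<partial>M) - (\<integral>x. incr_mean k n (u (S (F k) n x)) \<partial>M)\<bar> \<le> tol k"
  using incr[of k] unfolding increment_def F_def[abs_def] by blast

lemma F_measurable [measurable]: "F k \<in> measurable M (count_space UNIV)"
proof (rule measurable_of_int_imp_measurable)
  show "(\<lambda>x. real_of_int (F k x)) \<in> borel_measurable M" unfolding F_def of_int_sum by measurable
qed

lemma S_F_Suc: "S (F (Suc k)) n x = S (F k) n x + S (f k) n x"
  by (simp add: birkhoff_sum_def F_def sum.distrib)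

lemma S_F_bound: "\<bar>S (F k) n x\<bar> \<le> (\<Sum>i<k. 2 * int (shf i) * int (blk i))"
proof (induction k)
  case 0
  then show ?case by (simp add: birkhoff_sum_def F_def)
next
  case (Suc k)
  then show ?case using Sf_bound[of k n x] by (simp add: S_F_Suc)
qed

lemma integrable_S_F:
  assumes "\<And>c. \<bar>c\<bar> \<le> (\<Sum>i<k. 2 * int (shf i) * int (blk i)) \<Longrightarrow> \<bar>u c\<bar> \<le> B"
  shows "integrable M (\<lambda>x. u (S (F k) n x) :: real)"
proof (rule integrable_const_bound[of _ B])
  show "AE x in M. norm (u (S (F k) n x)) \<le> B" using assms S_F_bound by simp
  show "(\<lambda>x. u (S (F k) n x)) \<in> borel_measurable M"
    by (rule measurable_compose[where N="count_space UNIV"]) measurable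
qed

lemma integrable_S_F_sq: "integrable M (\<lambda>x. (real_of_int (S (F k) n x))\<^sup>2)"
proof (rule integrable_S_F[where u="\<lambda>c. (real_of_int c)\<^sup>2"])
  fix c assume "\<bar>c\<bar> \<le> (\<Sum>i<k. 2 * int (shf i) * int (blk i))" (is "_ \<le> ?b")
  then have "\<bar>real_of_int c\<bar> \<le> real_of_int ?b" by (metis of_int_abs of_int_le_iff)
  then show "\<bar>(real_of_int c)\<^sup>2\<bar> \<le> (real_of_int ?b)\<^sup>2"
    using power_mono[of "\<bar>real_of_int c\<bar>" "real_of_int ?b" 2] by simp
qed

text \<open>The test function is u (c + s); the inequality (c + s)^2 \<le> 2 c^2 + 2 s^2 is the
  origin of the factor 2 in \<open>increment\<close>.\<close>

lemma F_step:
  assumes "n \<le> hor k" "\<And>c. \<bar>u c\<bar> \<le> 1 + (real_of_int c)\<^sup>2"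
  shows "\<bar>(\<integral>x. u (S (F (Suc k)) n x) \<partial>M) - (\<integral>x. incr_mean k n (\<lambda>s. u (S (F k) n x + s)) \<partial>M)\<bar> \<le> tol k"
  unfolding S_F_Suc
proof (rule f_indep[OF assms(1), where u="\<lambda>c s. u (c + s)"])
  fix c s :: int
  have "\<bar>u (c + s)\<bar> \<le> 1 + (real_of_int c + real_of_int s)\<^sup>2" using assms(2)[of "c + s"] by simp
  also have "\<dots> \<le> 2 * (1 + (real_of_int c)\<^sup>2 + (real_of_int s)\<^sup>2)"
    using zero_le_power2[of "real_of_int c - real_of_int s"] by (simp add: power2_sum power2_diff)
  finally show "\<bar>u (c + s)\<bar> \<le> 2 * (1 + (real_of_int c)\<^sup>2 + (real_of_int s)\<^sup>2)" .
qed

text \<open>The letters are centred, so in the model the cross term vanishes and each step adds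
  exactly \<open>var k n\<close>.\<close>

lemma F_second_moment:
  assumes "start n \<le> K"
  shows "\<bar>mom2 (F K) n - mom2 (F (start n)) n
    - (\<Sum>k\<in>{start n..<K}. var k n)\<bar> \<le> (\<Sum>k\<in>{start n..<K}. tol k)"
  using assms
proof (induction K rule: dec_induct)
  case (step k)
  have n: "n \<le> hor k" using step(1) by (rule le_hor)
  have "\<bar>(\<integral>x. (real_of_int (S (F (Suc k)) n x))\<^sup>2 \<partial>M)
      - (\<integral>x. incr_mean k n (\<lambda>s. (real_of_int (S (F k) n x + s))\<^sup>2) \<partial>M)\<bar> \<le> tol k"
    by (rule F_step[OF n, where u="\<lambda>c. (real_of_int c)\<^sup>2"]) simp
  also have "(\<integral>x. incr_mean k n (\<lambda>s. (real_of_int (S (F k) n x + s))\<^sup>2) \<partial>M)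
      = mom2 (F k) n + var k n"
    by (simp add: incr_mean_square[OF n] integrable_S_F_sq prob_space)
  finally show ?case using step by simp
qed simp

text \<open>The summands are replaced by their models one at a time, from the last down to i. After
  each replacement the model part is already absorbed in \<open>Phi_prob\<close>, a bounded function
  of the remaining partial sum, and the cost is one tolerance.\<close>

lemma F_local_prob:
  assumes "start n \<le> i" "i \<le> K"
  shows "\<bar>\<P>(x in M. S (F K) n x = z) - (\<integral>x. Phi_prob i K n (real_of_int (S (F i) n x - z)) \<partial>M)\<bar>
    \<le> (\<Sum>k\<in>{i..<K}. tol k)"
  using assms(2,1)
proof (induction i rule: inc_induct)
  case base
  have "(\<integral>x. Phi_prob K K n (real_of_int (S (F K) n x - z)) \<partial>M) = (\<integral>x. indicator {x \<in> space M. S (F K) n x = z} x \<partial>M)"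
    by (intro Bochner_Integration.integral_cong refl) (simp only: Phi_prob_empty, simp add: indicator_def)
  then show ?case by simp
next
  case (step k)
  have n: "n \<le> hor k" using step(4) by (rule le_hor)
  have "\<bar>(\<integral>x. Phi_prob (Suc k) K n (real_of_int (S (F (Suc k)) n x - z)) \<partial>M)
      - (\<integral>x. incr_mean k n (\<lambda>s. Phi_prob (Suc k) K n (real_of_int (S (F k) n x + s - z))) \<partial>M)\<bar> \<le> tol k"
    by (rule F_step[OF n, where u="\<lambda>c. Phi_prob (Suc k) K n (real_of_int (c - z))"])
      (rule order_trans[OF abs_Phi_prob_le], simp)
  also have "(\<integral>x. incr_mean k n (\<lambda>s. Phi_prob (Suc k) K n (real_of_int (S (F k) n x + s - z))) \<partial>M)
      = (\<integral>x. Phi_prob k K n (real_of_int (S (F k) n x - z)) \<partial>M)"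
  proof (intro Bochner_Integration.integral_cong refl)
    fix x
    have "(\<lambda>s. Phi_prob (Suc k) K n (real_of_int (S (F k) n x + s - z)))
        = (\<lambda>s. Phi_prob (Suc k) K n (real_of_int (S (F k) n x - z) + of_int s))"
      by (simp add: algebra_simps)
    then show "incr_mean k n (\<lambda>s. Phi_prob (Suc k) K n (real_of_int (S (F k) n x + s - z)))
        = Phi_prob k K n (real_of_int (S (F k) n x - z))"
      by (simp only: incr_mean_Phi_prob[OF step(2) n])
  qed
  finally show ?case using step by (simp add: sum.atLeast_Suc_lessThan)
qed

end

lemma eventually_start_pos: "\<forall>\<^sub>F n in sequentially. 0 < start n"
proof -
  have "\<forall>\<^sub>F n in sequentially. 1 \<le> start n" using filterlim_start unfolding filterlim_at_top by blast
  then show ?thesis by eventually_elim simp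
qed

lemma gauss_Lipschitz: "\<bar>exp (- a\<^sup>2) - exp (- b\<^sup>2)\<bar> \<le> \<bar>a - b\<bar>" for a b :: real
proof -
  have deriv: "((\<lambda>x. exp (- x\<^sup>2)) has_real_derivative - 2 * x * exp (- x\<^sup>2)) (at x within UNIV)" for x :: real
    by (auto intro!: derivative_eq_intros)
  have "norm (exp (- a\<^sup>2) - exp (- b\<^sup>2)) \<le> 1 * norm (a - b)"
  proof (rule field_differentiable_bound[OF _ deriv])
    fix x :: real
    have "2 * \<bar>x\<bar> \<le> 1 + x\<^sup>2" using zero_le_power2[of "\<bar>x\<bar> - 1"] by (simp add: power2_diff)
    also have "\<dots> \<le> exp (x\<^sup>2)" by (rule exp_ge_add_one_self)
    finally have "2 * \<bar>x\<bar> * exp (- x\<^sup>2) \<le> exp (x\<^sup>2) * exp (- x\<^sup>2)" by (rule mult_right_mono) simp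
    then show "norm (- 2 * x * exp (- x\<^sup>2)) \<le> 1" by (simp add: abs_mult mult_exp_exp)
  qed auto
  then show ?thesis by simp
qed

text \<open>The Gaussian profile varies on the scale sqrt n, so a shift of smaller order is
  harmless. It will absorb the summands whose independence has run out.\<close>

lemma gauss_shift:
  fixes x y v :: real
  assumes v: "1 \<le> v" and n: "0 < n"
  shows "\<bar>exp (- x\<^sup>2 / (2 * real n * v)) / sqrt (2 * pi * v) - exp (- y\<^sup>2 / (2 * real n * v)) / sqrt (2 * pi * v)\<bar>
    \<le> \<bar>x - y\<bar> / sqrt n"
proof -
  define c where "c = sqrt (2 * real n * v)"
  have c: "0 < c" "c\<^sup>2 = 2 * real n * v" using v n by (auto simp: c_def)
  have cn: "sqrt n \<le> c" unfolding c_def using v n by (intro real_sqrt_le_mono) (simp add: mult_le_cancel_left1)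
  have s1: "1 \<le> sqrt (2 * pi * v)"
  proof -
    have "1 * 1 \<le> (2 * pi) * v" using v pi_ge_two by (intro mult_mono) auto
    then show ?thesis by simp
  qed
  have "\<bar>exp (- x\<^sup>2 / (2 * real n * v)) / sqrt (2 * pi * v) - exp (- y\<^sup>2 / (2 * real n * v)) / sqrt (2 * pi * v)\<bar>
      = \<bar>exp (- (x / c)\<^sup>2) - exp (- (y / c)\<^sup>2)\<bar> / sqrt (2 * pi * v)"
    using s1 by (simp add: power_divide c(2) abs_divide flip: diff_divide_distrib)
  also have "\<dots> \<le> \<bar>x / c - y / c\<bar> / 1"
    using s1 by (intro frac_le gauss_Lipschitz) auto
  also have "\<dots> = \<bar>x - y\<bar> / c" using c by (simp add: abs_divide flip: diff_divide_distrib)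
  also have "\<dots> \<le> \<bar>x - y\<bar> / sqrt n" using cn n by (intro divide_left_mono mult_pos_pos c) auto
  finally show ?thesis .
qed

section \<open>The limit function and its moments\<close>

context increments begin

text \<open>The case n = 1 of near independence: 2 / 4^k comes from \<open>var_le_early\<close>, 1 /
  4^k from the tolerance.\<close>

lemma f_second_moment: "(\<integral>x. (real_of_int (f k x))\<^sup>2 \<partial>M) \<le> 3 / 4 ^ k"
proof -
  have h: "1 \<le> hor k" using Suc_le_hor[of k] by linarith
  have "\<bar>(\<integral>x. (real_of_int (S (f k) 1 x))\<^sup>2 \<partial>M) - (\<integral>x. incr_mean k 1 (\<lambda>s. (real_of_int s)\<^sup>2) \<partial>M)\<bar> \<le> tol k"
    by (rule f_indep[OF h, where u="\<lambda>c s. (real_of_int s)\<^sup>2"]) simp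
  also have "(\<integral>x. incr_mean k 1 (\<lambda>s. (real_of_int s)\<^sup>2) \<partial>M) = var k 1"
    using incr_mean_square[OF h, of 0] by (simp add: prob_space)
  also have "S (f k) 1 = f k" by (simp add: birkhoff_sum_def fun_eq_iff)
  finally have "(\<integral>x. (real_of_int (f k x))\<^sup>2 \<partial>M) \<le> var k 1 + tol k" by linarith
  also have "var k 1 \<le> 2 * real 1 ^ 2 / (real (Suc k) * real (blk k))" by (rule var_le_early)
  also have "\<dots> \<le> 2 / (1 * 4 ^ k)"
  proof -
    have "real (4 ^ k) \<le> real (blk k)" using blk_ge_power[of k] by (simp only: of_nat_le_iff)
    then have "4 ^ k \<le> real (blk k)" by simp
    then have "1 * 4 ^ k \<le> real (Suc k) * real (blk k)" by (intro mult_mono) auto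
    then show ?thesis by (intro frac_le) auto
  qed
  also have "tol k \<le> (1 / 4) ^ k / (1 + real 0)" by (rule tol_le) simp
  finally show ?thesis by (simp add: power_divide)
qed

lemma integrable_f_sq: "integrable M (\<lambda>x. (real_of_int (f k x))\<^sup>2)"
proof (rule integrable_const_bound[of _ "(2 * real (blk k))\<^sup>2"])
  have "\<bar>real_of_int (f k x)\<bar> \<le> 2 * real (blk k)" for x using f_bound[of k x] by linarith
  then have "\<bar>real_of_int (f k x)\<bar>\<^sup>2 \<le> (2 * real (blk k))\<^sup>2" for x by (intro power_mono) auto
  then show "AE x in M. norm ((real_of_int (f k x))\<^sup>2) \<le> (2 * real (blk k))\<^sup>2" by simp
qed measurable

text \<open>A nonzero integer has square at least 1, so the second moment bounds the probability of
  a nonzero value; Borel-Cantelli applies.\<close>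

lemma AE_eventually_f_0: "AE x in M. \<forall>\<^sub>F k in sequentially. f k x = 0"
proof -
  define A where "A k = {x \<in> space M. f k x \<noteq> 0}" for k
  have [measurable]: "A k \<in> sets M" for k unfolding A_def by measurable
  have PA: "prob (A k) \<le> 3 * (1 / 4) ^ k" for k
  proof -
    have "prob (A k) = (\<integral>x. indicator (A k) x \<partial>M)" by simp
    also have "\<dots> \<le> (\<integral>x. (real_of_int (f k x))\<^sup>2 \<partial>M)"
    proof (rule integral_mono[OF _ integrable_f_sq])
      fix x
      have "1 \<le> (real_of_int (f k x))\<^sup>2" if "f k x \<noteq> 0"
      proof -
        have "1 \<le> (f k x)\<^sup>2" using that by (simp add: int_one_le_iff_zero_less)
        then have "real_of_int 1 \<le> real_of_int ((f k x)\<^sup>2)" by (simp only: of_int_le_iff)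
        then show ?thesis by simp
      qed
      then show "indicator (A k) x \<le> (real_of_int (f k x))\<^sup>2" by (auto simp: indicator_def A_def)
    qed (simp add: emeasure_eq_measure)
    also have "\<dots> \<le> 3 / 4 ^ k" by (rule f_second_moment)
    finally show ?thesis by (simp add: power_divide)
  qed
  have "summable (\<lambda>k. prob (A k))"
    by (rule summable_comparison_test'[of "\<lambda>k. 3 * (1 / 4) ^ k" 0]) (use PA in \<open>auto simp: summable_geometric summable_mult\<close>)
  then have "AE x in M. \<forall>\<^sub>F k in sequentially. x \<in> space M - A k"
    by (intro borel_cantelli_AE1) (auto simp: emeasure_eq_measure)
  then show ?thesis by (rule AE_mp) (auto simp: A_def elim!: eventually_mono)
qed

text \<open>A common majorant for all partial sums: the terms still have means at most 3 / 2^k, and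
  Cauchy-Schwarz with weights 2^k and 2^(-k) bounds every square of F K by 2 W.\<close>

definition W :: "'a \<Rightarrow> real" where "W x = (\<Sum>k. 2 ^ k * (real_of_int (f k x))\<^sup>2)"

lemma AE_summable_W: "AE x in M. summable (\<lambda>k. 2 ^ k * (real_of_int (f k x))\<^sup>2)"
  using AE_eventually_f_0
proof eventually_elim
  case (elim x)
  then obtain N where "\<And>k. N \<le> k \<Longrightarrow> f k x = 0" by (auto simp: eventually_sequentially)
  then show ?case by (intro summable_finite[of "{..<N}"]) (auto simp: not_less)
qed

lemma integrable_W: "integrable M W"
  unfolding W_def
proof (rule integrable_suminf)
  show "integrable M (\<lambda>x. 2 ^ k * (real_of_int (f k x))\<^sup>2)" for k
    by (intro integrable_mult_right integrable_f_sq)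
  show "AE x in M. summable (\<lambda>k. norm (2 ^ k * (real_of_int (f k x))\<^sup>2))"
    using AE_summable_W by simp
  show "summable (\<lambda>k. \<integral>x. norm (2 ^ k * (real_of_int (f k x))\<^sup>2) \<partial>M)"
  proof (rule summable_comparison_test'[of "\<lambda>k. 3 * (1 / 2) ^ k" 0])
    fix k :: nat
    have "(\<integral>x. norm (2 ^ k * (real_of_int (f k x))\<^sup>2) \<partial>M) = 2 ^ k * (\<integral>x. (real_of_int (f k x))\<^sup>2 \<partial>M)" by simp
    also have "\<dots> \<le> 2 ^ k * (3 / 4 ^ k)" by (intro mult_left_mono f_second_moment) auto
    also have "\<dots> = 3 * (1 / 2) ^ k" by (simp add: power_divide field_simps flip: power_mult_distrib)
    finally show "norm (\<integral>x. norm (2 ^ k * (real_of_int (f k x))\<^sup>2) \<partial>M) \<le> 3 * (1 / 2) ^ k" by simp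
  qed (auto simp: summable_geometric summable_mult)
qed

lemma F_sq_le_W: "AE x in M. \<forall>K. (real_of_int (F K x))\<^sup>2 \<le> 2 * W x"
  using AE_summable_W
proof eventually_elim
  case (elim x)
  show ?case
  proof
    fix K
    have s: "sqrt (1 / 2 ^ k) * sqrt (2 ^ k) = 1" for k :: nat by (simp add: real_sqrt_mult[symmetric])
    have "real_of_int (F K x) = (\<Sum>k<K. sqrt (1 / 2 ^ k) * (sqrt (2 ^ k) * real_of_int (f k x)))"
      by (simp add: F_def mult.assoc[symmetric] s)
    then have "(real_of_int (F K x))\<^sup>2 \<le> (\<Sum>k<K. (sqrt (1 / 2 ^ k))\<^sup>2) * (\<Sum>k<K. (sqrt (2 ^ k) * real_of_int (f k x))\<^sup>2)"
      by (simp only: Cauchy_Schwarz_ineq_sum)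
    also have "\<dots> = (\<Sum>k<K. (1 / 2) ^ k) * (\<Sum>k<K. 2 ^ k * (real_of_int (f k x))\<^sup>2)"
      by (simp add: power_mult_distrib power_divide)
    also have "\<dots> \<le> 2 * W x"
    proof (intro mult_mono)
      have "(\<Sum>k<K. (1 / 2 :: real) ^ k) \<le> (\<Sum>k. (1 / 2) ^ k)"
        by (rule sum_le_suminf) (auto simp: summable_geometric)
      then show "(\<Sum>k<K. (1 / 2 :: real) ^ k) \<le> 2" by (simp add: suminf_geometric)
      show "(\<Sum>k<K. 2 ^ k * (real_of_int (f k x))\<^sup>2) \<le> W x"
        unfolding W_def by (rule sum_le_suminf[OF elim]) auto
    qed (auto intro: sum_nonneg)
    finally show "(real_of_int (F K x))\<^sup>2 \<le> 2 * W x" .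
  qed
qed

text \<open>Almost everywhere only finitely many \<open>f k x\<close> are nonzero; elsewhere \<open>g x\<close> is a junk value.\<close>

definition g :: "'a \<Rightarrow> int" where "g x = \<lfloor>lim (\<lambda>K. real_of_int (F K x))\<rfloor>"

lemma g_measurable [measurable]: "g \<in> measurable M (count_space UNIV)"
  unfolding g_def by measurable

lemma AE_F_eq_g: "AE x in M. \<forall>\<^sub>F K in sequentially. F K x = g x"
  using AE_eventually_f_0
proof eventually_elim
  case (elim x)
  then obtain N where N: "\<And>k. N \<le> k \<Longrightarrow> f k x = 0" by (auto simp: eventually_sequentially)
  have const: "F K x = F N x" if "N \<le> K" for K
    using that by (induction K rule: dec_induct) (auto simp: F_def N)
  have "(\<lambda>K. real_of_int (F K x)) \<longlonglongrightarrow> real_of_int (F N x)"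
    by (rule tendsto_eventually) (rule eventually_sequentiallyI[of N], drule const, simp)
  then have "g x = F N x" by (simp add: g_def limI)
  then show ?case using const by (intro eventually_sequentiallyI[of N]) metis
qed

lemma AE_S_F_eq: "AE x in M. \<forall>\<^sub>F K in sequentially. S (F K) n x = S g n x"
proof -
  have "AE x in M. \<forall>i\<in>{..<n}. \<forall>\<^sub>F K in sequentially. F K ((T ^^ i) x) = g ((T ^^ i) x)"
  proof (rule AE_finite_allI)
    have "Measurable.pred M (\<lambda>x. \<forall>\<^sub>F K in sequentially. F K x = g x)"
      unfolding eventually_sequentially by measurable
    then show "AE x in M. \<forall>\<^sub>F K in sequentially. F K ((T ^^ i) x) = g ((T ^^ i) x)" for i
      by (rule AE_T_pow[OF _ AE_F_eq_g])
  qed simp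
  then show ?thesis
  proof eventually_elim
    case (elim x)
    then have "\<forall>\<^sub>F K in sequentially. \<forall>i\<in>{..<n}. F K ((T ^^ i) x) = g ((T ^^ i) x)"
      by (intro eventually_ball_finite) auto
    then show ?case by eventually_elim (simp add: birkhoff_sum_def)
  qed
qed

lemma AE_S_F_sq_le: "AE x in M. \<forall>K. (real_of_int (S (F K) n x))\<^sup>2 \<le> n * (\<Sum>i<n. 2 * W ((T ^^ i) x))"
proof -
  have [measurable]: "W \<in> borel_measurable M" using integrable_W by (rule borel_measurable_integrable)
  have "AE x in M. \<forall>i\<in>{..<n}. \<forall>K. (real_of_int (F K ((T ^^ i) x)))\<^sup>2 \<le> 2 * W ((T ^^ i) x)"
    by (rule AE_finite_allI) (auto intro!: AE_T_pow[where P="\<lambda>x. \<forall>K. (real_of_int (F K x))\<^sup>2 \<le> 2 * W x"] F_sq_le_W)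
  then show ?thesis
  proof eventually_elim
    case (elim x)
    show ?case
    proof
      fix K
      have "(real_of_int (S (F K) n x))\<^sup>2 = (\<Sum>i<n. 1 * real_of_int (F K ((T ^^ i) x)))\<^sup>2"
        by (simp add: birkhoff_sum_def)
      also have "\<dots> \<le> (\<Sum>i<n. 1\<^sup>2) * (\<Sum>i<n. (real_of_int (F K ((T ^^ i) x)))\<^sup>2)"
        by (rule Cauchy_Schwarz_ineq_sum)
      also have "\<dots> \<le> n * (\<Sum>i<n. 2 * W ((T ^^ i) x))"
        using elim by (auto intro!: mult_left_mono sum_mono)
      finally show "(real_of_int (S (F K) n x))\<^sup>2 \<le> n * (\<Sum>i<n. 2 * W ((T ^^ i) x))" .
    qed
  qed
qed

text \<open>Dominated convergence in K at fixed n; \<open>W\<close> summed along n points of the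
  orbit provides the majorant.\<close>

lemma
  shows integrable_S_g_sq: "integrable M (\<lambda>x. (real_of_int (S g n x))\<^sup>2)"
    and S_g_second_moment: "(\<lambda>K. mom2 (F K) n) \<longlonglongrightarrow> mom2 g n"
proof -
  have D: "integrable M (\<lambda>x. n * (\<Sum>i<n. 2 * W ((T ^^ i) x)))"
    by (intro integrable_mult_right Bochner_Integration.integrable_sum integrable_T_pow integrable_W)
  have lim: "AE x in M. (\<lambda>K. (real_of_int (S (F K) n x))\<^sup>2) \<longlonglongrightarrow> (real_of_int (S g n x))\<^sup>2"
    using AE_S_F_eq[of n] by eventually_elim (auto intro!: tendsto_eventually elim!: eventually_mono)
  have bound: "AE x in M. norm ((real_of_int (S (F K) n x))\<^sup>2) \<le> n * (\<Sum>i<n. 2 * W ((T ^^ i) x))" for K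
    using AE_S_F_sq_le[of n] by eventually_elim simp
  show "integrable M (\<lambda>x. (real_of_int (S g n x))\<^sup>2)"
    by (rule integrable_dominated_convergence[OF _ _ D lim bound]) measurable
  show "(\<lambda>K. mom2 (F K) n) \<longlonglongrightarrow> mom2 g n"
    by (rule integral_dominated_convergence[OF _ _ D lim bound]) measurable
qed

lemma integrable_g_sq: "integrable M (\<lambda>x. (real_of_int (g x))\<^sup>2)"
  using integrable_S_g_sq[of 1] by (simp add: birkhoff_sum_def)

lemma g_mean: "(\<integral>x. real_of_int (g x) \<partial>M) = 0"
proof -
  have "(\<lambda>K. \<integral>x. real_of_int (F K x) \<partial>M) \<longlonglongrightarrow> (\<integral>x. real_of_int (g x) \<partial>M)"
  proof (rule integral_dominated_convergence)
    show "integrable M (\<lambda>x. 1 + 2 * W x)" using integrable_W by simp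
    show "AE x in M. (\<lambda>K. real_of_int (F K x)) \<longlonglongrightarrow> real_of_int (g x)"
      using AE_F_eq_g by eventually_elim (auto intro!: tendsto_eventually elim!: eventually_mono)
    show "AE x in M. norm (real_of_int (F K x)) \<le> 1 + 2 * W x" for K
      using F_sq_le_W
    proof eventually_elim
      case (elim x)
      have "\<bar>real_of_int (F K x)\<bar> \<le> 1 + (real_of_int (F K x))\<^sup>2"
        using zero_le_power2[of "\<bar>real_of_int (F K x)\<bar> - 1"] by (simp add: power2_diff)
      then show ?case using elim by (smt (verit) real_norm_def)
    qed
  qed measurable
  moreover have "(\<integral>x. real_of_int (F K x) \<partial>M) = 0" for K
  proof -
    have fi: "integrable M (\<lambda>x. real_of_int (f k x))" for k
    proof (rule integrable_const_bound[of _ "2 * real (blk k)"])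
      have "\<bar>real_of_int (f k x)\<bar> \<le> 2 * real (blk k)" for x using f_bound[of k x] by linarith
      then show "AE x in M. norm (real_of_int (f k x)) \<le> 2 * real (blk k)" by simp
    qed measurable
    show ?thesis by (simp add: F_def Bochner_Integration.integral_sum[OF fi] f_mean)
  qed
  ultimately show ?thesis by (simp add: LIMSEQ_const_iff)
qed

lemma prob_S_F_neq: "(\<lambda>K. \<P>(x in M. S (F K) n x \<noteq> S g n x)) \<longlonglongrightarrow> 0"
proof -
  have "(\<lambda>K. \<integral>x. indicator {x \<in> space M. S (F K) n x \<noteq> S g n x} x \<partial>M) \<longlonglongrightarrow> (\<integral>x. (0::real) \<partial>M)"
  proof (rule integral_dominated_convergence[where w="\<lambda>_. 1"])
    show "AE x in M. (\<lambda>K. indicator {x \<in> space M. S (F K) n x \<noteq> S g n x} x) \<longlonglongrightarrow> (0::real)"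
      using AE_S_F_eq[of n]
    proof eventually_elim
      case (elim x)
      then have "\<forall>\<^sub>F K in sequentially. indicator {x \<in> space M. S (F K) n x \<noteq> S g n x} x = (0::real)"
        by eventually_elim (simp add: indicator_def)
      then show ?case by (rule tendsto_eventually)
    qed
    show "AE x in M. norm (indicator {x \<in> space M. S (F K) n x \<noteq> S g n x} x :: real) \<le> 1" for K
      by (simp add: indicator_def)
  qed simp_all
  then show ?thesis by simp
qed

section \<open>Transfer of the limit theorem to the limit function\<close>

definition good_stage :: "nat \<Rightarrow> nat \<Rightarrow> bool" where
  "good_stage n K \<longleftrightarrow> lev n < K \<and> start n \<le> K \<and> \<bar>mom2 (F K) n - mom2 g n\<bar> < 1 / (1 + real n) \<and>
    \<P>(x in M. S (F K) n x \<noteq> S g n x) < 1 / (1 + real n)"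

text \<open>For fixed n both errors vanish as K grows, so a cutoff depending on n exists. The
  accuracy 1/(1 + n) survives multiplication by sqrt n.\<close>

lemma exists_good_stage: "\<exists>K. good_stage n K"
proof -
  have e: "0 < 1 / (1 + real n)" by (simp add: add_pos_nonneg)
  have "\<forall>\<^sub>F K in sequentially. good_stage n K"
    using tendstoD[OF S_g_second_moment e] order_tendstoD(2)[OF prob_S_F_neq e]
      eventually_gt_at_top[of "lev n"] eventually_ge_at_top[of "start n"]
    by eventually_elim (auto simp: good_stage_def dist_real_def)
  then show ?thesis using eventually_happens sequentially_bot by blast
qed

text \<open>A pointwise bound owed to the coboundary form; it is o(sqrt n) because
  \<open>start n\<close> tends to infinity.\<close>

lemma S_start_le:
  assumes "0 < start n"
  shows "\<bar>real_of_int (S (F (start n)) n x)\<bar> \<le> sqrt n / start n"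
proof -
  have "real_of_int \<bar>S (F (start n)) n x\<bar> \<le> real_of_int (\<Sum>i<start n. 2 * int (shf i) * int (blk i))"
    by (simp only: of_int_le_iff S_F_bound)
  then have "\<bar>real_of_int (S (F (start n)) n x)\<bar> \<le> (\<Sum>i<start n. 2 * real (shf i) * real (blk i))" by simp
  then have "start n * \<bar>real_of_int (S (F (start n)) n x)\<bar> \<le> start n * (\<Sum>i<start n. 2 * real (shf i) * real (blk i))"
    by (intro mult_left_mono) auto
  also note start_bound
  finally show ?thesis using assms by (simp add: field_simps)
qed

definition stage :: "nat \<Rightarrow> nat" where
  "stage n = (SOME K. good_stage n K)"

lemma stage: "lev n < stage n" "start n \<le> stage n" "\<bar>mom2 (F (stage n)) n - mom2 g n\<bar> < 1 / (1 + real n)"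
    "\<P>(x in M. S (F (stage n)) n x \<noteq> S g n x) < 1 / (1 + real n)"
  using someI_ex[OF exists_good_stage[of n], folded stage_def] by (auto simp: good_stage_def)

sublocale scales start stage
  by unfold_locales (rule start_le_lev, rule stage)

lemma variance_tendsto: "(\<lambda>n. mom2 g n / real n) \<longlonglongrightarrow> 2 * ln 2"
proof -
  define V where "V n = (\<Sum>k\<in>{start n..<stage n}. var k n)" for n
  define Q where "Q n = mom2 g n" for n
  have "\<forall>\<^sub>F n in sequentially. 0 < start n" by (rule eventually_start_pos)
  then have bound: "\<forall>\<^sub>F n in sequentially. norm (Q n / n - V n / n) \<le> 1 / real (start n) + 3 / real n"
    using eventually_gt_at_top[of 0]
  proof eventually_elim
    case (elim n)
    have "mom2 (F (start n)) n \<le> n / start n"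
    proof (rule integral_le_const[OF integrable_S_F_sq])
      show "AE x in M. (real_of_int (S (F (start n)) n x))\<^sup>2 \<le> n / start n"
      proof (rule AE_I2)
        fix x
        have "\<bar>real_of_int (S (F (start n)) n x)\<bar>\<^sup>2 \<le> (sqrt n / start n)\<^sup>2"
          by (rule power_mono[OF S_start_le[OF elim(1)]]) simp
        also have "\<dots> = n / (real (start n) * real (start n))" by (simp add: power_divide power2_eq_square)
        also have "\<dots> \<le> n / (real (start n) * 1)" using elim(1) by (intro divide_left_mono mult_left_mono) auto
        finally show "(real_of_int (S (F (start n)) n x))\<^sup>2 \<le> n / start n" by simp
      qed
    qed
    moreover have "0 \<le> mom2 (F (start n)) n" by simp
    moreover have "1 / (1 + real n) \<le> 1" "2 / (1 + real n) \<le> 2" by (auto simp: field_simps)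
    \<comment> \<open>The constant is 1 + 2: passage from the stage to \<open>g\<close>, and the
      accumulated tolerances. The term n / start n comes from the summands below
      \<open>start n\<close>.\<close>
    ultimately have "\<bar>Q n - V n\<bar> \<le> n / start n + 3"
      using stage(3)[of n] F_second_moment[OF stage(2)[of n]] sum_tol_le[of n "stage n"]
      unfolding Q_def V_def by linarith
    then have "\<bar>Q n - V n\<bar> / n \<le> (n / start n + 3) / n" by (rule divide_right_mono) simp
    also have "\<dots> = 1 / real (start n) + 3 / real n" using elim(2) by (simp add: add_divide_distrib)
    finally show ?case by (simp add: abs_divide flip: diff_divide_distrib)
  qed
  have lim: "(\<lambda>n. 1 / real (start n) + 3 / real n) \<longlonglongrightarrow> 0 + 0"
    by (intro tendsto_add lim_const_over_n filterlim_compose[OF lim_const_over_n filterlim_start])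
  have "(\<lambda>n. Q n / n - V n / n) \<longlonglongrightarrow> 0"
    by (rule Lim_null_comparison[OF bound]) (use lim in simp)
  from tendsto_add[OF this var_tendsto[folded V_def]] show ?thesis by (simp add: Q_def)
qed

text \<open>Three replacements, each with an error that is small after multiplication by sqrt n:
  \<open>g\<close> by its stage; the summands from \<open>start n\<close> on by the model, which
  gives \<open>Phi_prob\<close> at A x - z with A the sum of the earlier ones; and A x - z by -z in
  the Gaussian.\<close>

lemma local_limit:
  assumes e: "0 < e"
  shows "\<forall>\<^sub>F n in sequentially. \<forall>z::int. \<bar>sqrt (real n) * \<P>(x in M. S g n x = z)
    - exp (- (real_of_int z)\<^sup>2 / (2 * real n * (2 * ln 2))) / sqrt (2 * pi * (2 * ln 2))\<bar> \<le> e"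
proof -
  define \<gamma> where "\<gamma> n z = exp (- z\<^sup>2 / (2 * real n * (2 * ln 2))) / sqrt (2 * pi * (2 * ln 2))" for n z
  have "\<forall>\<^sub>F n in sequentially. 0 < start n" by (rule eventually_start_pos)
  moreover have "\<forall>\<^sub>F n in sequentially. 1 / real (start n) < e / 4"
    using order_tendstoD(2)[OF filterlim_compose[OF lim_const_over_n filterlim_start, of 1], of "e / 4"] e by simp
  moreover have "\<forall>\<^sub>F n in sequentially. 3 / sqrt (real n) < e / 4"
  proof -
    have "(\<lambda>n. 3 * (1 / sqrt (real n))) \<longlonglongrightarrow> 3 * 0"
      by (intro tendsto_mult tendsto_const lim_1_over_real_power tendsto_divide_0[OF tendsto_const]
          filterlim_at_top_imp_at_infinity filterlim_compose[OF sqrt_at_top filterlim_real_sequentially])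
    from order_tendstoD(2)[OF this, of "e / 4"] show ?thesis using e by simp
  qed
  moreover have "\<forall>\<^sub>F n in sequentially. \<forall>z. \<bar>sqrt (real n) * Phi_prob (start n) (stage n) n z - \<gamma> n z\<bar> \<le> e / 4"
    unfolding \<gamma>_def by (rule Phi_prob_LLT) (use e in simp)
  ultimately have "\<forall>\<^sub>F n in sequentially. \<forall>z::int. \<bar>sqrt (real n) * \<P>(x in M. S g n x = z) - \<gamma> n z\<bar> \<le> e"
    using eventually_gt_at_top[of 0]
  proof eventually_elim
    case (elim n)
    show ?case
    proof
      fix z :: int
      define A where "A x = real_of_int (S (F (start n)) n x)" for x
      define p where "p y = Phi_prob (start n) (stage n) n y" for y
      define E where "E = (\<integral>x. p (A x - z) \<partial>M)"
      have sn: "0 < sqrt n" using elim(5) by simp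
      have "\<bar>\<P>(x in M. S g n x = z) - \<P>(x in M. S (F (stage n)) n x = z)\<bar>
          \<le> \<P>(x in M. S (F (stage n)) n x \<noteq> S g n x)"
      proof -
        have "\<P>(x in M. S g n x = z) \<le> prob ({x \<in> space M. S (F (stage n)) n x = z} \<union> {x \<in> space M. S (F (stage n)) n x \<noteq> S g n x})"
          by (rule finite_measure_mono) auto
        also have "\<dots> \<le> \<P>(x in M. S (F (stage n)) n x = z) + \<P>(x in M. S (F (stage n)) n x \<noteq> S g n x)"
          by (rule measure_Un_le) auto
        finally have 1: "\<P>(x in M. S g n x = z) \<le> \<dots>" .
        have "\<P>(x in M. S (F (stage n)) n x = z) \<le> prob ({x \<in> space M. S g n x = z} \<union> {x \<in> space M. S (F (stage n)) n x \<noteq> S g n x})"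
          by (rule finite_measure_mono) auto
        also have "\<dots> \<le> \<P>(x in M. S g n x = z) + \<P>(x in M. S (F (stage n)) n x \<noteq> S g n x)"
          by (rule measure_Un_le) auto
        finally show ?thesis using 1 by linarith
      qed
      moreover have "\<bar>\<P>(x in M. S (F (stage n)) n x = z) - E\<bar> \<le> 2 / (1 + real n)"
        using F_local_prob[OF order_refl stage(2)[of n], of z] sum_tol_le[of n "stage n"]
        by (simp add: E_def p_def A_def)
      ultimately have "\<bar>\<P>(x in M. S g n x = z) - E\<bar> \<le> 1 / (1 + real n) + 2 / (1 + real n)"
        using stage(4)[of n] by linarith
      also have "\<dots> = 3 / (1 + real n)" by (simp flip: add_divide_distrib)
      also have "\<dots> \<le> 3 / (sqrt n * sqrt n)" using elim(5) by (intro divide_left_mono) auto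
      finally have "sqrt n * \<bar>\<P>(x in M. S g n x = z) - E\<bar> \<le> sqrt n * (3 / (sqrt n * sqrt n))"
        using sn by (intro mult_left_mono) auto
      also have "\<dots> = 3 / sqrt n" using sn by (simp add: field_simps)
      finally have b1: "\<bar>sqrt n * \<P>(x in M. S g n x = z) - sqrt n * E\<bar> \<le> 3 / sqrt n"
        using sn by (simp add: abs_mult flip: right_diff_distrib)
      have pm: "integrable M (\<lambda>x. sqrt n * p (A x - z) - \<gamma> n z)"
      proof -
        have "integrable M (\<lambda>x. p (A x - z))" unfolding A_def
          by (rule integrable_S_F[where u="\<lambda>c. p (real_of_int c - z)" and B=1]) (simp add: p_def abs_Phi_prob_le)
        then show ?thesis by simp
      qed
      have "sqrt n * E - \<gamma> n z = (\<integral>x. sqrt n * p (A x - z) - \<gamma> n z \<partial>M)"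
      proof -
        have "integrable M (\<lambda>x. p (A x - z))" unfolding A_def
          by (rule integrable_S_F[where u="\<lambda>c. p (real_of_int c - z)" and B=1]) (simp add: p_def abs_Phi_prob_le)
        then show ?thesis by (simp add: E_def prob_space)
      qed
      also have "\<bar>\<dots>\<bar> \<le> (\<integral>x. \<bar>sqrt n * p (A x - z) - \<gamma> n z\<bar> \<partial>M)" by (rule integral_abs_bound)
      also have "\<dots> \<le> e / 4 + e / 4"
      proof (rule integral_le_const)
        show "integrable M (\<lambda>x. \<bar>sqrt n * p (A x - z) - \<gamma> n z\<bar>)" using pm by (rule integrable_abs)
        show "AE x in M. \<bar>sqrt n * p (A x - z) - \<gamma> n z\<bar> \<le> e / 4 + e / 4"
        proof (rule AE_I2)
          fix x
          \<comment> \<open>The Gaussian is even, so the profile at A x - z may be compared with the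
            one at -z, a shift by A x.\<close>
          have "\<gamma> n z = \<gamma> n (- z)" by (simp add: \<gamma>_def)
          moreover have "\<bar>\<gamma> n (A x - z) - \<gamma> n (- z)\<bar> \<le> \<bar>(A x - z) - (- z)\<bar> / sqrt n"
            unfolding \<gamma>_def by (rule gauss_shift) (use ln2_ge_two_thirds elim(5) in auto)
          moreover have "\<bar>(A x - z) - (- z)\<bar> / sqrt n \<le> (sqrt n / start n) / sqrt n"
            using S_start_le[OF elim(1), of x] sn by (intro divide_right_mono) (auto simp: A_def)
          moreover have "(sqrt n / start n) / sqrt n = 1 / start n" using sn by simp
          moreover have "\<bar>sqrt n * p (A x - z) - \<gamma> n (A x - z)\<bar> \<le> e / 4" using elim(4) by (simp add: p_def)
          ultimately show "\<bar>sqrt n * p (A x - z) - \<gamma> n z\<bar> \<le> e / 4 + e / 4" using elim(2) by linarith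
        qed
      qed
      finally have "\<bar>sqrt n * E - \<gamma> n z\<bar> \<le> e / 4 + e / 4" .
      then show "\<bar>sqrt (real n) * \<P>(x in M. S g n x = z) - \<gamma> n z\<bar> \<le> e" using b1 elim(3) e by linarith
    qed
  qed
  then show ?thesis by (simp only: \<gamma>_def)
qed

lemma g_LCLT: "lattice_LCLT M T g"
proof -
  define v :: real where "v = 2 * ln 2"
  define D where "D n z = \<bar>sqrt (real n) * \<P>(y in M. S g n y = z)
      - exp (- (real_of_int z)\<^sup>2 / (2 * real n * v)) / sqrt (2 * pi * v)\<bar>" for n and z :: int
  have "(\<lambda>n. SUP z. D n z) \<longlonglongrightarrow> 0"
  proof (rule LIMSEQ_I)
    fix e :: real assume "0 < e"
    then have "\<forall>\<^sub>F n in sequentially. \<forall>z. D n z \<le> e / 2"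
      using local_limit[of "e / 2"] by (simp add: D_def v_def)
    then have "\<forall>\<^sub>F n in sequentially. norm ((SUP z. D n z) - 0) < e"
    proof eventually_elim
      case (elim n)
      then have "(SUP z. D n z) \<le> e / 2" by (intro cSUP_least) auto
      \<comment> \<open>A real supremum is meaningful only for a bounded family; the uniform
        estimate supplies boundedness as well.\<close>
      moreover have "bdd_above (range (D n))" by (rule bdd_aboveI[of _ "e / 2"]) (use elim in auto)
      then have "D n 0 \<le> (SUP z. D n z)" by (intro cSUP_upper) auto
      moreover have "0 \<le> D n 0" by (simp add: D_def)
      ultimately show ?case using \<open>0 < e\<close> by simp
    qed
    then show "\<exists>no. \<forall>n\<ge>no. norm ((SUP z. D n z) - 0) < e" by (simp add: eventually_sequentially)
  qed
  moreover have "(L2_norm M (\<lambda>x. real_of_int (S g n x)))\<^sup>2 = mom2 g n" for n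
    by (simp add: L2_norm_def)
  ultimately show ?thesis
    unfolding lattice_LCLT_def using variance_tendsto
    by (intro exI[of _ v]) (simp add: v_def D_def)
qed

end

theorem mainTheorem1:
  fixes M :: "'a measure" and T :: "'a \<Rightarrow> 'a"
  assumes "standard_prob_space M"
    and "measure_preserving_map M T"
    and "ergodic_map M T"
    and "aperiodic_map M T"
  shows "\<exists>f :: 'a \<Rightarrow> int.
           f \<in> measurable M (count_space UNIV) \<and>
           integrable M (\<lambda>x. (real_of_int (f x))\<^sup>2) \<and>
           (\<integral>x. real_of_int (f x) \<partial>M) = 0 \<and>
           lattice_LCLT M T f"
proof -
  interpret prob_space M using assms(1) by (simp add: standard_prob_space_def)
  interpret ergodic_pt M T by unfold_locales (use assms in auto)
  obtain f where f: "\<And>k. increment k (\<lambda>x. \<Sum>i<k. f i x) (f k)"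
    by (rule exists_increments[OF assms(1,4)]) (rule that)
  interpret increments M T f by unfold_locales (rule f)
  show ?thesis using g_measurable integrable_g_sq g_mean g_LCLT by blast
qed

end
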